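(* Consider the sparse logistic regression model with fixed design matrix $X\in\mathbb{R}^{n\times d}$ (rows $\mathbf{x}_1,\dots,\mathbf{x}_n$) of rank $r$, any $r$ columns of which are linearly independent: $Y_1,\dots,Y_n$ are independent, $Y_i\sim Bin(1,p_i)$, $\ln\frac{p_i}{1-p_i}=\boldsymbol\beta^t\mathbf{x}_i$. Let $0<\delta<1/2$, let $\widehat M$ be the model selected by penalized maximum likelihood with the complexity penalty $$Pen(|M|)=c\,|M|\ln\frac{de}{|M|},\ |M|=1,\dots,r-1,\qquad Pen(r)=c\,r,\qquad c>\frac{4}{\delta(1-\delta)},$$ and let $\widehat\eta_{\widehat M}(\mathbf{x})=I\{\widehat{\boldsymbol\beta}_{\widehat M}^t\mathbf{x}\ge 0\}$ be the corresponding plug-in classifier. Then there is a constant $C_1>0$ such that, simultaneously for all $1\le d_0\le r$, $$\sup\ \mathcal{E}_X(\widehat\eta_{\widehat M},\eta^* )\ \le\ C_1\sqrt{\frac{1}{\delta(1-\delta)}\ \frac{\min\left(d_0\ln\frac{de}{d_0},\,r\right)}{n}},$$ where the supremum is over all $\eta^*\in\mathcal{C}(d_0)$, i.e. over all Bayes classifiers $\eta^*(\mathbf{x})=I\{\boldsymbol\beta^t\mathbf{x}\ge0\}$ of models with $\boldsymbol\beta\in\mathbb{R}^d$, $\|\boldsymbol\beta\|_0\le d_0$, and $\delta<p_i<1-\delta$ for all $i=1,\dots,n$. The constant $C_1$ depends at most on $c$ (not on $n,d,r,d_0,X,\boldsymbol\beta$).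
   Context: $\|\boldsymbol\beta\|_0$ is the number of nonzero entries of $\boldsymbol\beta$. A model is a subset $M\subseteq\{1,\dots,d\}$ of size $|M|$; $\mathcal{B}_M=\{\boldsymbol\beta\in\mathbb{R}^d:\beta_j=0\text{ if }j\notin M\}$. The maximum likelihood estimator for model $M$ is $$\widehat{\boldsymbol\beta}_M=\arg\max_{\widetilde{\boldsymbol\beta}\in\mathcal{B}_M}\sum_{i=1}^n\left\{\widetilde{\boldsymbol\beta}^t\mathbf{x}_iY_i-\ln(1+\exp(\widetilde{\boldsymbol\beta}^t\mathbf{x}_i))\right\}.$$ The penalized maximum likelihood model selection rule is $$\widehat M=\arg\min_{M:\,|M|\le r}\left\{\sum_{i=1}^n\left(\ln(1+\exp(\widehat{\boldsymbol\beta}_M^t\mathbf{x}_i))-\widehat{\boldsymbol\beta}_M^t\mathbf{x}_iY_i\right)+Pen(|M|)\right\},$$ with the convention $Pen(0)=0$. For a classifier $\eta$ the misclassification error is $R_X(\eta)=\frac1n\sum_{i=1}^nP(Y_i\ne\eta(\mathbf{x}_i))$; for a classifier $\widehat\eta$ built from the data it is the conditional error given the data, where the $Y_i$ to be predicted are new independent $Bin(1,p_i)$ variables. The misclassification excess risk is $\mathcal{E}_X(\widehat\eta,\eta^* )=E R_X(\widehat\eta)-R_X(\eta^* )$ with $\eta^*(\mathbf{x})=I\{\boldsymbol\beta^t\mathbf{x}\ge0\}$ the Bayes classifier for the true $\boldsymbol\beta$; equivalently $\mathcal{E}_X(\widehat\eta,\eta^* )=\frac1n\sum_{i=1}^nP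(\widehat\eta(\mathbf{x}_i)\ne\eta^*(\mathbf{x}_i))\,|2p_i-1|$.
   Formalization: For (quasi-)separated responses the maximum likelihood estimator does not exist; there it is replaced by a maximizing sequence whose linear predictors converge in [-∞,∞] at the design points, and the selection criterion and plug-in classifier use these limits. *)

theory Defs
  imports
    "HOL-Probability.Probability"
    "Jordan_Normal_Form.DL_Rank"
begin

unbundle no inner_syntax
unbundle no vec_syntax

text \<open>
  The design matrix has rows \<open>row X i\<close> for \<open>i < dim_row X\<close>; coordinates and models are indexed
  from 0, so a model is a subset of \<open>{..<dim_col X}\<close>. A response vector is a function
  \<open>y :: nat \<Rightarrow> bool\<close> of which only the values at \<open>i < dim_row X\<close> matter, with \<open>True\<close> for 1.
\<close>

definition cols_lin_indpt :: "real mat \<Rightarrow> nat set \<Rightarrow> bool" where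
  "cols_lin_indpt X J \<longleftrightarrow>
     inj_on (col X) J \<and>
     \<not> LinearCombinations.module.lin_dep class_ring (module_vec TYPE(real) (dim_row X)) (col X ` J)"

definition l0_norm :: "real vec \<Rightarrow> nat" where
  "l0_norm \<beta> = card {j. j < dim_vec \<beta> \<and> \<beta> $ j \<noteq> 0}"

definition model_space :: "nat \<Rightarrow> nat set \<Rightarrow> real vec set" where
  "model_space d M = {\<beta> \<in> carrier_vec d. \<forall>j<d. j \<notin> M \<longrightarrow> \<beta> $ j = 0}"

definition log_lik :: "real mat \<Rightarrow> (nat \<Rightarrow> bool) \<Rightarrow> real vec \<Rightarrow> real" where
  "log_lik X y \<beta> = (\<Sum>i<dim_row X. (\<beta> \<bullet> row X i) * of_bool (y i) - ln (1 + exp (\<beta> \<bullet> row X i)))"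

definition is_mle :: "real mat \<Rightarrow> (nat \<Rightarrow> bool) \<Rightarrow> nat set \<Rightarrow> real vec \<Rightarrow> bool" where
  "is_mle X y M \<beta> \<longleftrightarrow> is_arg_max (log_lik X y) (\<lambda>\<beta>. \<beta> \<in> model_space (dim_col X) M) \<beta>"

text \<open>
  For (quasi-)separated responses, which always have positive probability, the likelihood has no
  maximizer over \<open>model_space d M\<close>: it is only approached along sequences that diverge. The
  estimator is therefore represented by a sequence. It is the constant sequence of a
  maximizer whenever there is one, and otherwise a maximizing sequence whose linear predictors
  converge in \<open>[-\<infinity>, \<infinity>]\<close> at every design point. By \<open>maximizing_seq_unique\<close> below these
  limits depend only on the data and the model.
\<close>

definition maximizing_seq ::
  "real mat \<Rightarrow> (nat \<Rightarrow> bool) \<Rightarrow> nat set \<Rightarrow> (nat \<Rightarrow> real vec) \<Rightarrow> bool" where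
  "maximizing_seq X y M b \<longleftrightarrow>
     (\<forall>k. b k \<in> model_space (dim_col X) M) \<and>
     (\<lambda>k. log_lik X y (b k)) \<longlonglongrightarrow> (SUP \<beta>\<in>model_space (dim_col X) M. log_lik X y \<beta>) \<and>
     (\<forall>i<dim_row X. convergent (\<lambda>k. ereal (b k \<bullet> row X i)))"

definition mle_seq ::
  "real mat \<Rightarrow> (nat \<Rightarrow> bool) \<Rightarrow> nat set \<Rightarrow> (nat \<Rightarrow> real vec) \<Rightarrow> bool" where
  "mle_seq X y M b \<longleftrightarrow>
     (if \<exists>\<beta>. is_mle X y M \<beta> then \<exists>\<beta>. is_mle X y M \<beta> \<and> b = (\<lambda>_. \<beta>)
      else maximizing_seq X y M b)"

text \<open>For a constant sequence \<open>\<lambda>_. \<beta>\<close> the next two are \<open>I{\<beta> \<bullet> x \<ge> 0}\<close> and \<open>- log_lik X y \<beta>\<close>.\<close>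

definition plug_in :: "(nat \<Rightarrow> real vec) \<Rightarrow> real vec \<Rightarrow> bool" where
  "plug_in b x \<longleftrightarrow> 0 \<le> lim (\<lambda>k. ereal (b k \<bullet> x))"

definition neg_log_lik :: "real mat \<Rightarrow> (nat \<Rightarrow> bool) \<Rightarrow> (nat \<Rightarrow> real vec) \<Rightarrow> real" where
  "neg_log_lik X y b =
     lim (\<lambda>k. \<Sum>i<dim_row X. ln (1 + exp (b k \<bullet> row X i)) - (b k \<bullet> row X i) * of_bool (y i))"

definition Pen :: "real \<Rightarrow> nat \<Rightarrow> nat \<Rightarrow> nat \<Rightarrow> real" where
  "Pen c d r m =
     (if m = 0 then 0
      else if m < r then c * real m * ln (real d * exp 1 / real m)
      else c * real r)"

text \<open>
  \<open>bhat y M\<close> is the maximum likelihood estimator in model \<open>M\<close> and \<open>Mhat y\<close> the selected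
  model, both as functions of the responses; ties in the selection are broken arbitrarily.
\<close>

definition penalized_ml_selection ::
  "real mat \<Rightarrow> real \<Rightarrow> nat \<Rightarrow> ((nat \<Rightarrow> bool) \<Rightarrow> nat set \<Rightarrow> nat \<Rightarrow> real vec)
    \<Rightarrow> ((nat \<Rightarrow> bool) \<Rightarrow> nat set) \<Rightarrow> bool" where
  "penalized_ml_selection X c r bhat Mhat \<longleftrightarrow>
     (\<forall>y M. M \<subseteq> {..<dim_col X} \<and> card M \<le> r \<longrightarrow> mle_seq X y M (bhat y M)) \<and>
     (\<forall>y. is_arg_min (\<lambda>M. neg_log_lik X y (bhat y M) + Pen c (dim_col X) r (card M))
            (\<lambda>M. M \<subseteq> {..<dim_col X} \<and> card M \<le> r) (Mhat y))"

definition responses :: "nat \<Rightarrow> (nat \<Rightarrow> real) \<Rightarrow> (nat \<Rightarrow> bool) pmf" where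
  "responses n p = Pi_pmf {..<n} False (\<lambda>i. bernoulli_pmf (p i))"

definition misclass_error :: "real mat \<Rightarrow> (nat \<Rightarrow> real) \<Rightarrow> (real vec \<Rightarrow> bool) \<Rightarrow> real" where
  "misclass_error X p \<eta> =
     (1 / real (dim_row X)) *
       (\<Sum>i<dim_row X. measure_pmf.prob (bernoulli_pmf (p i)) {z. z \<noteq> \<eta> (row X i)})"

definition bayes :: "real vec \<Rightarrow> real vec \<Rightarrow> bool" where
  "bayes \<beta> x \<longleftrightarrow> 0 \<le> \<beta> \<bullet> x"

definition excess_risk ::
  "real mat \<Rightarrow> (nat \<Rightarrow> real) \<Rightarrow> ((nat \<Rightarrow> bool) \<Rightarrow> real vec \<Rightarrow> bool) \<Rightarrow> (real vec \<Rightarrow> bool) \<Rightarrow> real" where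
  "excess_risk X p \<eta>hat \<eta> =
     measure_pmf.expectation (responses (dim_row X) p) (\<lambda>y. misclass_error X p (\<eta>hat y))
       - misclass_error X p \<eta>"


subsection \<open>Well-definedness of the estimator\<close>

lemma plug_in_const: "plug_in (\<lambda>_. \<beta>) x \<longleftrightarrow> 0 \<le> \<beta> \<bullet> x"
  by (simp add: plug_in_def lim_def[symmetric] limI)

lemma neg_log_lik_const: "neg_log_lik X y (\<lambda>_. \<beta>) = - log_lik X y \<beta>"
  by (simp add: neg_log_lik_def log_lik_def limI sum_negf[symmetric])

lemma log_lik_nonpos: "log_lik X y \<beta> \<le> 0"
proof -
  have "t * of_bool b - ln (1 + exp t) \<le> 0" for t :: real and b
  proof -
    have "ln (exp t) \<le> ln (1 + exp t)" by (subst ln_le_cancel_iff) (auto simp: add_pos_pos)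
    moreover have "0 \<le> ln (1 + exp t)" by simp
    ultimately show ?thesis by (cases b) auto
  qed
  then show ?thesis unfolding log_lik_def by (intro sum_nonpos) blast
qed

lemma bdd_above_log_lik: "bdd_above (log_lik X y ` S)"
  by (rule bdd_aboveI[of _ 0]) (auto simp: log_lik_nonpos)

lemma zero_in_model_space: "0\<^sub>v d \<in> model_space d M"
  by (simp add: model_space_def)

lemma is_mle_imp_maximizing_seq:
  assumes "is_mle X y M \<beta>"
  shows "maximizing_seq X y M (\<lambda>_. \<beta>)"
proof -
  from assms have \<beta>: "\<beta> \<in> model_space (dim_col X) M"
    and mx: "\<And>\<gamma>. \<gamma> \<in> model_space (dim_col X) M \<Longrightarrow> log_lik X y \<gamma> \<le> log_lik X y \<beta>"
    by (auto simp: is_mle_def is_arg_max_linorder)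
  have "(SUP \<beta>\<in>model_space (dim_col X) M. log_lik X y \<beta>) = log_lik X y \<beta>"
    using \<beta> mx by (intro cSup_eq_maximum) auto
  then show ?thesis using \<beta> by (simp add: maximizing_seq_def convergent_const)
qed

lemma mle_seq_imp_maximizing_seq: "mle_seq X y M b \<Longrightarrow> maximizing_seq X y M b"
  by (auto simp: mle_seq_def is_mle_imp_maximizing_seq split: if_splits)

lemma ereal_subseq_finite:
  fixes f :: "nat \<Rightarrow> nat \<Rightarrow> ereal"
  shows "\<exists>s. strict_mono s \<and> (\<forall>i<n. convergent (\<lambda>k. f i (s k)))"
proof (induction n)
  case 0
  show ?case by (intro exI[of _ id]) (auto simp: strict_mono_def)
next
  case (Suc n)
  then obtain s where s: "strict_mono s" "\<And>i. i < n \<Longrightarrow> convergent (\<lambda>k. f i (s k))" by blast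
  obtain l t where t: "strict_mono (t :: nat \<Rightarrow> nat)" "((\<lambda>k. f n (s k)) \<circ> t) \<longlonglongrightarrow> l"
    using compact_complete_linorder by blast
  have "convergent (\<lambda>k. f i ((s \<circ> t) k))" if "i < Suc n" for i
  proof (cases "i = n")
    case True
    then show ?thesis using t(2) by (auto simp: convergent_def o_def)
  next
    case False
    then have "convergent (\<lambda>k. f i (s k))" using s(2) that by simp
    then show ?thesis
      using convergent_subseq_convergent[OF _ t(1)] by (auto simp: o_def)
  qed
  then show ?case using strict_mono_o[OF s(1) t(1)] by blast
qed

lemma maximizing_seq_exists: "\<exists>b. maximizing_seq X y M b"
proof -
  let ?B = "model_space (dim_col X) M"
  let ?s = "SUP \<beta>\<in>?B. log_lik X y \<beta>"
  have "\<exists>\<beta>\<in>?B. ?s - 1 / real (Suc k) < log_lik X y \<beta>" for k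
  proof -
    have "?s - 1 / real (Suc k) < ?s" by simp
    then show ?thesis
      using less_cSUP_iff[OF _ bdd_above_log_lik] zero_in_model_space by blast
  qed
  then obtain a where a: "\<And>k. a k \<in> ?B" "\<And>k. ?s - 1 / real (Suc k) < log_lik X y (a k)"
    by metis
  have lim: "(\<lambda>k. log_lik X y (a k)) \<longlonglongrightarrow> ?s"
  proof (rule tendsto_sandwich)
    show "\<forall>\<^sub>F k in sequentially. ?s - 1 / real (Suc k) \<le> log_lik X y (a k)"
      using a(2) by (intro always_eventually) (auto intro: less_imp_le)
    show "\<forall>\<^sub>F k in sequentially. log_lik X y (a k) \<le> ?s"
      using a(1) by (intro always_eventually allI cSUP_upper bdd_above_log_lik)
    show "(\<lambda>k. ?s - 1 / real (Suc k)) \<longlonglongrightarrow> ?s"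
      using tendsto_diff[OF tendsto_const LIMSEQ_inverse_real_of_nat, of ?s]
      by (simp add: inverse_eq_divide)
  qed simp
  obtain s where s: "strict_mono (s :: nat \<Rightarrow> nat)"
      "\<And>i. i < dim_row X \<Longrightarrow> convergent (\<lambda>k. ereal (a (s k) \<bullet> row X i))"
    using ereal_subseq_finite[of "dim_row X" "\<lambda>i k. ereal (a k \<bullet> row X i)"] by blast
  have "maximizing_seq X y M (\<lambda>k. a (s k))"
    using a(1) s LIMSEQ_subseq_LIMSEQ[OF lim s(1)] by (auto simp: maximizing_seq_def o_def)
  then show ?thesis by blast
qed

lemma mle_seq_exists: "\<exists>b. mle_seq X y M b"
  using maximizing_seq_exists[of X y M] by (cases "\<exists>\<beta>. is_mle X y M \<beta>") (auto simp: mle_seq_def)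

text \<open>
  Concavity defect of the log-likelihood at a midpoint. With \<open>u = arctan (exp (a/2))\<close> and
  \<open>v = arctan (exp (b/2))\<close> it equals \<open>ln (1 + (tan (u - v))\<^sup>2) / 2\<close>.
\<close>

definition gap :: "real \<Rightarrow> real \<Rightarrow> real" where
  "gap a b = (ln (1 + exp a) + ln (1 + exp b)) / 2 - ln (1 + exp ((a + b) / 2))"

lemma gap_eq: "gap a b = ln (1 + (tan (arctan (exp (a/2)) - arctan (exp (b/2))))\<^sup>2) / 2"
proof -
  define u v where "u = exp (a/2)" and "v = exp (b/2)"
  have pos: "u > 0" "v > 0" by (auto simp: u_def v_def)
  have ea: "exp a = u\<^sup>2" and eb: "exp b = v\<^sup>2" and em: "exp ((a + b) / 2) = u * v"
    by (simp_all add: u_def v_def power2_eq_square exp_add[symmetric] add_divide_distrib)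
  have uv: "1 + u * v > 0" using pos by (simp add: add_pos_pos)
  have bd: "0 < arctan u" "arctan u < pi/2" "0 < arctan v" "arctan v < pi/2"
    using pos arctan_ubound by auto
  have c: "cos (arctan u - arctan v) \<noteq> 0"
  proof -
    have "- (pi/2) < arctan u - arctan v" "arctan u - arctan v < pi/2" using bd by linarith+
    then show ?thesis using cos_gt_zero_pi by fastforce
  qed
  have t: "tan (arctan u - arctan v) = (u - v) / (1 + u * v)"
    using tan_diff[OF cos_arctan_not_zero cos_arctan_not_zero c] by (simp add: tan_arctan)
  have "1 + ((u - v) / (1 + u * v))\<^sup>2 = (1 + u\<^sup>2) * (1 + v\<^sup>2) / (1 + u * v)\<^sup>2"
  proof -
    have "(1 + u\<^sup>2) * (1 + v\<^sup>2) = (1 + u * v)\<^sup>2 + (u - v)\<^sup>2"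
      by (simp add: algebra_simps power2_eq_square)
    then show ?thesis using uv by (simp add: add_divide_distrib power_divide)
  qed
  then have "ln (1 + (tan (arctan u - arctan v))\<^sup>2)
      = ln (1 + u\<^sup>2) + ln (1 + v\<^sup>2) - 2 * ln (1 + u * v)"
  proof -
    have "1 + u\<^sup>2 > 0" "1 + v\<^sup>2 > 0" by (simp_all add: add_pos_nonneg)
    moreover have "ln ((1 + u * v)\<^sup>2) = 2 * ln (1 + u * v)"
      using uv by (simp add: ln_realpow)
    ultimately show ?thesis
      using uv unfolding t \<open>1 + ((u - v) / (1 + u * v))\<^sup>2 = _\<close>
      by (subst ln_div) (auto simp: ln_mult_pos)
  qed
  then show ?thesis
    by (simp add: gap_def ea eb em flip: u_def v_def)
qed

lemma gap_nonneg: "0 \<le> gap a b"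
  by (simp add: gap_eq)

lemma gap_tendsto_0_imp:
  assumes "(\<lambda>k. gap (a k) (b k)) \<longlonglongrightarrow> 0"
  shows "(\<lambda>k. arctan (exp (a k / 2)) - arctan (exp (b k / 2))) \<longlonglongrightarrow> 0"
proof -
  define w where "w k = arctan (exp (a k / 2)) - arctan (exp (b k / 2))" for k
  have "(\<lambda>k. exp (2 * gap (a k) (b k)) - 1) \<longlonglongrightarrow> exp (2 * 0) - 1"
    by (intro tendsto_intros assms)
  moreover have "exp (2 * gap (a k) (b k)) - 1 = (tan (w k))\<^sup>2" for k
  proof -
    have "0 < 1 + (tan (w k))\<^sup>2" by (simp add: add_pos_nonneg)
    then show ?thesis by (simp add: gap_eq w_def)
  qed
  ultimately have "(\<lambda>k. (tan (w k))\<^sup>2) \<longlonglongrightarrow> 0" by simp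
  then have "(\<lambda>k. tan (w k)) \<longlonglongrightarrow> 0"
    using tendsto_rabs_zero_cancel tendsto_real_sqrt[of "\<lambda>k. (tan (w k))\<^sup>2" 0] by fastforce
  then have "(\<lambda>k. arctan (tan (w k))) \<longlonglongrightarrow> arctan 0" by (intro tendsto_intros)
  moreover have "arctan (tan (w k)) = w k" for k
  proof (rule arctan_tan)
    have "0 < arctan (exp (a k / 2))" "0 < arctan (exp (b k / 2))" by simp_all
    then show "- (pi / 2) < w k" "w k < pi / 2"
      unfolding w_def using arctan_ubound[of "exp (a k / 2)"] arctan_ubound[of "exp (b k / 2)"]
      by linarith+
  qed
  ultimately show ?thesis by (simp add: w_def)
qed

lemma arctan_exp_ereal_limit:
  assumes "(\<lambda>k. ereal (a k)) \<longlonglongrightarrow> l"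
  shows "(\<lambda>k. arctan (exp (a k / 2))) \<longlonglongrightarrow>
    (case l of ereal t \<Rightarrow> arctan (exp (t/2)) | PInfty \<Rightarrow> pi/2 | MInfty \<Rightarrow> 0)"
proof (cases l)
  case (real t)
  then have "a \<longlonglongrightarrow> t" using assms by simp
  then show ?thesis using real by (auto intro!: tendsto_intros)
next
  case PInf
  then have "filterlim a at_top sequentially"
    using assms tendsto_PInfty_eq_at_top by auto
  then have "filterlim (\<lambda>k. exp (a k * (1/2))) at_top sequentially"
    by (intro filterlim_compose[OF exp_at_top] filterlim_at_top_mult_tendsto_pos[OF tendsto_const]) auto
  then show ?thesis using PInf by (auto intro: filterlim_compose[OF tendsto_arctan_at_top])
next
  case MInf
  then have "filterlim a at_bot sequentially"
    using assms by (simp add: tendsto_MInfty filterlim_at_bot_dense)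
  then have "filterlim (\<lambda>k. a k * (1/2)) at_bot sequentially"
    unfolding filterlim_uminus_at_bot
    using filterlim_at_top_mult_tendsto_pos[OF tendsto_const[of "1/2::real"], of "\<lambda>k. - a k" sequentially]
    by simp
  then have "(\<lambda>k. exp (a k * (1/2))) \<longlonglongrightarrow> 0"
    by (rule filterlim_compose[OF exp_at_bot])
  then have "(\<lambda>k. arctan (exp (a k * (1/2)))) \<longlonglongrightarrow> arctan 0" by (intro tendsto_intros)
  then show ?thesis using MInf by simp
qed

lemma arctan_exp_ereal_inj:
  assumes "(case l of ereal t \<Rightarrow> arctan (exp (t/2)) | PInfty \<Rightarrow> pi/2 | MInfty \<Rightarrow> 0)
         = (case l' of ereal t \<Rightarrow> arctan (exp (t/2)) | PInfty \<Rightarrow> pi/2 | MInfty \<Rightarrow> (0::real))"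
  shows "l = l'"
proof -
  have "arctan (exp (t/2)) \<noteq> pi/2" "pi/2 \<noteq> arctan (exp (t/2))" for t :: real
    using arctan_ubound[of "exp (t/2)"] by auto
  then show ?thesis
    using assms by (cases l; cases l') (auto simp: arctan_eq_iff)
qed

lemma log_lik_midpoint:
  assumes "\<beta> \<in> carrier_vec (dim_col X)" "\<gamma> \<in> carrier_vec (dim_col X)"
  shows "log_lik X y ((1/2) \<cdot>\<^sub>v (\<beta> + \<gamma>)) =
    (log_lik X y \<beta> + log_lik X y \<gamma>) / 2 + (\<Sum>i<dim_row X. gap (\<beta> \<bullet> row X i) (\<gamma> \<bullet> row X i))"
proof -
  have eq: "((1/2) \<cdot>\<^sub>v (\<beta> + \<gamma>)) \<bullet> row X i = (\<beta> \<bullet> row X i + \<gamma> \<bullet> row X i) / 2" if "i < dim_row X" for i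
  proof -
    have "row X i \<in> carrier_vec (dim_col X)" by simp
    then show ?thesis
      using assms by (simp add: add_scalar_prod_distrib[of _ "dim_col X"])
  qed
  show ?thesis
    unfolding log_lik_def sum.distrib[symmetric] sum_divide_distrib
  proof (intro sum.cong refl)
    fix i assume "i \<in> {..<dim_row X}"
    then have i: "i < dim_row X" by simp
    show "((1/2) \<cdot>\<^sub>v (\<beta> + \<gamma>)) \<bullet> row X i * of_bool (y i) - ln (1 + exp (((1/2) \<cdot>\<^sub>v (\<beta> + \<gamma>)) \<bullet> row X i)) =
      (\<beta> \<bullet> row X i * of_bool (y i) - ln (1 + exp (\<beta> \<bullet> row X i)) +
       (\<gamma> \<bullet> row X i * of_bool (y i) - ln (1 + exp (\<gamma> \<bullet> row X i)))) / 2 +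
      gap (\<beta> \<bullet> row X i) (\<gamma> \<bullet> row X i)"
      unfolding eq[OF i] gap_def by (simp add: field_simps)
  qed
qed

theorem maximizing_seq_unique:
  assumes "maximizing_seq X y M b" "maximizing_seq X y M b'" and i: "i < dim_row X"
  shows "lim (\<lambda>k. ereal (b k \<bullet> row X i)) = lim (\<lambda>k. ereal (b' k \<bullet> row X i))"
proof -
  let ?B = "model_space (dim_col X) M"
  let ?s = "SUP \<beta>\<in>?B. log_lik X y \<beta>"
  let ?g = "\<lambda>k j. gap (b k \<bullet> row X j) (b' k \<bullet> row X j)"
  have in_B: "b k \<in> ?B" "b' k \<in> ?B" for k using assms by (auto simp: maximizing_seq_def)
  have lims: "(\<lambda>k. log_lik X y (b k)) \<longlonglongrightarrow> ?s" "(\<lambda>k. log_lik X y (b' k)) \<longlonglongrightarrow> ?s"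
    using assms by (auto simp: maximizing_seq_def)
  have bound: "?g k i \<le> ?s - (log_lik X y (b k) + log_lik X y (b' k)) / 2" for k
  proof -
    have c: "b k \<in> carrier_vec (dim_col X)" "b' k \<in> carrier_vec (dim_col X)"
      using in_B by (auto simp: model_space_def)
    then have "(1/2) \<cdot>\<^sub>v (b k + b' k) \<in> ?B"
      using in_B[of k] by (auto simp: model_space_def)
    then have "log_lik X y ((1/2) \<cdot>\<^sub>v (b k + b' k)) \<le> ?s"
      by (intro cSUP_upper bdd_above_log_lik)
    moreover have "?g k i \<le> (\<Sum>j<dim_row X. ?g k j)"
      using i by (intro member_le_sum) (auto simp: gap_nonneg)
    ultimately show ?thesis using log_lik_midpoint[OF c, of y] by linarith
  qed
  have "(\<lambda>k. ?g k i) \<longlonglongrightarrow> 0"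
  proof (rule tendsto_sandwich)
    show "\<forall>\<^sub>F k in sequentially. 0 \<le> ?g k i" by (simp add: gap_nonneg)
    show "(\<lambda>_. 0) \<longlonglongrightarrow> (0 :: real)" by simp
    have "(\<lambda>k. ?s - (log_lik X y (b k) + log_lik X y (b' k)) / 2) \<longlonglongrightarrow> ?s - (?s + ?s) / 2"
      by (intro tendsto_intros lims) auto
    then show "(\<lambda>k. ?s - (log_lik X y (b k) + log_lik X y (b' k)) / 2) \<longlonglongrightarrow> 0" by simp
    show "\<forall>\<^sub>F k in sequentially. ?g k i \<le> ?s - (log_lik X y (b k) + log_lik X y (b' k)) / 2"
      using bound by (intro always_eventually) blast
  qed
  from gap_tendsto_0_imp[OF this]
  have d: "(\<lambda>k. arctan (exp ((b k \<bullet> row X i) / 2)) - arctan (exp ((b' k \<bullet> row X i) / 2))) \<longlonglongrightarrow> 0" .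
  obtain l l' where l: "(\<lambda>k. ereal (b k \<bullet> row X i)) \<longlonglongrightarrow> l" "(\<lambda>k. ereal (b' k \<bullet> row X i)) \<longlonglongrightarrow> l'"
    using assms(1)[unfolded maximizing_seq_def convergent_def]
      assms(2)[unfolded maximizing_seq_def convergent_def] i by meson
  note L = arctan_exp_ereal_limit[OF l(1)] arctan_exp_ereal_limit[OF l(2)]
  have "l = l'"
    using LIMSEQ_unique[OF tendsto_diff[OF L] d] by (intro arctan_exp_ereal_inj) simp
  then show ?thesis using l by (simp add: limI)
qed

end

theory Submission
  imports Defs
begin

text \<open>
  Write \<open>\<lambda> = 9/20 \<delta> (1 - \<delta>)\<close>, so that \<open>\<lambda> c > 9/5\<close>. The heart of the proof is a sharp moment bound: if \<open>k\<close>
  linear predictors span the model, then \<open>\<lambda>\<close> times the supremum over the model of the log-likelihood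
  ratio to the truth has exponential moment at most \<open>(25/7)\<^sup>k\<close>. The observations are replaced one
  at a time: the \<open>\<lambda>\<close>-th power of the likelihood ratio of one observation is dominated by a three-point mixture
  of \<open>1\<close> and \<open>exp (\<plusminus>q m u - (m u)\<^sup>2/2)\<close>, \<open>q = 24/25\<close>, where \<open>u\<close> is the change of the predictor. The two
  responses have different maximizers; concavity of the remaining exponents is what makes the suprema
  comparable. In the end the supremum is a quadratic form in random signs, with exponential
  moment at most \<open>(1 - q\<^sup>2) powr (- k/2) = (25/7)\<^sup>k\<close>.

  As \<open>\<lambda> c > 9/5\<close>, the penalty outweighs the entropy of the models, so the penalized log-likelihood
  ratio is bounded over all models at once. One percent of it is traded, through the concavity gap at the
  midpoint of the estimate and the truth, for the sum of \<open>(p\<^sub>i - 1/2)\<^sup>2\<close> over the rows where the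
  classifiers disagree; the weights \<open>2 \<bar>p\<^sub>i - 1/2\<bar>\<close> of the excess risk then follow by the inequality of means.
\<close>

section \<open>The likelihood ratio of a single observation\<close>

text \<open>At one fixed predictor change the averaged tilted likelihood ratio is at most 1. Under a
  supremum, however, the two responses select different changes \<open>u1\<close> and
  \<open>u0\<close>, and the first-order terms no longer cancel. So
  \<open>p * tilt l p (- u1) + (1 - p) * tilt l (1 - p) u0\<close> has to be bounded for unrelated
  \<open>u0\<close>, \<open>u1\<close>. Near 0 the slope \<open>13/50 * 24/25 * 19/10\<close> of the
  comparison must exceed the slope \<open>9/20\<close> of the tilt, both in units of
  \<open>(p * (1 - p))^2\<close>. Far out in a common direction \<open>gauss\<close> vanishes, while
  the left side tends to \<open>p powr (1 - l)\<close> or \<open>(1 - p) powr (1 - l)\<close>; the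
  atom at 1, of weight \<open>1 - a\<close>, has to cover this, which bounds \<open>a\<close> in
  terms of \<open>min p (1 - p)\<close>. And \<open>q < 1\<close> is what keeps the Gaussian moment
  finite. The constants meet these demands together. The arguments of \<open>gauss\<close> may be
  chosen anywhere between \<open>u0\<close> and \<open>u1\<close>, since concavity controls the
  whole segment. This freedom is essential: \<open>gauss\<close> is not monotone.\<close>

text \<open>If a response had probability \<open>a\<close> and the predictor moves by
  \<open>u\<close> against that response, its likelihood is multiplied by
  \<open>1 / (a + (1 - a) * exp u)\<close>; this is the \<open>l\<close>-th power of that factor. A
  response \<open>True\<close> thus contributes \<open>tilt l p (- u)\<close>, a response
  \<open>False\<close> contributes \<open>tilt l (1 - p) u\<close>.\<close>

definition tilt :: "real \<Rightarrow> real \<Rightarrow> real \<Rightarrow> real" where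
  "tilt l a u = (a + (1 - a) * exp u) powr - l"

definition gauss :: "real \<Rightarrow> real" where
  "gauss v = exp (24/25 * v - v\<^sup>2 / 2)"

text \<open>Expected tilted ratio of one observation with success probability \<open>a\<close>.
  Exchanging \<open>a\<close> and \<open>1 - a\<close> amounts to changing the sign of
  \<open>y\<close>, so only \<open>0 \<le> y\<close> is studied below.\<close>

definition mean_tilt :: "real \<Rightarrow> real \<Rightarrow> real \<Rightarrow> real" where
  "mean_tilt l a y = (1 - a) * tilt l (1 - a) y + a * tilt l a (- y)"

lemma tilt_base_pos: "0 < a \<Longrightarrow> a < 1 \<Longrightarrow> 0 < a + (1 - a) * exp (u::real)"
  by (simp add: add_pos_pos)

lemma tilt_pos: "0 < a \<Longrightarrow> a < 1 \<Longrightarrow> 0 < tilt l a u"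
  using tilt_base_pos[of a u] by (simp add: tilt_def)

lemma tilt_0 [simp]: "tilt l a 0 = 1"
  by (simp add: tilt_def)

lemma tilt_antimono:
  assumes "0 < a" "a < 1" "0 \<le> l" "u \<le> v"
  shows "tilt l a v \<le> tilt l a u"
  unfolding tilt_def using assms tilt_base_pos[of a u]
  by (intro powr_mono2') auto

lemma tilt_deriv:
  assumes "0 < a" "a < 1"
  shows "(tilt l a has_real_derivative - l * ((1 - a) * exp u * (a + (1 - a) * exp u) powr (- l - 1))) (at u)"
  unfolding tilt_def using tilt_base_pos[OF assms, of u]
  by (auto intro!: derivative_eq_intros simp: field_simps)

lemma reflect_base:
  fixes a u l :: real
  assumes "0 < a" "a < 1"
  shows "exp (- u) * (a + (1 - a) * exp (- u)) powr (- l - 1) = exp (l * u) * ((1 - a) + a * exp u) powr (- l - 1)"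
proof -
  have "a + (1 - a) * exp (- u) = exp (- u) * ((1 - a) + a * exp u)"
    by (simp add: algebra_simps flip: exp_add)
  moreover have "0 < (1 - a) + a * exp u" using assms by (simp add: add_pos_pos)
  ultimately have "(a + (1 - a) * exp (- u)) powr (- l - 1)
      = exp (- u) powr (- l - 1) * ((1 - a) + a * exp u) powr (- l - 1)"
    by (simp add: powr_mult)
  moreover have "exp (- u) * exp (- u) powr (- l - 1) = exp (l * u)"
    by (simp add: powr_def algebra_simps flip: exp_add)
  ultimately show ?thesis by (metis mult.assoc)
qed

lemma tilt_neg_deriv:
  assumes "0 < a" "a < 1"
  shows "((\<lambda>y. tilt l a (- y)) has_real_derivative
    l * (1 - a) * (exp (l * y) * ((1 - a) + a * exp y) powr (- l - 1))) (at y)"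
proof -
  have "((\<lambda>y. tilt l a (- y)) has_real_derivative
      (- l * ((1 - a) * exp (- y) * (a + (1 - a) * exp (- y)) powr (- l - 1))) * (- 1)) (at y)"
    by (rule DERIV_chain2[OF tilt_deriv[OF assms]]) (auto intro!: derivative_eq_intros)
  then show ?thesis using reflect_base[OF assms, of y l] by (simp add: mult.assoc)
qed

text \<open>\<open>reflect_base\<close> brings both summands to the base
  \<open>(1 - a) + a * exp y\<close>, so the sign is that of
  \<open>exp y - exp (l * y)\<close>.\<close>

lemma mean_tilt_deriv:
  assumes "0 < a" "a < 1"
  shows "(mean_tilt l a has_real_derivative
    - (l * a * (1 - a) * ((exp y - exp (l * y)) * ((1 - a) + a * exp y) powr (- l - 1)))) (at y)"
proof -
  have 1: "((\<lambda>y. (1 - a) * tilt l (1 - a) y) has_real_derivative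
      (1 - a) * (- l * ((1 - (1 - a)) * exp y * ((1 - a) + (1 - (1 - a)) * exp y) powr (- l - 1)))) (at y)"
    using assms by (intro DERIV_cmult tilt_deriv) auto
  have 2: "((\<lambda>y. a * tilt l a (- y)) has_real_derivative
      a * (l * (1 - a) * (exp (l * y) * ((1 - a) + a * exp y) powr (- l - 1)))) (at y)"
    by (intro DERIV_cmult tilt_neg_deriv assms)
  have "((\<lambda>y. (1 - a) * tilt l (1 - a) y + a * tilt l a (- y)) has_real_derivative
    - (l * a * (1 - a) * ((exp y - exp (l * y)) * ((1 - a) + a * exp y) powr (- l - 1)))) (at y)"
    using DERIV_add[OF 1 2] by (simp add: algebra_simps)
  then show ?thesis unfolding mean_tilt_def [abs_def] .
qed

lemma mean_tilt_0 [simp]: "mean_tilt l a 0 = 1"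
  by (simp add: mean_tilt_def)

lemma deriv_nonneg_mono:
  fixes f :: "real \<Rightarrow> real"
  assumes "a \<le> b" "\<And>x. a \<le> x \<Longrightarrow> x \<le> b \<Longrightarrow> (f has_real_derivative f' x) (at x)"
    "\<And>x. a \<le> x \<Longrightarrow> x \<le> b \<Longrightarrow> 0 \<le> f' x"
  shows "f a \<le> f b"
  using assms by (intro DERIV_nonneg_imp_nondecreasing[of a b f]) auto

lemma exp_diff_nonneg:
  fixes l y :: real
  assumes "l \<le> 1" "0 \<le> y" shows "0 \<le> exp y - exp (l * y)"
  using assms mult_right_mono[of l 1 y] by simp

lemma mean_tilt_antimono:
  assumes a: "0 < a" "a < 1" and l: "0 \<le> l" "l \<le> 1" and y: "0 \<le> x" "x \<le> y"
  shows "mean_tilt l a y \<le> mean_tilt l a x"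
proof -
  have "- mean_tilt l a x \<le> - mean_tilt l a y"
    by (rule deriv_nonneg_mono[OF y(2), of _ "\<lambda>y. l * a * (1 - a) * ((exp y - exp (l * y)) * ((1 - a) + a * exp y) powr (- l - 1))"])
       (use a l y in \<open>auto intro!: derivative_eq_intros mean_tilt_deriv mult_nonneg_nonneg exp_diff_nonneg\<close>)
  then show ?thesis by simp
qed

lemma weights_le:
  fixes p y :: real
  assumes "p \<le> 1/2" "0 \<le> y"
  shows "(1 - p) + p * exp y \<le> p + (1 - p) * exp y"
proof -
  have "0 \<le> (1 - 2 * p) * (exp y - 1)" using assms by simp
  then show ?thesis by (simp add: algebra_simps)
qed

text \<open>The two derivatives differ only in the base under the negative power, and
  \<open>weights_le\<close> orders the bases. For \<open>p \<le> 1/2\<close> the loss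
  \<open>1 - mean_tilt\<close> is therefore the weaker one in the negative direction.\<close>

lemma mean_tilt_swap:
  assumes p: "0 < p" "p \<le> 1/2" and l: "0 \<le> l" "l \<le> 1" and y: "0 \<le> y"
  shows "mean_tilt l p y \<le> mean_tilt l (1 - p) y"
proof -
  let ?D = "\<lambda>a y. l * a * (1 - a) * ((exp y - exp (l * y)) * ((1 - a) + a * exp y) powr (- l - 1))"
  have "mean_tilt l (1 - p) 0 - mean_tilt l p 0 \<le> mean_tilt l (1 - p) y - mean_tilt l p y"
  proof (rule deriv_nonneg_mono[OF y, where f' = "\<lambda>y. - ?D (1 - p) y - (- ?D p y)"])
    show "((\<lambda>y. mean_tilt l (1 - p) y - mean_tilt l p y) has_real_derivative - ?D (1 - p) x - (- ?D p x)) (at x)" for x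
      using p by (intro DERIV_diff mean_tilt_deriv) auto
    fix x :: real assume x: "0 \<le> x"
    have b: "(p + (1 - p) * exp x) powr (- l - 1) \<le> ((1 - p) + p * exp x) powr (- l - 1)"
      using p l x weights_le[of p x] by (intro powr_mono2') (auto simp: add_pos_pos)
    have "l * p * (1 - p) * ((exp x - exp (l * x)) * (p + (1 - p) * exp x) powr (- l - 1))
        \<le> l * p * (1 - p) * ((exp x - exp (l * x)) * ((1 - p) + p * exp x) powr (- l - 1))"
      using p l x by (intro mult_left_mono b exp_diff_nonneg) auto
    then show "0 \<le> - ?D (1 - p) x - (- ?D p x)" by (simp add: mult.commute mult.left_commute)
  qed
  then show ?thesis by simp
qed

text \<open>Again only the bases differ: the rarer response has the larger gain. With
  \<open>mean_tilt_swap\<close>, a hybrid of the larger gain and the smaller loss covers both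
  directions.\<close>

lemma gain_swap:
  assumes p: "0 < p" "p \<le> 1/2" and l: "0 \<le> l" "l \<le> 1" and y: "0 \<le> x" "x \<le> y"
  shows "(1 - p) * (tilt l (1 - p) (- y) - tilt l (1 - p) (- x)) \<le> p * (tilt l p (- y) - tilt l p (- x))"
proof -
  let ?J = "\<lambda>a y. l * (1 - a) * (exp (l * y) * ((1 - a) + a * exp y) powr (- l - 1))"
  have "p * tilt l p (- x) - (1 - p) * tilt l (1 - p) (- x) \<le> p * tilt l p (- y) - (1 - p) * tilt l (1 - p) (- y)"
  proof (rule deriv_nonneg_mono[OF y(2), where f' = "\<lambda>y. p * ?J p y - (1 - p) * ?J (1 - p) y"])
    show "((\<lambda>y. p * tilt l p (- y) - (1 - p) * tilt l (1 - p) (- y)) has_real_derivative p * ?J p z - (1 - p) * ?J (1 - p) z) (at z)" for z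
      using p by (intro DERIV_diff DERIV_cmult tilt_neg_deriv) auto
    fix z :: real assume "x \<le> z"
    then have z: "0 \<le> z" using y by simp
    have b: "(p + (1 - p) * exp z) powr (- l - 1) \<le> ((1 - p) + p * exp z) powr (- l - 1)"
      using p l z weights_le[of p z] by (intro powr_mono2') (auto simp: add_pos_pos)
    have "0 \<le> p * (l * (1 - p) * (exp (l * z) * (((1 - p) + p * exp z) powr (- l - 1) - (p + (1 - p) * exp z) powr (- l - 1))))"
      using p l b by (intro mult_nonneg_nonneg) auto
    also have "\<dots> = p * ?J p z - (1 - p) * ?J (1 - p) z" by (simp add: algebra_simps)
    finally show "0 \<le> p * ?J p z - (1 - p) * ?J (1 - p) z" .
  qed
  then show ?thesis by (simp add: algebra_simps)
qed

lemma loss_rate_ge: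
  fixes l y p :: real
  assumes p: "0 < p" "p < 1" and l: "0 \<le> l" "l \<le> 1" and y: "0 \<le> y"
  shows "exp (- l * y) - exp (- y) \<le> (exp y - exp (l * y)) * (p + (1 - p) * exp y) powr (- l - 1)"
proof -
  have "p + (1 - p) * exp y \<le> exp y"
    using p y mult_left_mono[of 1 "exp y" p] by (simp add: algebra_simps)
  then have "exp y powr (- l - 1) \<le> (p + (1 - p) * exp y) powr (- l - 1)"
    using p l by (intro powr_mono2') (auto simp: add_pos_pos)
  then have "(exp y - exp (l * y)) * exp y powr (- l - 1)
      \<le> (exp y - exp (l * y)) * (p + (1 - p) * exp y) powr (- l - 1)"
    using exp_diff_nonneg[OF l(2) y] by (rule mult_left_mono)
  moreover have "(exp y - exp (l * y)) * exp y powr (- l - 1) = exp (- l * y) - exp (- y)"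
    by (simp add: powr_def algebra_simps flip: exp_add)
  ultimately show ?thesis by simp
qed

lemma gain_rate_ge:
  fixes l y p :: real
  assumes p: "0 < p" "p < 1" and l: "0 \<le> l" and y: "0 \<le> y"
  shows "exp (- y) \<le> exp (l * y) * ((1 - p) + p * exp y) powr (- l - 1)"
proof -
  have "(1 - p) + p * exp y \<le> exp y"
    using p y mult_left_mono[of 1 "exp y" "1 - p"] by (simp add: algebra_simps)
  then have "exp y powr (- l - 1) \<le> ((1 - p) + p * exp y) powr (- l - 1)"
    using p l by (intro powr_mono2') (auto simp: add_pos_pos)
  then have "exp (l * y) * exp y powr (- l - 1) \<le> exp (l * y) * ((1 - p) + p * exp y) powr (- l - 1)"
    by (rule mult_left_mono) simp
  moreover have "exp (l * y) * exp y powr (- l - 1) = exp (- y)"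
    by (simp add: powr_def algebra_simps flip: exp_add)
  ultimately show ?thesis by simp
qed

lemma loss_ge:
  assumes p: "0 < p" "p < 1" and l: "0 \<le> l" "l \<le> 1" and y: "0 \<le> y"
  shows "p * (1 - p) * (1 - exp (- l * y) - l * (1 - exp (- y))) \<le> 1 - mean_tilt l (1 - p) y"
proof -
  let ?D = "\<lambda>y. l * (1 - p) * (1 - (1 - p)) * ((exp y - exp (l * y)) * ((1 - (1 - p)) + (1 - p) * exp y) powr (- l - 1))"
  let ?f = "\<lambda>y. - mean_tilt l (1 - p) y - p * (1 - p) * (1 - exp (- l * y) - l * (1 - exp (- y)))"
  have "?f 0 \<le> ?f y"
  proof (rule deriv_nonneg_mono[OF y, where f' = "\<lambda>y. ?D y - p * (1 - p) * (l * exp (- l * y) - l * exp (- y))"])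
    show "(?f has_real_derivative ?D x - p * (1 - p) * (l * exp (- l * x) - l * exp (- x))) (at x)" for x
      using p by (auto intro!: derivative_eq_intros mean_tilt_deriv)
    fix x :: real assume x: "0 \<le> x"
    have "l * (1 - p) * p * (exp (- l * x) - exp (- x))
        \<le> l * (1 - p) * p * ((exp x - exp (l * x)) * (p + (1 - p) * exp x) powr (- l - 1))"
      using p l by (intro mult_left_mono loss_rate_ge x) auto
    then show "0 \<le> ?D x - p * (1 - p) * (l * exp (- l * x) - l * exp (- x))" by (simp add: algebra_simps)
  qed
  then show ?thesis by simp
qed

text \<open>The \<open>exp (- y)\<close> of \<open>gain_rate_ge\<close> cancels the one subtracted
  in \<open>loss_rate_ge\<close>, so the sum of the rates keeps only
  \<open>exp (- l * y)\<close>.\<close>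

lemma gain_loss_ge:
  assumes p: "0 < p" "p < 1" and l: "0 \<le> l" "l \<le> 1" and y: "0 \<le> y"
  shows "p + p * (1 - p) * (1 - exp (- l * y)) \<le> p * tilt l p (- y) + 1 - mean_tilt l (1 - p) y"
proof -
  let ?D = "\<lambda>y. l * (1 - p) * (1 - (1 - p)) * ((exp y - exp (l * y)) * ((1 - (1 - p)) + (1 - p) * exp y) powr (- l - 1))"
  let ?J = "\<lambda>y. l * (1 - p) * (exp (l * y) * ((1 - p) + p * exp y) powr (- l - 1))"
  let ?f = "\<lambda>y. p * tilt l p (- y) - mean_tilt l (1 - p) y - p * (1 - p) * (1 - exp (- l * y))"
  have "?f 0 \<le> ?f y"
  proof (rule deriv_nonneg_mono[OF y, where f' = "\<lambda>y. p * ?J y - (- ?D y) - p * (1 - p) * (l * exp (- l * y))"])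
    have "((\<lambda>y. p * (1 - p) * (1 - exp (- l * y))) has_real_derivative p * (1 - p) * (l * exp (- l * x))) (at x)" for x
      by (auto intro!: derivative_eq_intros)
    note d = this
    have p': "0 < 1 - p" "1 - p < 1" using p by auto
    show "(?f has_real_derivative p * ?J x - (- ?D x) - p * (1 - p) * (l * exp (- l * x))) (at x)" for x
      by (rule DERIV_diff[OF DERIV_diff[OF DERIV_cmult[OF tilt_neg_deriv[OF p]] mean_tilt_deriv[OF p']] d])
    fix x :: real assume x: "0 \<le> x"
    have "l * (1 - p) * p * (exp (- l * x) - exp (- x))
        \<le> l * (1 - p) * p * ((exp x - exp (l * x)) * (p + (1 - p) * exp x) powr (- l - 1))"
      using p l by (intro mult_left_mono loss_rate_ge x) auto
    moreover have "l * (1 - p) * p * exp (- x) \<le> l * (1 - p) * p * (exp (l * x) * ((1 - p) + p * exp x) powr (- l - 1))"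
      using p l by (intro mult_left_mono gain_rate_ge x) auto
    ultimately show "0 \<le> p * ?J x - (- ?D x) - p * (1 - p) * (l * exp (- l * x))" by (simp add: algebra_simps)
  qed
  then show ?thesis by simp
qed

text \<open>One positive summand is dropped in each base; nothing is lost in the limit of large
  \<open>y\<close>, where the bound is used.\<close>

lemma mean_tilt_le:
  assumes p: "0 < p" "p < 1" and l: "0 \<le> l"
  shows "mean_tilt l (1 - p) y \<le> (1 - p) powr - l * (p * exp (- l * y) + (1 - p))"
proof -
  have "tilt l p y \<le> ((1 - p) * exp y) powr - l"
    unfolding tilt_def using p l by (intro powr_mono2') auto
  also have "\<dots> = (1 - p) powr - l * exp (- l * y)"
    using p by (simp add: powr_mult) (simp add: powr_def)
  finally have 1: "p * tilt l p y \<le> p * ((1 - p) powr - l * exp (- l * y))" using p by simp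
  have "tilt l (1 - p) (- y) \<le> (1 - p) powr - l"
    unfolding tilt_def using p l by (intro powr_mono2') auto
  then have "(1 - p) * tilt l (1 - p) (- y) \<le> (1 - p) * (1 - p) powr - l" using p by simp
  with 1 show ?thesis by (simp add: mean_tilt_def algebra_simps)
qed

lemma tilt_le_limit:
  assumes "0 < p" "p < 1" "0 \<le> l"
  shows "tilt l p u \<le> p powr - l"
  unfolding tilt_def using assms by (intro powr_mono2') auto

lemma one_plus_powr_ge:
  fixes x l :: real
  assumes "0 \<le> x" "0 \<le> l" shows "1 - l * x \<le> (1 + x) powr - l"
proof -
  have "ln (1 + x) \<le> x" using assms by (intro ln_add_one_self_le_self) auto
  then have "exp (- (l * x)) \<le> exp (- (l * ln (1 + x)))" using assms by (auto intro: mult_left_mono)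
  moreover have "1 - l * x \<le> exp (- (l * x))" using exp_ge_add_one_self[of "- (l * x)"] by simp
  moreover have "(1 + x) powr - l = exp (- (l * ln (1 + x)))" using assms by (simp add: powr_def)
  ultimately show ?thesis by linarith
qed

lemma gain_tail:
  assumes p: "0 < p" "p < 1" and l: "0 \<le> l"
  shows "p powr - l - tilt l p (- y) \<le> p powr - l * (l * ((1 - p) / p * exp (- y)))"
proof -
  let ?x = "(1 - p) / p * exp (- y)"
  have x: "0 \<le> ?x" using p by simp
  have "p + (1 - p) * exp (- y) = p * (1 + ?x)" using p by (simp add: field_simps)
  then have "tilt l p (- y) = p powr - l * (1 + ?x) powr - l"
    using p x by (simp add: tilt_def powr_mult)
  moreover have "p powr - l * (1 - l * ?x) \<le> p powr - l * (1 + ?x) powr - l"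
    by (intro mult_left_mono one_plus_powr_ge x l) auto
  ultimately show ?thesis by (simp add: algebra_simps)
qed

lemma bernoulli_powr:
  fixes x t :: real
  assumes "0 < x" "0 \<le> t" "t \<le> 1" shows "x powr t \<le> 1 + t * (x - 1)"
proof -
  have "x powr t * 1 powr (1 - t) \<le> t * x + (1 - t) * 1"
    by (rule Youngs_inequality_0) (use assms in auto)
  then show ?thesis by (simp add: algebra_simps)
qed

text \<open>Odd degree makes the Taylor polynomial a lower bound on both sides of 0; negative
  arguments are needed later.\<close>

lemma exp_cubic_le: "1 + x + x\<^sup>2 / 2 + x ^ 3 / 6 \<le> exp (x::real)"
proof -
  define g where "g x = (1 + x + x\<^sup>2 / 2 + x ^ 3 / 6) * exp (- x)" for x :: real
  have d: "(g has_real_derivative - (x ^ 3 / 6 * exp (- x))) (at x)" for x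
    unfolding g_def [abs_def]
    by (auto intro!: derivative_eq_intros simp: field_simps power2_eq_square power3_eq_cube)
  have "g x \<le> g 0"
  proof (cases "0 \<le> x")
    case True
    then show ?thesis using d
      by (intro DERIV_nonpos_imp_nonincreasing[OF True]) (metis mult_nonneg_nonneg neg_le_0_iff_le divide_nonneg_nonneg zero_le_power exp_ge_zero zero_le_numeral)
  next
    case False
    have "0 \<le> - (y ^ 3 / 6 * exp (- y))" if "y \<le> 0" for y :: real
      using that by (auto simp: power3_eq_cube mult_nonpos_nonpos mult_nonneg_nonpos mult_le_0_iff zero_le_mult_iff)
    then show ?thesis using d False by (intro deriv_nonneg_mono[of x 0 g]) auto
  qed
  then have "(1 + x + x\<^sup>2 / 2 + x ^ 3 / 6) * exp (- x) \<le> 1" by (simp add: g_def)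
  then show ?thesis by (simp add: exp_minus field_simps)
qed

lemma exp_ge_cubic4:
  assumes "0 \<le> 1 + x / 4 + (x / 4)\<^sup>2 / 2 + (x / 4) ^ 3 / 6"
  shows "(1 + x / 4 + (x / 4)\<^sup>2 / 2 + (x / 4) ^ 3 / 6) ^ 4 \<le> exp (x::real)"
proof -
  have "(1 + x / 4 + (x / 4)\<^sup>2 / 2 + (x / 4) ^ 3 / 6) ^ 4 \<le> exp (x / 4) ^ 4"
    by (rule power_mono[OF exp_cubic_le assms])
  also have "\<dots> = exp x" by (simp flip: exp_of_nat_mult)
  finally show ?thesis .
qed

section \<open>The Gaussian comparison function and its loss\<close>

lemma gauss_0 [simp]: "gauss 0 = 1"
  by (simp add: gauss_def)

definition gauss_loss :: "real \<Rightarrow> real" where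
  "gauss_loss v = 1 - (gauss v + gauss (- v)) / 2"

lemma gauss_deriv: "(gauss has_real_derivative (24/25 - v) * gauss v) (at v)"
  unfolding gauss_def [abs_def] by (auto intro!: derivative_eq_intros simp: field_simps)

text \<open>This says that \<open>gauss_loss\<close> has nonnegative derivative. Below
  \<open>q = 24/25\<close> it reduces to \<open>2 * q * v \<le> ln ((q + v) / (q - v))\<close>,
  which holds because the right side has derivative \<open>2 * q / (q^2 - v^2) \<ge> 2 * q\<close>,
  as \<open>q \<le> 1\<close>.\<close>

lemma gauss_ratio:
  fixes v :: real
  assumes "0 \<le> v"
  shows "(24/25 - v) * gauss v \<le> (24/25 + v) * gauss (- v)"
proof (cases "24/25 \<le> v")
  case True
  then have "(24/25 - v) * gauss v \<le> 0" by (simp add: gauss_def mult_nonpos_nonneg)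
  also have "0 \<le> (24/25 + v) * gauss (- v)" using assms by (simp add: gauss_def)
  finally show ?thesis .
next
  case False
  let ?h = "\<lambda>v::real. ln (24/25 + v) - ln (24/25 - v) - 48/25 * v"
  have "?h 0 \<le> ?h v"
  proof (rule deriv_nonneg_mono[OF assms, where f' = "\<lambda>v. 1 / (24/25 + v) + 1 / (24/25 - v) - 48/25"])
    fix x :: real assume x: "0 \<le> x" "x \<le> v"
    have pos: "0 < 24/25 + x" "0 < 24/25 - x" using x False by auto
    have d1: "((\<lambda>v. ln (24/25 + v)) has_real_derivative 1 / (24/25 + x) * 1) (at x)"
      by (rule DERIV_chain2[where f = ln and g = "\<lambda>v. 24/25 + v", OF DERIV_ln_divide[OF pos(1)]]) (auto intro!: derivative_eq_intros)
    have d2: "((\<lambda>v. ln (24/25 - v)) has_real_derivative 1 / (24/25 - x) * (- 1)) (at x)"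
      by (rule DERIV_chain2[where f = ln and g = "\<lambda>v. 24/25 - v", OF DERIV_ln_divide[OF pos(2)]]) (auto intro!: derivative_eq_intros)
    have "1 / (24/25 + x) * 1 - 1 / (24/25 - x) * (- 1) - 48/25 = 1 / (24/25 + x) + 1 / (24/25 - x) - 48/25"
      by simp
    with DERIV_diff[OF DERIV_diff[OF d1 d2] DERIV_cmult_Id[of "48/25" x UNIV]]
    show "(?h has_real_derivative 1 / (24/25 + x) + 1 / (24/25 - x) - 48/25) (at x)"
      by (simp only:)
    have ab: "1 / a + 1 / b = (a + b) / (a * b)" if "0 < a" "0 < b" for a b :: real
      using that by (simp add: field_simps)
    have prod: "(24/25 + x) * (24/25 - x) = (24/25)\<^sup>2 - x\<^sup>2" by (simp add: power2_eq_square algebra_simps)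
    have sum: "(24/25 + x) + (24/25 - x) = 48/25" by simp
    have "1 / (24/25 + x) + 1 / (24/25 - x) = (48/25) / ((24/25)\<^sup>2 - x\<^sup>2)"
      using ab[OF pos] unfolding prod sum .
    moreover have "0 < (24/25)\<^sup>2 - x\<^sup>2"
      using mult_pos_pos[OF pos] by (simp add: power2_eq_square algebra_simps)
    moreover have "(24/25)\<^sup>2 - x\<^sup>2 \<le> 1" by (simp add: power2_eq_square)
       (use zero_le_square[of x] in linarith)
    ultimately show "0 \<le> 1 / (24/25 + x) + 1 / (24/25 - x) - 48/25"
      by (simp add: le_divide_eq)
  qed
  then have "48/25 * v \<le> ln ((24/25 + v) / (24/25 - v))"
    using assms False by (simp add: ln_div)
  then have "exp (48/25 * v) \<le> (24/25 + v) / (24/25 - v)"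
    using ln_ge_iff[of "(24/25 + v) / (24/25 - v)" "48/25 * v"] assms False by simp
  then have "(24/25 - v) * exp (48/25 * v) \<le> 24/25 + v"
    using False by (simp add: field_simps)
  then have "(24/25 - v) * exp (48/25 * v) * gauss (- v) \<le> (24/25 + v) * gauss (- v)"
    by (intro mult_right_mono) (auto simp: gauss_def)
  moreover have "exp (48/25 * v) * gauss (- v) = gauss v"
    by (simp add: gauss_def flip: exp_add)
  ultimately show ?thesis by (metis mult.assoc)
qed

lemma gauss_loss_mono:
  assumes "0 \<le> v" "v \<le> w"
  shows "gauss_loss v \<le> gauss_loss w"
proof (rule deriv_nonneg_mono[OF assms(2), where f' = "\<lambda>v. ((24/25 + v) * gauss (- v) - (24/25 - v) * gauss v) / 2"])
  have "((\<lambda>v. gauss (- v)) has_real_derivative ((24/25 - (- x)) * gauss (- x)) * (- 1)) (at x)" for x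
    by (rule DERIV_chain2[OF gauss_deriv]) (auto intro!: derivative_eq_intros)
  then show "(gauss_loss has_real_derivative ((24/25 + x) * gauss (- x) - (24/25 - x) * gauss x) / 2) (at x)" for x
    unfolding gauss_loss_def [abs_def]
    by (auto intro!: derivative_eq_intros gauss_deriv simp: field_simps)
  show "0 \<le> ((24/25 + x) * gauss (- x) - (24/25 - x) * gauss x) / 2" if "v \<le> x" for x
    using gauss_ratio[of x] assms that by simp
qed

lemma gauss_pos: "0 < gauss v" by (simp add: gauss_def)

lemma gauss_loss_le_1: "gauss_loss v \<le> 1"
  using gauss_pos[of v] gauss_pos[of "- v"] by (simp add: gauss_loss_def)

text \<open>The coefficients are \<open>(1 - q^2) / 2\<close> and \<open>q^2 / 4\<close> with
  \<open>q = 24/25\<close>, from multiplying out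
  \<open>(1 - v^2/2) * (1 + (q * v)^2/2)\<close>.\<close>

lemma gauss_loss_le_quadratic:
  "gauss_loss v \<le> (49/1250 + 144/625 * v\<^sup>2) * v\<^sup>2"
proof -
  have c: "1 + x\<^sup>2 / 2 \<le> (exp x + exp (- x)) / 2" for x :: real
    using exp_cubic_le[of x] exp_cubic_le[of "- x"] by simp
  have e: "(gauss v + gauss (- v)) / 2 = exp (- (v\<^sup>2 / 2)) * ((exp (24/25 * v) + exp (- (24/25 * v))) / 2)"
  proof -
    have "gauss v = exp (- (v\<^sup>2 / 2)) * exp (24/25 * v)" "gauss (- v) = exp (- (v\<^sup>2 / 2)) * exp (- (24/25 * v))"
      by (simp_all add: gauss_def flip: exp_add)
    then show ?thesis by (simp only:) (simp add: algebra_simps)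
  qed
  have "(1 - v\<^sup>2 / 2) * (1 + (24/25 * v)\<^sup>2 / 2) \<le> exp (- (v\<^sup>2 / 2)) * (1 + (24/25 * v)\<^sup>2 / 2)"
    using exp_ge_add_one_self[of "- (v\<^sup>2 / 2)"] by (intro mult_right_mono) (auto simp: add_nonneg_nonneg)
  also have "\<dots> \<le> exp (- (v\<^sup>2 / 2)) * ((exp (24/25 * v) + exp (- (24/25 * v))) / 2)"
    by (intro mult_left_mono c) auto
  finally have f: "(1 - v\<^sup>2 / 2) * (1 + (24/25 * v)\<^sup>2 / 2) \<le> (gauss v + gauss (- v)) / 2" unfolding e .
  have "(1 - v\<^sup>2 / 2) * (1 + (24/25 * v)\<^sup>2 / 2) = 1 - (49/1250 + 144/625 * v\<^sup>2) * v\<^sup>2"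
    by (simp add: power2_eq_square field_simps)
  with f show ?thesis unfolding gauss_loss_def by linarith
qed

section \<open>Small changes: gains compared by their derivatives\<close>

lemma mult_sq_le: "0 \<le> p \<Longrightarrow> p \<le> 1 \<Longrightarrow> p * (1 - p) ^ 2 \<le> (4/27::real)"
proof -
  assume p: "0 \<le> p" "p \<le> 1"
  have "4/27 - p * (1 - p) ^ 2 = (p - 1/3)\<^sup>2 * (4/3 - p)"
    by (simp add: power2_eq_square algebra_simps)
  moreover have "0 \<le> (p - 1/3)\<^sup>2 * (4/3 - p)" using p by simp
  ultimately show ?thesis by linarith
qed

lemma mult_cube_le: "0 \<le> p \<Longrightarrow> p \<le> 1 \<Longrightarrow> p * (1 - p) ^ 3 \<le> (27/256::real)"
proof -
  assume p: "0 \<le> p" "p \<le> 1"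
  have "27/256 - p * (1 - p) ^ 3 = (p - 1/4)\<^sup>2 * ((1 - p)\<^sup>2 + (1 - p) / 2 + 3/16)"
    by (simp add: power2_eq_square power3_eq_cube field_simps)
  moreover have "0 \<le> (p - 1/4)\<^sup>2 * ((1 - p)\<^sup>2 + (1 - p) / 2 + 3/16)" using p by simp
  ultimately show ?thesis by linarith
qed

lemma mult_pow4_le: "0 \<le> p \<Longrightarrow> p \<le> 1 \<Longrightarrow> p * (1 - p) ^ 4 \<le> (256/3125::real)"
proof -
  assume p: "0 \<le> p" "p \<le> 1"
  have "256/3125 - p * (1 - p) ^ 4 = (p - 1/5)\<^sup>2 * ((1 - p) ^ 3 + 3/5 * (1 - p)\<^sup>2 + 8/25 * (1 - p) + 16/125)"
    by (simp add: numeral_eq_Suc field_simps)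
  moreover have "0 \<le> (p - 1/5)\<^sup>2 * ((1 - p) ^ 3 + 3/5 * (1 - p)\<^sup>2 + 8/25 * (1 - p) + 16/125)" using p by simp
  ultimately show ?thesis by linarith
qed

lemma exp_ge_quartic:
  fixes y :: real
  assumes "0 \<le> y" shows "1 + y + y\<^sup>2 / 2 + y ^ 3 / 6 + y ^ 4 / 24 \<le> exp y"
proof -
  have "(\<Sum>i<5. inverse (fact i) * y ^ i) \<le> (\<Sum>i. inverse (fact i) * y ^ i)"
    using assms summable_exp[of y] by (intro sum_le_suminf) auto
  then show ?thesis
    by (simp add: exp_def scaleR_conv_of_real eval_nat_numeral fact_numeral field_simps)
qed

text \<open>Written in \<open>X\<close>, the Taylor coefficients of \<open>p * exp y\<close> become
  \<open>1 / (2 * p * (1 - p)^4)\<close> and the like; the maxima of these denominators over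
  \<open>p\<close>, rounded safely, give coefficients free of \<open>p\<close>.\<close>

lemma tilted_weight_ge:
  fixes p y X :: real
  assumes p: "0 < p" "p \<le> 1/2" and y: "0 \<le> y" and X: "X = p * (1 - p)\<^sup>2 * y"
  shows "1 + X + 61/10 * X\<^sup>2 + 149/10 * X ^ 3 + 25 * X ^ 4 \<le> (1 - p) + p * exp y"
proof -
  let ?M = "1 - p"
  have b2: "p * ?M\<^sup>2 \<le> 4/27" and b3: "p * ?M ^ 3 \<le> 27/256" and b4: "p * ?M ^ 4 \<le> 256/3125"
    using mult_sq_le[of p] mult_cube_le[of p] mult_pow4_le[of p] p by simp_all
  have b33: "(p * ?M ^ 3)\<^sup>2 \<le> (27/256)\<^sup>2" using b3 p by (intro power_mono) auto
  then have b38: "(p * ?M ^ 3)\<^sup>2 * (p * ?M\<^sup>2) \<le> (27/256)\<^sup>2 * (4/27)"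
    using b2 p by (intro mult_mono) auto
  have "X \<le> p * y"
  proof -
    have "?M\<^sup>2 * (p * y) \<le> 1 * (p * y)" using p y by (intro mult_right_mono power_le_one) auto
    then show ?thesis by (simp add: X mult_ac)
  qed
  moreover have "61/10 * X\<^sup>2 \<le> p * (y\<^sup>2 / 2)"
  proof -
    have "(61/5 * (p * ?M ^ 4)) * (p * (y\<^sup>2 / 2)) \<le> 1 * (p * (y\<^sup>2 / 2))"
      using p b4 by (intro mult_right_mono) auto
    moreover have "61/10 * X\<^sup>2 = (61/5 * (p * ?M ^ 4)) * (p * (y\<^sup>2 / 2))"
      by (simp add: X numeral_eq_Suc field_simps)
    ultimately show ?thesis by simp
  qed
  moreover have "149/10 * X ^ 3 \<le> p * (y ^ 3 / 6)"
  proof -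
    have "(447/5 * (p * ?M ^ 3)\<^sup>2) * (p * (y ^ 3 / 6)) \<le> 1 * (p * (y ^ 3 / 6))"
      using p y b33 by (intro mult_right_mono) (auto simp: power2_eq_square)
    moreover have "149/10 * X ^ 3 = (447/5 * (p * ?M ^ 3)\<^sup>2) * (p * (y ^ 3 / 6))"
      by (simp add: X numeral_eq_Suc field_simps)
    ultimately show ?thesis by simp
  qed
  moreover have "25 * X ^ 4 \<le> p * (y ^ 4 / 24)"
  proof -
    have "(600 * ((p * ?M ^ 3)\<^sup>2 * (p * ?M\<^sup>2))) * (p * (y ^ 4 / 24)) \<le> 1 * (p * (y ^ 4 / 24))"
      using p y b38 by (intro mult_right_mono) (auto simp: power2_eq_square)
    moreover have "25 * X ^ 4 = (600 * ((p * ?M ^ 3)\<^sup>2 * (p * ?M\<^sup>2))) * (p * (y ^ 4 / 24))"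
      by (simp add: X numeral_eq_Suc field_simps)
    ultimately show ?thesis by simp
  qed
  moreover have "p * (1 + y + y\<^sup>2 / 2 + y ^ 3 / 6 + y ^ 4 / 24) \<le> p * exp y"
    using p exp_ge_quartic[OF y] by simp
  ultimately show ?thesis by (simp add: distrib_left)
qed

text \<open>Only the power \<open>- l\<close> of the base is weakened, by weighted AM-GM in the form
  \<open>exp (p * y) \<le> (1 - p) + p * exp y\<close>. The remaining factor, the reciprocal of the
  base, stays exact so that \<open>tilted_weight_ge\<close> can be applied to it.\<close>

lemma gain_rate_le:
  fixes p y l :: real
  assumes p: "0 < p" "p \<le> 1/2" and l: "0 \<le> l"
  shows "exp (l * y) * ((1 - p) + p * exp y) powr (- l - 1) \<le> exp (l * (1 - p) * y) / ((1 - p) + p * exp y)"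
proof -
  let ?W = "(1 - p) + p * exp y"
  have W: "0 < ?W" using p by (simp add: add_pos_pos)
  have "exp y powr p \<le> 1 + p * (exp y - 1)" using p by (intro bernoulli_powr) auto
  then have "exp (p * y) \<le> ?W" by (simp add: powr_def algebra_simps)
  then have "?W powr - l \<le> exp (p * y) powr - l" using l by (intro powr_mono2') auto
  also have "\<dots> = exp (- l * p * y)" by (simp add: powr_def)
  finally have "exp (l * y) * ?W powr - l \<le> exp (l * y) * exp (- l * p * y)" by simp
  also have "\<dots> = exp (l * (1 - p) * y)" by (simp add: algebra_simps flip: exp_add)
  finally have "exp (l * y) * ?W powr - l / ?W \<le> exp (l * (1 - p) * y) / ?W"
    using W by (intro divide_right_mono) auto
  moreover have "?W powr (- l - 1) = ?W powr - l / ?W" using W by (simp add: powr_diff)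
  ultimately show ?thesis by simp
qed

text \<open>Here \<open>247/500 = 13/50 * 19/10\<close>, and
  \<open>687/500 = 24/25 * 19/10 - 9/20\<close> is the exponent of \<open>gauss (19/10 * X)\<close>
  to first order minus that of the gain rate. The last factor comes from
  \<open>tilted_weight_ge\<close>.\<close>

lemma gain_polynomial:
  fixes X :: real
  assumes X: "0 \<le> X" "X \<le> 2/5"
  shows "9/20 \<le> 247/500 * (24/25 - 19/10 * X) * (1 + (687/500 * X - 361/200 * X\<^sup>2))
    * (1 + X + 61/10 * X\<^sup>2 + 149/10 * X ^ 3 + 25 * X ^ 4)" (is "_ \<le> ?P")
proof -
  have s4: "X ^ 4 \<le> t * X ^ 3" and s5: "X ^ 5 \<le> t\<^sup>2 * X ^ 3" and s6: "X ^ 6 \<le> t ^ 3 * X ^ 3" if "X \<le> t" for t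
    using mult_right_mono[OF that, of "X ^ 3"] mult_right_mono[OF power_mono[OF that X(1), of 2], of "X ^ 3"]
      mult_right_mono[OF power_mono[OF that X(1), of 3], of "X ^ 3"] X
    by (simp_all add: numeral_eq_Suc mult_ac)
  have P: "?P = 1482/3125 + (585143/3125000) * X + (5752877/12500000) * X\<^sup>2 + (608005567/125000000) * X ^ 3 + (-238402671/62500000) * X ^ 4 + (-1440521537/50000000) * X ^ 5 + (-283978123/10000000) * X ^ 6 + (1694173/40000) * X ^ 7" by (simp add: numeral_eq_Suc field_simps)
  have nn: "0 \<le> X\<^sup>2" "0 \<le> X ^ 3" "0 \<le> X ^ 6" "0 \<le> X ^ 7" using X by auto
  show ?thesis
  proof (cases "X \<le> 3/10")
    case True
    have "X ^ 5 \<le> 9/100 * X ^ 3" "X ^ 6 \<le> 27/1000 * X ^ 3"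
      using s5[OF True] s6[OF True] by (simp_all add: power2_eq_square power3_eq_cube)
    then show ?thesis unfolding P using s4[OF True] X nn by linarith
  next
    case False
    have "3/10 * X ^ 6 \<le> X ^ 7" using mult_right_mono[of "3/10" X "X ^ 6"] False X by (simp add: numeral_eq_Suc)
    moreover have "X ^ 3 \<le> 4/25 * X" using mult_right_mono[OF power_mono[OF X(2) X(1), of 2], of X] X
      by (simp add: numeral_eq_Suc mult_ac)
    moreover have "3/10 * X \<le> X\<^sup>2" using False X mult_right_mono[of "3/10" X X] by (simp add: power2_eq_square)
    moreover have "X ^ 5 \<le> 4/25 * X ^ 3" "X ^ 6 \<le> 8/125 * X ^ 3"
      using s5[OF X(2)] s6[OF X(2)] by (simp_all add: power2_eq_square power3_eq_cube)
    ultimately show ?thesis unfolding P using s4[OF X(2)] X nn by linarith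
  qed
qed

text \<open>The inequality between the derivatives in \<open>gain_step\<close>, divided by the
  common factor \<open>p * (1 - p)^2\<close>. Up to \<open>X = 2/5\<close> the comparison is still
  increasing, since \<open>19/10 * 2/5 < 24/25\<close>.\<close>

lemma gain_rate_compare:
  assumes p: "0 < p" "p \<le> 1/2" and l: "l = 9/20 * p * (1 - p)" and y: "0 \<le> y"
    and X: "X = p * (1 - p)\<^sup>2 * y" "X \<le> 2/5"
  shows "9/20 * (exp (l * y) * ((1 - p) + p * exp y) powr (- l - 1))
    \<le> 247/500 * (24/25 - 19/10 * X) * gauss (19/10 * X)"
proof -
  let ?W = "(1 - p) + p * exp y" and ?w = "687/500 * X - 361/200 * X\<^sup>2"
  let ?Q = "1 + X + 61/10 * X\<^sup>2 + 149/10 * X ^ 3 + 25 * X ^ 4"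
  have X0: "0 \<le> X" using p y by (simp add: X(1))
  have W: "0 < ?W" using p by (simp add: add_pos_pos)
  have Q: "?Q \<le> ?W" by (rule tilted_weight_ge[OF p y X(1)])
  have "X\<^sup>2 \<le> 2/5 * X" using mult_right_mono[OF X(2) X0] by (simp add: power2_eq_square)
  then have w: "0 \<le> ?w" using X0 by linarith
  have "9/20 \<le> 247/500 * (24/25 - 19/10 * X) * (1 + ?w) * ?Q" by (rule gain_polynomial[OF X0 X(2)])
  also have "\<dots> \<le> 247/500 * (24/25 - 19/10 * X) * exp ?w * ?W"
    using w X(2) X0 Q exp_ge_add_one_self[of ?w] by (intro mult_mono mult_nonneg_nonneg add_nonneg_nonneg) auto
  finally have "9/20 * exp (9/20 * X) \<le> 247/500 * (24/25 - 19/10 * X) * exp ?w * ?W * exp (9/20 * X)"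
    by (rule mult_right_mono) simp
  also have "\<dots> = 247/500 * (24/25 - 19/10 * X) * gauss (19/10 * X) * ?W"
    by (simp add: gauss_def power2_eq_square algebra_simps flip: exp_add)
  finally have "9/20 * (exp (9/20 * X) / ?W) \<le> 247/500 * (24/25 - 19/10 * X) * gauss (19/10 * X)"
    using W by (simp add: field_simps)
  moreover have "exp (l * y) * ?W powr (- l - 1) \<le> exp (9/20 * X) / ?W"
    using gain_rate_le[OF p, of l y] p by (simp add: l X(1) power2_eq_square mult_ac)
  ultimately show ?thesis by linarith
qed

lemma gain_step:
  assumes p: "0 < p" "p \<le> 1/2" and l: "l = 9/20 * p * (1 - p)" and m: "m = 19/10 * (p * (1 - p)\<^sup>2)"
    and y: "0 \<le> x" "x \<le> y" "p * (1 - p)\<^sup>2 * y \<le> 2/5"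
  shows "tilt l p (- y) - tilt l p (- x) \<le> 13/50 * (gauss (m * y) - gauss (m * x))"
proof -
  let ?J = "\<lambda>y. l * (1 - p) * (exp (l * y) * ((1 - p) + p * exp y) powr (- l - 1))"
  have "13/50 * gauss (m * x) - tilt l p (- x) \<le> 13/50 * gauss (m * y) - tilt l p (- y)"
  proof (rule deriv_nonneg_mono[OF y(2), where f' = "\<lambda>y. 13/50 * (m * ((24/25 - m * y) * gauss (m * y))) - ?J y"])
    have g: "((\<lambda>y. gauss (m * y)) has_real_derivative m * ((24/25 - m * z) * gauss (m * z))) (at z)" for z
    proof -
      have "((\<lambda>y. gauss (m * y)) has_real_derivative ((24/25 - m * z) * gauss (m * z)) * m) (at z)"
        by (rule DERIV_chain2[OF gauss_deriv]) (auto intro!: derivative_eq_intros)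
      then show ?thesis by (simp only: mult.commute[of m])
    qed
    show "((\<lambda>y. 13/50 * gauss (m * y) - tilt l p (- y)) has_real_derivative
        13/50 * (m * ((24/25 - m * z) * gauss (m * z))) - ?J z) (at z)" for z
      using p by (intro DERIV_diff DERIV_cmult g tilt_neg_deriv) auto
    fix z assume z: "x \<le> z" "z \<le> y"
    have "p * (1 - p)\<^sup>2 * z \<le> p * (1 - p)\<^sup>2 * y" using z p by (intro mult_left_mono) auto
    then have "9/20 * (exp (l * z) * ((1 - p) + p * exp z) powr (- l - 1))
      \<le> 247/500 * (24/25 - 19/10 * (p * (1 - p)\<^sup>2 * z)) * gauss (19/10 * (p * (1 - p)\<^sup>2 * z))"
      using y z by (intro gain_rate_compare[OF p l _ refl]) auto
    from mult_left_mono[OF this, of "p * (1 - p)\<^sup>2"] p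
    have "p * (1 - p)\<^sup>2 * (9/20 * (exp (l * z) * ((1 - p) + p * exp z) powr (- l - 1)))
      \<le> p * (1 - p)\<^sup>2 * (247/500 * (24/25 - 19/10 * (p * (1 - p)\<^sup>2 * z)) * gauss (19/10 * (p * (1 - p)\<^sup>2 * z)))"
      by simp
    moreover have "?J z = p * (1 - p)\<^sup>2 * (9/20 * (exp (l * z) * ((1 - p) + p * exp z) powr (- l - 1)))"
    proof -
      have "l * (1 - p) = p * (1 - p)\<^sup>2 * (9/20)" by (simp add: l power2_eq_square)
      then show ?thesis by (simp only: mult.assoc)
    qed
    moreover have "13/50 * (m * ((24/25 - m * z) * gauss (m * z)))
      = p * (1 - p)\<^sup>2 * (247/500 * (24/25 - 19/10 * (p * (1 - p)\<^sup>2 * z)) * gauss (19/10 * (p * (1 - p)\<^sup>2 * z)))"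
      unfolding m by (simp add: mult.assoc)
    ultimately show "0 \<le> 13/50 * (m * ((24/25 - m * z) * gauss (m * z))) - ?J z" by linarith
  qed
  then show ?thesis by simp
qed

section \<open>Small changes: losses\<close>

lemma exp_neg_bounds:
  fixes z :: real
  assumes "0 \<le> z"
  shows "exp (- z) \<le> 1 - z + z\<^sup>2 / 2" and "z - z\<^sup>2 / 2 \<le> 1 - exp (- z)"
proof -
  have pos: "0 < 1 + z + z\<^sup>2 / 2" using assms by (simp add: add_pos_nonneg)
  have "1 + z + z\<^sup>2 / 2 \<le> exp z" using exp_ge_quartic[OF assms] assms
    by (smt (verit) zero_le_power divide_nonneg_nonneg)
  then have "exp (- z) \<le> 1 / (1 + z + z\<^sup>2 / 2)"
    using pos by (simp add: exp_minus field_simps)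
  also have "\<dots> \<le> 1 - z + z\<^sup>2 / 2"
  proof -
    have "(1 - z + z\<^sup>2 / 2) * (1 + z + z\<^sup>2 / 2) = 1 + (z\<^sup>2)\<^sup>2 / 4" by (simp add: power2_eq_square field_simps)
    then have "1 \<le> (1 - z + z\<^sup>2 / 2) * (1 + z + z\<^sup>2 / 2)" by simp
    then show ?thesis using pos by (simp only: pos_divide_le_eq)
  qed
  finally show "exp (- z) \<le> 1 - z + z\<^sup>2 / 2" .
  then show "z - z\<^sup>2 / 2 \<le> 1 - exp (- z)" by simp
qed

text \<open>The (1,1) Pade approximant stays accurate for the moderately large \<open>y\<close> that
  small \<open>p\<close> permits under \<open>X \<le> 2/5\<close>, where a Taylor polynomial would
  fail.\<close>

lemma exp_neg_pade:
  fixes y :: real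
  assumes "0 \<le> y" shows "(2 - y) / (2 + y) \<le> exp (- y)"
proof -
  let ?h = "\<lambda>y::real. 2 + y - (2 - y) * exp y"
  have "?h 0 \<le> ?h y"
  proof (rule deriv_nonneg_mono[OF assms, where f' = "\<lambda>y. 1 - (1 - y) * exp y"])
    show "(?h has_real_derivative 1 - (1 - x) * exp x) (at x)" for x
      by (auto intro!: derivative_eq_intros simp: algebra_simps)
    show "0 \<le> 1 - (1 - x) * exp x" for x :: real
      using mult_right_mono[OF exp_ge_add_one_self[of "- x"], of "exp x"] by (simp flip: exp_add)
  qed
  then have "(2 - y) * exp y \<le> 2 + y" by simp
  then have "(2 - y) * exp y * exp (- y) \<le> (2 + y) * exp (- y)" by (rule mult_right_mono) simp
  then have "2 - y \<le> (2 + y) * exp (- y)" by (simp add: mult.assoc flip: exp_add)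
  then show ?thesis using assms by (simp add: field_simps)
qed

lemma exponent_bounds:
  fixes p :: real
  assumes "0 < p" "p \<le> 1/2" "l = 9/20 * p * (1 - p)"
  shows "0 < l" "l \<le> 9/80" "l \<le> 1"
proof -
  have "0 < p * (1 - p)" using assms by simp
  moreover have "p * (1 - p) \<le> 1/4" using zero_le_square[of "p - 1/2"] by (simp add: algebra_simps)
  moreover have "l = 9/20 * (p * (1 - p))" using assms(3) by simp
  ultimately show "0 < l" "l \<le> 9/80" "l \<le> 1" by linarith+
qed

lemma loss_small:
  assumes p: "0 < p" "p \<le> 1/2" and l: "l = 9/20 * p * (1 - p)" and y: "0 \<le> y"
    and X: "X = p * (1 - p)\<^sup>2 * y" "X \<le> 2/5"
  shows "13/25 * p * gauss_loss (19/10 * X) \<le> 1 - mean_tilt l (1 - p) y"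
proof -
  let ?M = "1 - p"
  define P where "P = p * ?M\<^sup>2"
  have P: "0 < P" "P \<le> 4/27" using p mult_sq_le[of p] by (auto simp: P_def)
  have XP: "X = P * y" by (simp add: X(1) P_def)
  have X0: "0 \<le> X" using P y by (simp add: XP)
  have l01: "0 \<le> l" "l \<le> 1" using exponent_bounds[OF p l] by auto
  have X2: "X\<^sup>2 \<le> 4/25" using power_mono[OF X(2) X0, of 2] by (simp add: power2_eq_square)
  have "gauss_loss (19/10 * X) \<le> (49/1250 + 144/625 * (19/10 * X)\<^sup>2) * (19/10 * X)\<^sup>2"
    by (rule gauss_loss_le_quadratic)
  also have "\<dots> \<le> 4/5 * 361/100 * (1/5 + 1/50) * X\<^sup>2"
  proof -
    have "(49/1250 + 144/625 * (19/10 * X)\<^sup>2) * (19/10 * X)\<^sup>2 = (49/1250 + 144/625 * (361/100) * X\<^sup>2) * (361/100 * X\<^sup>2)"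
      by (simp add: power2_eq_square)
    also have "\<dots> \<le> (4/5 * (1/5 + 1/50)) * (361/100 * X\<^sup>2)"
      using X2 by (intro mult_right_mono) auto
    finally show ?thesis by simp
  qed
  finally have "13/25 * p * gauss_loss (19/10 * X) \<le> 13/25 * p * (4/5 * 361/100 * (1/5 + 1/50) * X\<^sup>2)"
    using p by (intro mult_left_mono) auto
  also have "\<dots> = p * P * y\<^sup>2 * (13/25 * 4/5 * 361/100 * (1/5 + 1/50) * P)" by (simp add: XP power2_eq_square)
  also have "\<dots> \<le> p * P * y\<^sup>2 * (9/20 * (1 / (2 + y) - l / 2))"
  proof (intro mult_left_mono)
    \<comment> \<open>\<open>P * (2 + y) = 2 * P + X\<close> is at most \<open>8/27 + 2/5\<close>,
      whose reciprocal exceeds 1.436.\<close>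
    have "P * (1436/1000) \<le> 1 / (2 + y)"
    proof -
      have "P * (2 + y) \<le> 8/27 + 2/5" using P X(2) by (simp add: XP algebra_simps)
      then have "P * (1436/1000) * (2 + y) \<le> 1" by (simp add: algebra_simps)
      then show ?thesis using y by (simp only: pos_le_divide_eq)
    qed
    moreover have "l / 2 \<le> 9/20 * P"
    proof -
      have "p * ?M * (1/2) \<le> p * ?M * ?M" using p by (intro mult_left_mono) auto
      then show ?thesis by (simp add: l P_def power2_eq_square)
    qed
    ultimately have "9/20 * (P * (1436/1000) - 9/20 * P) \<le> 9/20 * (1 / (2 + y) - l / 2)"
      by (intro mult_left_mono diff_mono) auto
    moreover have "13/25 * 4/5 * 361/100 * (1/5 + 1/50) * P \<le> 9/20 * (P * (1436/1000) - 9/20 * P)"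
      using P by simp
    ultimately show "13/25 * 4/5 * 361/100 * (1/5 + 1/50) * P \<le> 9/20 * (1 / (2 + y) - l / 2)"
      by (rule order_trans[rotated])
  qed (use p P in auto)
  also have "\<dots> = p * ?M * (l * (y\<^sup>2 * (1 / (2 + y)) - l * y\<^sup>2 / 2))"
  proof -
    have "p * P * y\<^sup>2 * (9/20 * (D - l / 2)) = p * ?M * (l * (y\<^sup>2 * D - l * y\<^sup>2 / 2))" for D
      by (simp add: P_def l power2_eq_square field_simps)
    then show ?thesis .
  qed
  also have "\<dots> \<le> p * ?M * (1 - exp (- l * y) - l * (1 - exp (- y)))"
  proof (intro mult_left_mono)
    have "y - y\<^sup>2 * (1 / (2 + y)) = 1 - (2 - y) / (2 + y)"
      using y by (simp add: field_simps power2_eq_square)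
    then have "1 - exp (- y) \<le> y - y\<^sup>2 * (1 / (2 + y))" using exp_neg_pade[OF y] by linarith
    then have "l * (1 - exp (- y)) \<le> l * (y - y\<^sup>2 * (1 / (2 + y)))" using l01 by (intro mult_left_mono)
    moreover have "l * y - (l * y)\<^sup>2 / 2 \<le> 1 - exp (- (l * y))" using l01 y by (intro exp_neg_bounds) auto
    ultimately show "l * (y\<^sup>2 * (1 / (2 + y)) - l * y\<^sup>2 / 2) \<le> 1 - exp (- l * y) - l * (1 - exp (- y))"
      by (simp add: algebra_simps power2_eq_square)
  qed (use p in auto)
  also have "\<dots> \<le> 1 - mean_tilt l ?M y" using p l01 y by (intro loss_ge) auto
  finally show ?thesis .
qed

section \<open>Crossing \<open>X = 2/5\<close>: the gain replaced by its limit\<close>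

text \<open>The tangent bound for the logarithm at \<open>4 * p = 1\<close>, with
  \<open>ln 2 \<le> 25/36\<close>; the decimals are \<open>5/36\<close> and \<open>7/18\<close>
  rounded safely.\<close>

lemma neg_ln_weight_le:
  fixes p :: real
  assumes p: "0 < p" "p \<le> 1/2"
  shows "p * (1 - p) * - ln p \<le> 1/4 + 1389/10000 * p - 3888/10000 * p\<^sup>2"
proof -
  have "- ln p = 2 * ln 2 + ln (1 / (4 * p))"
    using p ln_realpow[of 2 2] by (simp add: ln_div ln_mult)
  also have "ln (1 / (4 * p)) \<le> 1 / (4 * p) - 1" using p by (intro ln_le_minus_one) auto
  also have "ln (2::real) \<le> 25/36" by (rule ln2_le_25_over_36)
  finally have "- ln p \<le> 7/18 + 1 / (4 * p)" by simp
  then have "p * (1 - p) * - ln p \<le> p * (1 - p) * (7/18 + 1 / (4 * p))"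
    using p by (intro mult_left_mono) auto
  also have "\<dots> = 1/4 + 5/36 * p - 7/18 * p\<^sup>2" using p by (simp add: field_simps power2_eq_square)
  also have "\<dots> \<le> 1/4 + 1389/10000 * p - 3888/10000 * p\<^sup>2"
    using p zero_le_square[of p] unfolding power2_eq_square by linarith
  finally show ?thesis .
qed

text \<open>With \<open>p powr - l = exp z\<close> and \<open>z \<le> 0.1181\<close>, the chord
  bound \<open>exp z \<le> 1 + 17/16 * z\<close> holds; \<open>153/320\<close> is
  \<open>17/16 * 9/20\<close>.\<close>

lemma powr_neg_weight_le:
  fixes p :: real
  assumes p: "0 < p" "p \<le> 1/2" and l: "l = 9/20 * p * (1 - p)"
  shows "p powr - l \<le> 1 + 153/320 * (1/4 + 1389/10000 * p - 3888/10000 * p\<^sup>2)" "p powr - l \<le> 1126/1000"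
proof -
  let ?B = "1/4 + 1389/10000 * p - 3888/10000 * p\<^sup>2"
  define z where "z = 9/20 * (p * (1 - p) * - ln p)"
  have z: "p powr - l = exp z" using p by (simp add: powr_def l z_def)
  have B: "?B \<le> 26241/100000"
    using zero_le_square[of "p - 1389/7776"] by (simp add: algebra_simps power2_eq_square)
  have z0: "0 \<le> z" using p by (auto simp: z_def mult_le_0_iff)
  have zB: "z \<le> 9/20 * ?B" unfolding z_def by (rule mult_left_mono[OF neg_ln_weight_le[OF p]]) simp
  then have z1: "z \<le> 1181/10000" using B by simp
  have "1 \<le> (1 + 17/16 * z) * (1 - z + z\<^sup>2 / 2 - z ^ 3 / 6)"
  proof -
    have "z * z \<le> 1181/10000 * z" "z * (z * z) \<le> 1181/10000 * (z * z)"
      using mult_right_mono[OF z1 z0] mult_right_mono[OF z1, of "z * z"] by simp_all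
    moreover have "(1 + 17/16 * z) * (1 - z + z\<^sup>2 / 2 - z ^ 3 / 6)
        = 1 + z * (1/16 - 9/16 * z + 35/96 * (z * z) - 17/96 * (z * (z * z)))"
      by (simp add: power2_eq_square power3_eq_cube field_simps)
    moreover have "0 \<le> 1/16 - 9/16 * z + 35/96 * (z * z) - 17/96 * (z * (z * z))"
    proof -
      have "0 \<le> (1181/10000 - z) * (1181/10000 - z)" by simp
      then have "2 * (1181/10000) * z - (1181/10000)\<^sup>2 \<le> z * z" by (simp add: algebra_simps power2_eq_square)
      then show ?thesis using \<open>z * (z * z) \<le> 1181/10000 * (z * z)\<close> z1 by (simp add: power2_eq_square)
    qed
    ultimately show ?thesis using z0 by (simp add: mult_nonneg_nonneg)
  qed
  also have "\<dots> \<le> (1 + 17/16 * z) * exp (- z)"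
    using exp_cubic_le[of "- z"] z0 by (intro mult_left_mono) (auto simp: power3_eq_cube)
  finally have "exp z \<le> 1 + 17/16 * z" by (simp add: exp_minus field_simps)
  with zB B z1 show "p powr - l \<le> 1 + 153/320 * ?B" "p powr - l \<le> 1126/1000" unfolding z by linarith+
qed

text \<open>Taylor polynomial of \<open>exp (x / 4)\<close>. Its fourth power is a lower bound for
  \<open>exp x\<close> that is rational for rational \<open>x\<close>, so the numerical side
  conditions below become rational arithmetic.\<close>

definition cubic :: "real \<Rightarrow> real" where
  "cubic x = 1 + x / 4 + (x / 4)\<^sup>2 / 2 + (x / 4) ^ 3 / 6"

lemma exp_ge_cubic: "0 \<le> cubic x \<Longrightarrow> a \<le> cubic x ^ 4 \<Longrightarrow> a \<le> exp x"
  using exp_ge_cubic4[of x] by (simp add: cubic_def)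

lemma exp_neg_le_cubic: "0 \<le> cubic x \<Longrightarrow> 0 \<le> b \<Longrightarrow> 1 \<le> b * cubic x ^ 4 \<Longrightarrow> exp (- x) \<le> b"
proof -
  assume a: "0 \<le> cubic x" "0 \<le> b" "1 \<le> b * cubic x ^ 4"
  then have "1 \<le> b * exp x"
    using mult_left_mono[OF exp_ge_cubic[OF a(1) order_refl] a(2)] by linarith
  then show "exp (- x) \<le> b" by (simp add: exp_minus field_simps)
qed

text \<open>A lower bound for the slack of the inequality in \<open>row_middle\<close>, divided by
  \<open>p\<close>, after \<open>p\<close> is eliminated. The decimals are the coefficients of
  \<open>powr_neg_weight_le\<close>; \<open>15538/10000\<close> is a lower bound of
  \<open>gauss (19/25)\<close>.\<close>

definition middle_bound :: "real \<Rightarrow> real \<Rightarrow> real \<Rightarrow> real \<Rightarrow> real" where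
  "middle_bound S r t X = 9/20 * X - (9/20 * X)\<^sup>2 / 2 - (6642/100000 + S) * (6642/100000 + (9/20 * X)\<^sup>2) / (743/1000)
      - 11954/100000 - 13/25 + 13/50 * (15538/10000 + r * (1 + t - 228/125 * X - 361/200 * X\<^sup>2))"

text \<open>
  The interval \<open>0 \<le> X \<le> 2/5\<close> is covered by short intervals \<open>[a, b]\<close>. On each of them the inequality is reduced
  to a concave quadratic in \<open>X\<close>, which need only be checked at \<open>a\<close> and \<open>b\<close>; \<open>r\<close> is a rational lower bound of
  the tangent \<open>exp (- t)\<close> at an interior point \<open>x\<close>.
\<close>

lemma row_middle_step:
  assumes p: "0 < p" "p \<le> 1/2" and l: "l = 9/20 * p * (1 - p)" and y: "0 \<le> y"
    and X: "X = p * (1 - p)\<^sup>2 * y"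
    and I: "a \<le> X" "X \<le> b" and ab: "0 \<le> a" "b \<le> 2/5"
    and x: "t = 228/125 * x + 361/200 * x\<^sup>2" "0 \<le> r" "0 \<le> cubic (- t)" "r \<le> cubic (- t) ^ 4" "0 \<le> 1 + t - (228/125 * b + 361/200 * b\<^sup>2)"
    and S: "S = (9/20 * b)\<^sup>2"
    and Phi: "0 \<le> middle_bound S r t a" "0 \<le> middle_bound S r t b"
  shows "p * p powr - l - p * tilt l p (- y) + mean_tilt l (1 - p) y
    \<le> 1 - 13/25 * p + 13/50 * p * (gauss (19/25) + gauss (- (19/10 * X)))"
proof -
  let ?M = "1 - p" and ?s = "9/20 * X"
  have X0: "0 \<le> X" using ab I by simp
  have l01: "0 \<le> l" "l \<le> 1" using exponent_bounds[OF p l] by auto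
  have sl: "l * y * ?M = ?s" by (simp add: l X power2_eq_square)
  have sq: "0 \<le> (X - a) * (b - X)" using I by simp
  have "0 \<le> middle_bound S r t X"
  proof -
    define A where "A = 81/800 + (6642/100000 + S) * (81/400) / (743/1000) + 13/50 * r * 361/200"
    define B where "B = 9/20 - 13/50 * r * (228/125)"
    define C where "C = - (6642/100000 + S) * (6642/100000) / (743/1000)
      - 11954/100000 - 13/25 + 13/50 * (15538/10000 + r * (1 + t))"
    have e: "middle_bound S r t X = C + B * X - A * X\<^sup>2" for X
      by (simp add: middle_bound_def A_def B_def C_def power2_eq_square field_simps)
    have "0 \<le> S" by (simp add: S)
    then have A0: "0 \<le> A" using x(2) by (simp add: A_def)
    have "0 \<le> C + B * a - A * a\<^sup>2" "0 \<le> C + B * b - A * b\<^sup>2" using Phi by (simp_all add: e)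
    then have "0 \<le> (b - X) * (C + B * a - A * a\<^sup>2) + (X - a) * (C + B * b - A * b\<^sup>2)"
      using I by simp
    also have "\<dots> = (b - a) * (C + B * X - A * X\<^sup>2) - A * ((b - a) * ((X - a) * (b - X)))"
      by (simp add: power2_eq_square algebra_simps)
    finally have "0 \<le> (b - a) * (C + B * X - A * X\<^sup>2)"
      using A0 sq I by (smt (verit) mult_nonneg_nonneg)
    then show ?thesis
    proof (cases "a = b")
      case True
      then show ?thesis using I Phi by simp
    next
      case False
      with \<open>0 \<le> (b - a) * (C + B * X - A * X\<^sup>2)\<close> I show ?thesis by (simp add: e zero_le_mult_iff)
    qed
  qed
  \<comment> \<open>Maximisation over \<open>p\<close> by completing the square;
    \<open>743/1000\<close> lies just below \<open>4 * 18589/100000\<close>. One of the two equal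
    factors is frozen at the right end of the interval, which keeps the bound quadratic in
    \<open>X\<close>.\<close>
  moreover have "(6642/100000 + ?s\<^sup>2) * p - 18589/100000 * p\<^sup>2 \<le> (6642/100000 + S) * (6642/100000 + ?s\<^sup>2) / (743/1000)"
  proof -
    let ?c = "6642/100000 + ?s\<^sup>2"
    have "?s\<^sup>2 \<le> S" unfolding S using I X0 by (intro power_mono) auto
    then have "?c * ?c / (743/1000) \<le> (6642/100000 + S) * ?c / (743/1000)"
      by (intro divide_right_mono mult_right_mono) auto
    moreover have "c * p - 18589/100000 * p\<^sup>2 \<le> c * c / (743/1000)" for c :: real
    proof -
      have "0 \<le> (c - 743/2000 * p) * (c - 743/2000 * p)" by simp
      then have "743/1000 * (c * p) \<le> c * c + 552049/4000000 * (p * p)" by (simp add: algebra_simps)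
      moreover have "0 \<le> p * p" by simp
      ultimately have "(c * p - 18589/100000 * (p * p)) * (743/1000) \<le> c * c" by argo
      then show ?thesis unfolding power2_eq_square by (subst pos_le_divide_eq) simp_all
    qed
    ultimately show ?thesis by (rule order_trans[rotated])
  qed
  moreover have "?s - ?s\<^sup>2 / 2 - ?s\<^sup>2 * p \<le> ?M * (1 - exp (- l * y))"
  proof -
    have "l * y - (l * y)\<^sup>2 / 2 \<le> 1 - exp (- (l * y))" using l01 y by (intro exp_neg_bounds) auto
    then have "?M * (l * y - (l * y)\<^sup>2 / 2) \<le> ?M * (1 - exp (- l * y))" using p by simp
    moreover have "?M * (l * y - (l * y)\<^sup>2 / 2) = ?s - ?s * (l * y) / 2"
    proof -
      have "?M * (L - L\<^sup>2 / 2) = L * ?M - (L * ?M) * L / 2" for L by (simp add: power2_eq_square field_simps)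
      from this[of "l * y"] show ?thesis unfolding sl .
    qed
    moreover have "?s * (l * y) \<le> ?s * (?s * (1 + 2 * p))"
    proof (intro mult_left_mono)
      have "0 \<le> p * (1 - 2 * p)" using p by simp
      then have "1 \<le> ?M * (1 + 2 * p)" by (simp add: algebra_simps)
      then have "l * y * 1 \<le> l * y * (?M * (1 + 2 * p))" using l01 y by (intro mult_left_mono) auto
      also have "l * y * (?M * (1 + 2 * p)) = ?s * (1 + 2 * p)" by (simp only: sl[symmetric] mult.assoc)
      finally show "l * y \<le> ?s * (1 + 2 * p)" by simp
    qed (use X0 in auto)
    moreover have "?s * (?s * (1 + 2 * p)) = 2 * (?s\<^sup>2 / 2 + ?s\<^sup>2 * p)"
      by (simp add: power2_eq_square algebra_simps)
    moreover have "v \<le> w \<Longrightarrow> v = s - t / 2 \<Longrightarrow> t \<le> u \<Longrightarrow> u = 2 * (a + b) \<Longrightarrow> s - a - b \<le> w"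
      for a b s t u v w :: real by simp
    ultimately show ?thesis by blast
  qed
  moreover have "p powr - l - 1 \<le> 11954/100000 + 6642/100000 * p - 18589/100000 * p\<^sup>2"
    using powr_neg_weight_le(1)[OF p l] p zero_le_power2[of p] by argo
  moreover have "15538/10000 \<le> gauss (19/25)"
    unfolding gauss_def by (rule exp_ge_cubic) (simp_all add: cubic_def power2_eq_square numeral_eq_Suc)
  moreover have "r * (1 + t - 228/125 * X - 361/200 * X\<^sup>2) \<le> gauss (- (19/10 * X))"
  proof -
    have w: "228/125 * X + 361/200 * X\<^sup>2 \<le> 228/125 * b + 361/200 * b\<^sup>2"
      using I X0 by (intro add_mono mult_left_mono power_mono) auto
    let ?d = "t - 228/125 * X - 361/200 * X\<^sup>2"
    have "r \<le> exp (- t)" using x by (intro exp_ge_cubic)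
    then have "r * (1 + ?d) \<le> exp (- t) * exp ?d"
      using x w exp_ge_add_one_self[of ?d] by (intro mult_mono) auto
    also have "\<dots> = gauss (- (19/10 * X))" by (simp add: gauss_def power2_eq_square field_simps flip: exp_add)
    finally show ?thesis by (simp add: algebra_simps)
  qed
  ultimately have "p powr - l - 1 - ?M * (1 - exp (- l * y)) \<le> - 13/25 + 13/50 * (gauss (19/25) + gauss (- (19/10 * X)))"
    unfolding middle_bound_def by argo
  then have "p * (p powr - l - 1 - ?M * (1 - exp (- l * y))) \<le> p * (- 13/25 + 13/50 * (gauss (19/25) + gauss (- (19/10 * X))))"
    using p by (intro mult_left_mono) auto
  moreover have "p + p * ?M * (1 - exp (- l * y)) \<le> p * tilt l p (- y) + 1 - mean_tilt l ?M y"
    using p l01 y by (intro gain_loss_ge) auto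
  ultimately show ?thesis by (simp add: algebra_simps)
qed

lemma row_middle:
  assumes p: "0 < p" "p \<le> 1/2" and l: "l = 9/20 * p * (1 - p)" and y: "0 \<le> y"
    and X: "X = p * (1 - p)\<^sup>2 * y" "X \<le> 2/5"
  shows "p * p powr - l - p * tilt l p (- y) + mean_tilt l (1 - p) y
    \<le> 1 - 13/25 * p + 13/50 * p * (gauss (19/25) + gauss (- (19/10 * X)))"
proof -
  have X0: "0 \<le> X" using p y by (simp add: X(1))
  have ?thesis if "0/1 \<le> X" "X \<le> 3/25"
    by (rule row_middle_step[OF p l y X(1) that, where x = "3/50" and r = "1781/2000", OF _ _ refl _ _ _ _ refl])
       (simp_all add: middle_bound_def cubic_def power2_eq_square numeral_eq_Suc)
  moreover have ?thesis if "3/25 \<le> X" "X \<le> 11/50"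
    by (rule row_middle_step[OF p l y X(1) that, where x = "17/100" and r = "6961/10000", OF _ _ refl _ _ _ _ refl])
       (simp_all add: middle_bound_def cubic_def power2_eq_square numeral_eq_Suc)
  moreover have ?thesis if "11/50 \<le> X" "X \<le> 31/100"
    by (rule row_middle_step[OF p l y X(1) that, where x = "53/200" and r = "679/1250", OF _ _ refl _ _ _ _ refl])
       (simp_all add: middle_bound_def cubic_def power2_eq_square numeral_eq_Suc)
  moreover have ?thesis if "31/100 \<le> X" "X \<le> 2/5"
    by (rule row_middle_step[OF p l y X(1) that, where x = "71/200" and r = "2083/5000", OF _ _ refl _ _ _ _ refl])
       (simp_all add: middle_bound_def cubic_def power2_eq_square numeral_eq_Suc)
  ultimately show ?thesis using X0 X(2) by linarith
qed

section \<open>Large changes: beyond \<open>X = 2/5\<close>\<close>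

lemma entropy_le:
  fixes p :: real
  assumes "0 \<le> p" "p < 1"
  shows "- ((1 - p) * ln (1 - p)) \<le> p - p\<^sup>2 / 2"
proof -
  let ?f = "\<lambda>p::real. p - p\<^sup>2 / 2 + (1 - p) * ln (1 - p)"
  have "?f 0 \<le> ?f p"
  proof (rule deriv_nonneg_mono[OF assms(1), where f' = "\<lambda>p. - p - ln (1 - p)"])
    fix x :: real assume x: "0 \<le> x" "x \<le> p"
    then have pos: "0 < 1 - x" using assms by simp
    show "(?f has_real_derivative - x - ln (1 - x)) (at x)"
      using pos by (auto intro!: derivative_eq_intros)
    show "0 \<le> - x - ln (1 - x)" using ln_le_minus_one[OF pos] by simp
  qed
  then show ?thesis by simp
qed

text \<open>Divided by \<open>p\<close>, the loss is bounded below by a polynomial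
  \<open>1 - u - Y * p + b * p^2\<close> with \<open>Y = 9/20 - u * s\<close>. The last assumption
  says \<open>3/10 \<le> b\<close>, and minimising over \<open>p\<close> leaves
  \<open>Y^2 / (6/5)\<close>.\<close>

lemma loss_large:
  assumes p: "0 < p" "p \<le> 1/2" and l: "l = 9/20 * p * (1 - p)"
    and y: "x = p * (1 - p)\<^sup>2 * y" "0 \<le> x" and s: "s = 9/20 * x" and u: "u = exp (- s)"
    and b: "3/10 \<le> 9/20 * (91/80 - 69/80 * u) + u * s - 9/8 * u * s\<^sup>2"
  shows "p * (1 - u - (9/20 - u * s)\<^sup>2 / (6/5)) \<le> 1 - mean_tilt l (1 - p) y"
proof -
  let ?M = "1 - p"
  define b where "b = exp (- l * y)"
  define z where "z = 9/20 * p\<^sup>2 * (1 - p / 2)"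
  have l01: "0 \<le> l" "l \<le> 1" using exponent_bounds[OF p l] by auto
  have s0: "0 \<le> s" using y s by simp
  have u01: "0 < u" "u \<le> 1" using s0 u by auto
  have ly: "l * y * ?M = s" by (simp add: l s y power2_eq_square)
  have ly2: "s * (1 + p + p\<^sup>2) \<le> l * y"
  proof -
    have "?M * (1 + p + p\<^sup>2) \<le> 1" using p by (simp add: power2_eq_square algebra_simps)
    moreover have "0 \<le> l * y"
    proof (rule ccontr)
      assume "\<not> 0 \<le> l * y"
      then have "l * y * ?M < 0" using p by (intro mult_neg_pos[of "l * y"]) auto
      then show False using ly s0 by simp
    qed
    ultimately have "l * y * (?M * (1 + p + p\<^sup>2)) \<le> l * y * 1" by (intro mult_left_mono)
    then show ?thesis by (simp add: ly[symmetric] mult.assoc)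
  qed
  have t0: "0 \<le> s * (p + p\<^sup>2)" using s0 p by simp
  have "b \<le> exp (- s) * exp (- (s * (p + p\<^sup>2)))"
    using ly2 by (simp add: b_def algebra_simps flip: exp_add)
  then have b1: "b \<le> u * exp (- (s * (p + p\<^sup>2)))" by (simp add: u)
  have bu: "b \<le> u" using order_trans[OF b1 mult_left_le[of "exp (- (s * (p + p\<^sup>2)))" u]] t0 u01 by simp
  have "exp (- (s * (p + p\<^sup>2))) \<le> 1 - s * (p + p\<^sup>2) + (s * (p + p\<^sup>2))\<^sup>2 / 2"
    by (rule exp_neg_bounds[OF t0])
  also have "\<dots> \<le> 1 - s * (p + p\<^sup>2) + 9/8 * s\<^sup>2 * p\<^sup>2"
  proof -
    have "p + p\<^sup>2 \<le> 3/2 * p" using p by (simp add: power2_eq_square)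
    then have "(s * (p + p\<^sup>2))\<^sup>2 \<le> (s * (3/2 * p))\<^sup>2" using t0 s0 by (intro power_mono mult_left_mono) auto
    also have "(s * (3/2 * p))\<^sup>2 = 2 * (9/8 * s\<^sup>2 * p\<^sup>2)" by (simp add: power_mult_distrib power2_eq_square)
    finally show ?thesis by argo
  qed
  finally have "u * exp (- (s * (p + p\<^sup>2))) \<le> u * (1 - s * (p + p\<^sup>2) + 9/8 * s\<^sup>2 * p\<^sup>2)"
    using u01 by (intro mult_left_mono) auto
  with b1 have b2: "b \<le> u * (1 - s * (p + p\<^sup>2) + 9/8 * s\<^sup>2 * p\<^sup>2)" by linarith
  have z0: "0 \<le> z" using p by (simp add: z_def)
  have z1: "z \<le> 9/20 * p\<^sup>2" using p mult_left_mono[of "1 - p/2" 1 "9/20 * p\<^sup>2"] by (simp add: z_def)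
  have p2: "p\<^sup>2 \<le> p / 2" using p by (simp add: power2_eq_square)
  have zz: "z + z\<^sup>2 \<le> 9/20 * p\<^sup>2 * (1 - 11/40 * p)"
  proof -
    have "(1 - p/2) * (1 + z) \<le> (1 - p/2) * (1 + 9/40 * p)" using p z1 p2 by (intro mult_left_mono) auto
    also have "\<dots> \<le> 1 - 11/40 * p" using p by (simp add: field_simps)
    finally have "9/20 * p\<^sup>2 * ((1 - p/2) * (1 + z)) \<le> 9/20 * p\<^sup>2 * (1 - 11/40 * p)" by (intro mult_left_mono) auto
    moreover have "9/20 * p\<^sup>2 * ((1 - p/2) * (1 + z)) = z + z\<^sup>2" by (simp add: z_def power2_eq_square field_simps)
    ultimately show ?thesis by (simp only:)
  qed
  have "?M powr - l \<le> 1 + z + z\<^sup>2"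
  proof -
    have "9/20 * p * - (?M * ln ?M) \<le> 9/20 * p * (p - p\<^sup>2 / 2)"
      using p by (intro mult_left_mono entropy_le) auto
    then have "- l * ln ?M \<le> z" by (simp add: l z_def power2_eq_square field_simps)
    then have "?M powr - l \<le> exp z" using p by (simp add: powr_def)
    also have "\<dots> \<le> 1 + z + z\<^sup>2" using z0 z1 p2 p by (intro exp_bound) auto
    finally show ?thesis .
  qed
  moreover have "0 \<le> p * b + ?M" using p by (simp add: b_def)
  ultimately have "?M powr - l * (p * b + ?M) \<le> (1 + z + z\<^sup>2) * (p * b + ?M)" by (rule mult_right_mono)
  then have "mean_tilt l ?M y \<le> (1 + z + z\<^sup>2) * (p * b + ?M)"
    using mean_tilt_le[of p l y] p l01 unfolding b_def by linarith
  also have "\<dots> \<le> p * b + ?M + (z + z\<^sup>2) * (1 - p * (1 - u))"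
  proof -
    have "(z + z\<^sup>2) * (p * b + ?M) \<le> (z + z\<^sup>2) * (1 - p * (1 - u))"
      using z0 bu p by (intro mult_left_mono) (auto simp: algebra_simps)
    then show ?thesis by (simp add: algebra_simps)
  qed
  also have "(z + z\<^sup>2) * (1 - p * (1 - u)) \<le> 9/20 * p\<^sup>2 * (1 - 11/40 * p) * (1 - p * (1 - u))"
    using p u01 mult_mono[of p 1 "1 - u" 1] by (intro mult_right_mono zz) auto
  also have "9/20 * p\<^sup>2 * (1 - 11/40 * p) * (1 - p * (1 - u)) \<le> 9/20 * p\<^sup>2 * (1 - p * (91/80 - 69/80 * u))"
  proof -
    have "0 \<le> p * (1 - u) * (1/2 - p)" using p u01 by simp
    then have "(1 - 11/40 * p) * (1 - p * (1 - u)) \<le> 1 - p * (91/80 - 69/80 * u)"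
      by (simp add: field_simps)
    then have "9/20 * p\<^sup>2 * ((1 - 11/40 * p) * (1 - p * (1 - u))) \<le> 9/20 * p\<^sup>2 * (1 - p * (91/80 - 69/80 * u))"
      by (intro mult_left_mono) auto
    then show ?thesis by (simp only: mult.assoc)
  qed
  finally have "mean_tilt l ?M y \<le> p * b + ?M + 9/20 * p\<^sup>2 * (1 - p * (91/80 - 69/80 * u))" by simp
  moreover have "p * b \<le> p * (u * (1 - s * (p + p\<^sup>2) + 9/8 * s\<^sup>2 * p\<^sup>2))" using b2 p by simp
  ultimately have "p * (1 - u) - p * ((9/20 - u * s) * p) + p * (p\<^sup>2 * (9/20 * (91/80 - 69/80 * u) + u * s - 9/8 * u * s\<^sup>2))
      \<le> 1 - mean_tilt l ?M y"
    by (simp add: power2_eq_square algebra_simps)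
  moreover have "p * (p\<^sup>2 * (3/10)) \<le> p * (p\<^sup>2 * (9/20 * (91/80 - 69/80 * u) + u * s - 9/8 * u * s\<^sup>2))"
    using p assms(8) by (intro mult_left_mono) auto
  moreover have "p * (1 - u - (9/20 - u * s)\<^sup>2 / (6/5)) \<le> p * (1 - u - (9/20 - u * s) * p + p\<^sup>2 * (3/10))"
  proof (intro mult_left_mono)
    have "c - Y\<^sup>2 / (6/5) \<le> c - Y * p + p\<^sup>2 * (3/10)" for c Y :: real
    proof -
      have "0 \<le> (Y - 3/5 * p)\<^sup>2" by simp
      then show ?thesis by (simp add: power2_eq_square field_simps)
    qed
    then show "1 - u - (9/20 - u * s)\<^sup>2 / (6/5) \<le> 1 - u - (9/20 - u * s) * p + p\<^sup>2 * (3/10)" .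
  qed (use p in auto)
  moreover have "p * (1 - u - (9/20 - u * s) * p + p\<^sup>2 * (3/10)) = p * (1 - u) - p * ((9/20 - u * s) * p) + p * (p\<^sup>2 * (3/10))"
    by (simp only: right_diff_distrib distrib_left)
  ultimately show ?thesis by linarith
qed

text \<open>By monotonicity each term is evaluated at one end of the interval: the loss and the
  remaining gain at \<open>x\<close>, \<open>gauss_loss\<close> at \<open>x'\<close>. The numbers
  \<open>lo\<close> and \<open>hi\<close> enclose \<open>exp (- (9/20 * x))\<close>, and
  \<open>e\<close> bounds \<open>exp (- y)\<close> through \<open>27/4 * X \<le> y\<close>.\<close>

lemma row_tail_step:
  assumes p: "0 < p" "p \<le> 1/2" and l: "l = 9/20 * p * (1 - p)" and X: "X = p * (1 - p)\<^sup>2 * y"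
    and I: "x \<le> X" "X \<le> x'" and x: "0 \<le> x"
    and lo: "0 \<le> cubic (- (9/20 * x))" "lo \<le> cubic (- (9/20 * x)) ^ 4" "0 \<le> lo"
    and hi: "0 \<le> cubic (9/20 * x)" "0 \<le> hi" "1 \<le> hi * cubic (9/20 * x) ^ 4" "hi * (9/20 * x) \<le> 9/20"
    and e: "0 \<le> cubic (27/4 * x)" "0 \<le> e" "1 \<le> e * cubic (27/4 * x) ^ 4"
    and g: "gauss_loss (19/10 * x') \<le> g"
    and b: "3/10 \<le> 9/20 * (91/80 - 69/80 * hi) + hi * (9/20 * x) - 9/8 * hi * (9/20 * x)\<^sup>2"
      "9/20 * x - 9/8 * (9/20 * x)\<^sup>2 \<le> 9/20 * (69/80)"
    and fin: "13/25 * g \<le> 1 - hi - (9/20 - lo * (9/20 * x))\<^sup>2 / (6/5) - 51/100 * e"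
  shows "p * p powr - l - p * tilt l p (- y) + mean_tilt l (1 - p) y \<le> 1 - 13/25 * p * gauss_loss (19/10 * X)"
proof -
  let ?M = "1 - p" and ?s = "9/20 * x"
  define P where "P = p * ?M\<^sup>2"
  have P: "0 < P" "P \<le> 4/27" using p mult_sq_le[of p] by (auto simp: P_def)
  have XP: "X = P * y" by (simp add: X P_def)
  have l01: "0 \<le> l" "l \<le> 1" using exponent_bounds[OF p l] by auto
  \<comment> \<open>The change belonging to the left end \<open>x\<close>; the loss found there
    carries over to \<open>y\<close> by \<open>mean_tilt_antimono\<close>.\<close>
  define y' where "y' = x / P"
  have xy: "x = p * ?M\<^sup>2 * y'" using P by (simp add: y'_def flip: P_def)
  have yy: "0 \<le> y'" "y' \<le> y" using P I x by (simp_all add: y'_def XP field_simps)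
  define u where "u = exp (- ?s)"
  have ul: "lo \<le> u" unfolding u_def using lo by (intro exp_ge_cubic)
  have uh: "u \<le> hi" unfolding u_def using hi by (intro exp_neg_le_cubic)
  have brk: "3/10 \<le> 9/20 * (91/80 - 69/80 * u) + u * ?s - 9/8 * u * ?s\<^sup>2"
  proof -
    have "(hi - u) * (?s - 9/8 * ?s\<^sup>2) \<le> (hi - u) * (9/20 * (69/80))" using b uh by (intro mult_left_mono) auto
    moreover have "3/10 \<le> 9/20 * (91/80 - 69/80 * h) + h * S - 9/8 * h * T
        \<Longrightarrow> (h - u) * (S - 9/8 * T) \<le> (h - u) * (9/20 * (69/80))
        \<Longrightarrow> 3/10 \<le> 9/20 * (91/80 - 69/80 * u) + u * S - 9/8 * u * T" for h S T :: real
      by (simp add: field_simps)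
    ultimately show ?thesis using b(1) by blast
  qed
  have "p * (1 - u - (9/20 - u * ?s)\<^sup>2 / (6/5)) \<le> 1 - mean_tilt l ?M y'"
    by (rule loss_large[OF p l xy x refl u_def brk])
  then have 1: "p * (1 - u - (9/20 - u * ?s)\<^sup>2 / (6/5)) \<le> 1 - mean_tilt l ?M y"
    using mean_tilt_antimono[of ?M l y' y] p l01 yy by simp
  have "p powr - l - tilt l p (- y) \<le> p powr - l * (l * (?M / p * exp (- y)))"
    using p l01 by (intro gain_tail) auto
  also have "\<dots> = p powr - l * (9/20 * ?M\<^sup>2) * exp (- y)" using p by (simp add: l power2_eq_square)
  also have "\<dots> \<le> (1126/1000 * (9/20 * 1)) * e"
  proof (intro mult_mono)
    show "?M\<^sup>2 \<le> 1" using p by (intro power_le_one) auto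
    have "27/4 * x \<le> 27/4 * X" using I by simp
    also have "\<dots> = 27/4 * P * y" by (simp add: XP)
    also have "\<dots> \<le> 1 * y" using P yy by (intro mult_right_mono) auto
    finally have "exp (- y) \<le> exp (- (27/4 * x))" by simp
    also have "\<dots> \<le> e" using e by (intro exp_neg_le_cubic)
    finally show "exp (- y) \<le> e" .
  qed (use powr_neg_weight_le(2)[OF p l] in auto)
  also have "\<dots> \<le> 51/100 * e" using e by simp
  finally have 2: "p * (p powr - l - tilt l p (- y)) \<le> p * (51/100 * e)" using p by simp
  have "gauss_loss (19/10 * X) \<le> gauss_loss (19/10 * x')" using I x by (intro gauss_loss_mono) auto
  with g have "13/25 * gauss_loss (19/10 * X) \<le> 13/25 * g" by simp
  also note fin
  also have "1 - hi - (9/20 - lo * ?s)\<^sup>2 / (6/5) - 51/100 * e \<le> 1 - u - (9/20 - u * ?s)\<^sup>2 / (6/5) - 51/100 * e"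
  proof -
    have "u * ?s \<le> hi * ?s" "lo * ?s \<le> u * ?s" using uh ul x by (auto intro!: mult_right_mono)
    then have "(9/20 - u * ?s)\<^sup>2 \<le> (9/20 - lo * ?s)\<^sup>2" using hi(4) by (intro power_mono) auto
    then show ?thesis using uh by simp
  qed
  finally have "p * (13/25 * gauss_loss (19/10 * X)) \<le> p * (1 - u - (9/20 - u * ?s)\<^sup>2 / (6/5) - 51/100 * e)"
    using p by (intro mult_left_mono) auto
  with 1 2 show ?thesis by (simp add: algebra_simps)
qed

text \<open>The alternative \<open>h \<le> 0\<close> drops \<open>gauss (- v)\<close>, which is
  negligible on the far intervals.\<close>

lemma gauss_loss_le_cubic:
  assumes "0 \<le> cubic (24/25 * v - v\<^sup>2 / 2)" "g \<le> cubic (24/25 * v - v\<^sup>2 / 2) ^ 4"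
    "h \<le> 0 \<or> 0 \<le> cubic (- (24/25 * v) - v\<^sup>2 / 2) \<and> h \<le> cubic (- (24/25 * v) - v\<^sup>2 / 2) ^ 4"
  shows "gauss_loss v \<le> 1 - (g + h) / 2"
proof -
  have "g \<le> gauss v" unfolding gauss_def by (rule exp_ge_cubic[OF assms(1,2)])
  moreover have "h \<le> gauss (- v)"
    using assms(3)
  proof
    assume "h \<le> 0" then show ?thesis using gauss_pos[of "- v"] by linarith
  next
    assume "0 \<le> cubic (- (24/25 * v) - v\<^sup>2 / 2) \<and> h \<le> cubic (- (24/25 * v) - v\<^sup>2 / 2) ^ 4"
    then have "h \<le> exp (- (24/25 * v) - v\<^sup>2 / 2)" by (intro exp_ge_cubic) auto
    then show ?thesis by (simp add: gauss_def)
  qed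
  ultimately show ?thesis by (simp add: gauss_loss_def)
qed

lemma row_tail:
  assumes p: "0 < p" "p \<le> 1/2" and l: "l = 9/20 * p * (1 - p)" and X: "X = p * (1 - p)\<^sup>2 * y" "2/5 \<le> X"
  shows "p * p powr - l - p * tilt l p (- y) + mean_tilt l (1 - p) y \<le> 1 - 13/25 * p * gauss_loss (19/10 * X)"
proof -
  have ?thesis if "2/5 \<le> X" "X \<le> 27/50"
    by (rule row_tail_step[OF p l X(1) that, where lo = "522/625" and hi = "8353/10000" and e = "6859/100000",
          OF _ _ _ _ _ _ _ _ _ _ _ gauss_loss_le_cubic[where g = "7909/5000" and h = "549/2500"]])
       (simp_all add: cubic_def power2_eq_square numeral_eq_Suc)
  moreover have ?thesis if "27/50 \<le> X" "X \<le> 39/50"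
    by (rule row_tail_step[OF p l X(1) that, where lo = "3921/5000" and hi = "1961/2500" and e = "691/25000",
          OF _ _ _ _ _ _ _ _ _ _ _ gauss_loss_le_cubic[where g = "6917/5000" and h = "769/10000"]])
       (simp_all add: cubic_def power2_eq_square numeral_eq_Suc)
  moreover have ?thesis if "39/50 \<le> X" "X \<le> 101/100"
    by (rule row_tail_step[OF p l X(1) that, where lo = "7039/10000" and hi = "7041/10000" and e = "621/100000",
          OF _ _ _ _ _ _ _ _ _ _ _ gauss_loss_le_cubic[where g = "10009/10000" and h = "193/10000"]])
       (simp_all add: cubic_def power2_eq_square numeral_eq_Suc)
  moreover have ?thesis if "101/100 \<le> X" "X \<le> 59/50"
    by (rule row_tail_step[OF p l X(1) that, where lo = "6347/10000" and hi = "1587/2500" and e = "163/100000",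
          OF _ _ _ _ _ _ _ _ _ _ _ gauss_loss_le_cubic[where g = "6969/10000" and h = "19/5000"]])
       (simp_all add: cubic_def power2_eq_square numeral_eq_Suc)
  moreover have ?thesis if "59/50 \<le> X" "X \<le> 131/100"
    by (rule row_tail_step[OF p l X(1) that, where lo = "5879/10000" and hi = "5881/10000" and e = "2/3125",
          OF _ _ _ _ _ _ _ _ _ _ _ gauss_loss_le_cubic[where g = "1231/2500" and h = "3/10000"]])
       (simp_all add: cubic_def power2_eq_square numeral_eq_Suc)
  moreover have ?thesis if "131/100 \<le> X" "X \<le> 71/50"
    by (rule row_tail_step[OF p l X(1) that, where lo = "1109/2000" and hi = "5547/10000" and e = "33/100000",
          OF _ _ _ _ _ _ _ _ _ _ _ gauss_loss_le_cubic[where g = "3497/10000" and h = "0/1"]])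
       (simp_all add: cubic_def power2_eq_square numeral_eq_Suc)
  moreover have ?thesis if "71/50 \<le> X" "X \<le> 153/100"
    by (rule row_tail_step[OF p l X(1) that, where lo = "5277/10000" and hi = "5279/10000" and e = "19/100000",
          OF _ _ _ _ _ _ _ _ _ _ _ gauss_loss_le_cubic[where g = "2373/10000" and h = "0/1"]])
       (simp_all add: cubic_def power2_eq_square numeral_eq_Suc)
  moreover have ?thesis if "153/100 \<le> X" "X \<le> 42/25"
    by (rule row_tail_step[OF p l X(1) that, where lo = "2511/5000" and hi = "201/400" and e = "11/100000",
          OF _ _ _ _ _ _ _ _ _ _ _ gauss_loss_le_cubic[where g = "1291/10000" and h = "0/1"]])
       (simp_all add: cubic_def power2_eq_square numeral_eq_Suc)
  moreover have ?thesis if "42/25 \<le> X" "X \<le> 199/100"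
    by (rule row_tail_step[OF p l X(1) that, where lo = "2347/5000" and hi = "4697/10000" and e = "3/50000",
          OF _ _ _ _ _ _ _ _ _ _ _ gauss_loss_le_cubic[where g = "3/125" and h = "0/1"]])
       (simp_all add: cubic_def power2_eq_square numeral_eq_Suc)
  \<comment> \<open>The last interval is unbounded: \<open>X\<close> itself serves as right end, and
    \<open>gauss_loss\<close> is bounded by 1.\<close>
  moreover have ?thesis if "199/100 \<le> X"
    by (rule row_tail_step[OF p l X(1) that order_refl, where lo = "4081/10000" and hi = "2043/5000" and e = "1/50000",
          OF _ _ _ _ _ _ _ _ _ _ _ gauss_loss_le_1])
       (simp_all add: cubic_def power2_eq_square numeral_eq_Suc)
  ultimately show ?thesis using X(2) by linarith
qed

section \<open>Assembling the inequality for one observation\<close>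

text \<open>Since \<open>gauss\<close> increases only up to \<open>24/25\<close>, the witness
  \<open>v\<close> follows \<open>m * y\<close> only until \<open>X = 2/5\<close>. If the interval
  crosses that point, \<open>v\<close> stops at \<open>19/25 = 19/10 * 2/5\<close>; if it lies
  beyond, \<open>v\<close> is the left end \<open>m * x\<close>. In the last two cases the gain is
  replaced by its limit.\<close>

lemma row_increasing:
  assumes p: "0 < p" "p \<le> 1/2" and l: "l = 9/20 * p * (1 - p)" and m: "m = 19/10 * (p * (1 - p)\<^sup>2)"
    and y: "0 \<le> x" "x \<le> y"
  shows "\<exists>v. m * x \<le> v \<and> v \<le> m * y \<and> p * (tilt l p (- y) - tilt l p (- x)) + mean_tilt l (1 - p) x
    \<le> 1 - 13/25 * p + 13/50 * p * (gauss v + gauss (- (m * x)))"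
proof -
  define P where "P = p * (1 - p)\<^sup>2"
  have P: "0 < P" using p by (simp add: P_def)
  have mP: "m * z = 19/10 * (P * z)" for z by (simp add: m P_def)
  have xy: "P * x \<le> P * y" "0 \<le> P * x" using P y by simp_all
  have l0: "0 \<le> l" using exponent_bounds[OF p l] by simp
  consider "P * y \<le> 2/5" | "P * x \<le> 2/5" "2/5 \<le> P * y" | "2/5 \<le> P * x" by linarith
  then show ?thesis
  proof cases
    case 1
    have "tilt l p (- y) - tilt l p (- x) \<le> 13/50 * (gauss (m * y) - gauss (m * x))"
      using 1 by (intro gain_step[OF p l m y]) (simp add: P_def)
    then have "p * (tilt l p (- y) - tilt l p (- x)) \<le> p * (13/50 * (gauss (m * y) - gauss (m * x)))"
      using p by (intro mult_left_mono) auto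
    moreover have "13/25 * p * gauss_loss (m * x) \<le> 1 - mean_tilt l (1 - p) x"
      unfolding mP by (rule loss_small[OF p l y(1)]) (use 1 xy in \<open>auto simp: P_def\<close>)
    ultimately have "p * (tilt l p (- y) - tilt l p (- x)) + mean_tilt l (1 - p) x
      \<le> 1 - 13/25 * p + 13/50 * p * (gauss (m * y) + gauss (- (m * x)))"
      by (simp add: gauss_loss_def field_simps)
    then show ?thesis using xy by (intro exI[of _ "m * y"]) (simp add: mP)
  next
    case 2
    have "p * tilt l p (- y) \<le> p * p powr - l"
      using p l0 by (intro mult_left_mono tilt_le_limit) auto
    moreover have "p * p powr - l - p * tilt l p (- x) + mean_tilt l (1 - p) x
      \<le> 1 - 13/25 * p + 13/50 * p * (gauss (19/25) + gauss (- (m * x)))"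
      unfolding mP by (rule row_middle[OF p l y(1)]) (use 2 in \<open>auto simp: P_def\<close>)
    ultimately have "p * (tilt l p (- y) - tilt l p (- x)) + mean_tilt l (1 - p) x
      \<le> 1 - 13/25 * p + 13/50 * p * (gauss (19/25) + gauss (- (m * x)))"
      by (simp add: right_diff_distrib)
    then show ?thesis using 2 by (intro exI[of _ "19/25"]) (simp add: mP)
  next
    case 3
    have "p * tilt l p (- y) \<le> p * p powr - l"
      using p l0 by (intro mult_left_mono tilt_le_limit) auto
    moreover have "p * p powr - l - p * tilt l p (- x) + mean_tilt l (1 - p) x \<le> 1 - 13/25 * p * gauss_loss (m * x)"
      unfolding mP by (rule row_tail[OF p l]) (use 3 in \<open>auto simp: P_def\<close>)
    ultimately have "p * (tilt l p (- y) - tilt l p (- x)) + mean_tilt l (1 - p) x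
      \<le> 1 - 13/25 * p + 13/50 * p * (gauss (m * x) + gauss (- (m * x)))"
      by (simp add: gauss_loss_def field_simps)
    then show ?thesis using xy by (intro exI[of _ "m * x"]) (simp add: mP)
  qed
qed

text \<open>An interval on one side of 0 reduces to \<open>row_increasing\<close> through the two
  swap lemmas. An interval around 0 is split there: at \<open>x = 0\<close> the loss vanishes and
  the gains of the two halves add up.\<close>

lemma row_ordered:
  assumes p: "0 < p" "p \<le> 1/2" and l: "l = 9/20 * p * (1 - p)" and m: "m = 19/10 * (p * (1 - p)\<^sup>2)"
    and u: "u0 \<le> u1"
  shows "\<exists>v w. u0 \<le> v \<and> v \<le> u1 \<and> u0 \<le> w \<and> w \<le> u1 \<and>
    p * tilt l p (- u1) + (1 - p) * tilt l (1 - p) u0 \<le> 1 - 13/25 * p + 13/50 * p * (gauss (m * v) + gauss (- (m * w)))"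
proof -
  have l01: "0 \<le> l" "l \<le> 1" using exponent_bounds[OF p l] by auto
  have m0: "0 < m" using p by (simp add: m)
  have star: "\<exists>v. x \<le> v \<and> v \<le> y \<and> p * (tilt l p (- y) - tilt l p (- x)) + mean_tilt l (1 - p) x
    \<le> 1 - 13/25 * p + 13/50 * p * (gauss (m * v) + gauss (- (m * x)))" if xy: "0 \<le> x" "x \<le> y" for x y
  proof -
    obtain v where "m * x \<le> v" "v \<le> m * y" "p * (tilt l p (- y) - tilt l p (- x)) + mean_tilt l (1 - p) x
      \<le> 1 - 13/25 * p + 13/50 * p * (gauss v + gauss (- (m * x)))"
      using row_increasing[OF p l m xy] by blast
    then show ?thesis using m0 by (intro exI[of _ "v / m"]) (simp add: field_simps)
  qed
  consider "0 \<le> u0" | "u1 \<le> 0" | "u0 \<le> 0" "0 \<le> u1" by linarith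
  then show ?thesis
  proof cases
    case 1
    obtain v where "u0 \<le> v" "v \<le> u1" "p * (tilt l p (- u1) - tilt l p (- u0)) + mean_tilt l (1 - p) u0
      \<le> 1 - 13/25 * p + 13/50 * p * (gauss (m * v) + gauss (- (m * u0)))"
      using star[OF 1 u] by blast
    moreover have "mean_tilt l p u0 \<le> mean_tilt l (1 - p) u0" by (rule mean_tilt_swap[OF p l01 1])
    ultimately have "p * tilt l p (- u1) + (1 - p) * tilt l (1 - p) u0
      \<le> 1 - 13/25 * p + 13/50 * p * (gauss (m * v) + gauss (- (m * u0)))"
      by (simp add: mean_tilt_def right_diff_distrib)
    then show ?thesis using \<open>u0 \<le> v\<close> \<open>v \<le> u1\<close> u by blast
  next
    case 2
    then have y: "0 \<le> - u1" "- u1 \<le> - u0" using u by auto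
    obtain v where v: "- u1 \<le> v" "v \<le> - u0" and le: "p * (tilt l p (- (- u0)) - tilt l p (- (- u1))) + mean_tilt l (1 - p) (- u1)
      \<le> 1 - 13/25 * p + 13/50 * p * (gauss (m * v) + gauss (- (m * (- u1))))"
      using star[OF y] by blast
    have "(1 - p) * (tilt l (1 - p) (- (- u0)) - tilt l (1 - p) (- (- u1))) \<le> p * (tilt l p (- (- u0)) - tilt l p (- (- u1)))"
      by (rule gain_swap[OF p l01 y])
    with le have "p * tilt l p (- u1) + (1 - p) * tilt l (1 - p) u0
      \<le> 1 - 13/25 * p + 13/50 * p * (gauss (m * u1) + gauss (- (m * (- v))))"
      by (simp add: mean_tilt_def field_simps)
    then show ?thesis using v u by (intro exI[of _ u1] exI[of _ "- v"]) auto
  next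
    case 3
    obtain v where v: "0 \<le> v" "v \<le> u1" and a: "p * (tilt l p (- u1) - tilt l p (- 0)) + mean_tilt l (1 - p) 0
      \<le> 1 - 13/25 * p + 13/50 * p * (gauss (m * v) + gauss (- (m * 0)))"
      using star[OF order_refl 3(2)] by blast
    have y: "0 \<le> - u0" using 3 by simp
    obtain w where w: "0 \<le> w" "w \<le> - u0" and b: "p * (tilt l p (- (- u0)) - tilt l p (- 0)) + mean_tilt l (1 - p) 0
      \<le> 1 - 13/25 * p + 13/50 * p * (gauss (m * w) + gauss (- (m * 0)))"
      using star[OF order_refl y] by blast
    have "(1 - p) * (tilt l (1 - p) (- (- u0)) - tilt l (1 - p) (- 0)) \<le> p * (tilt l p (- (- u0)) - tilt l p (- 0))"
      by (rule gain_swap[OF p l01 order_refl y])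
    with a b have "p * tilt l p (- u1) + (1 - p) * tilt l (1 - p) u0
      \<le> 1 - 13/25 * p + 13/50 * p * (gauss (m * v) + gauss (- (m * (- w))))"
      by (simp add: field_simps)
    then show ?thesis using v w 3 by (intro exI[of _ v] exI[of _ "- w"]) auto
  qed
qed

text \<open>For \<open>u1 < u0\<close>, raising \<open>u1\<close> to \<open>u0\<close> only
  increases the left side, so the degenerate interval suffices.\<close>

lemma row_flat:
  assumes p: "0 < p" "p \<le> 1/2" and l: "l = 9/20 * p * (1 - p)" and m: "m = 19/10 * (p * (1 - p)\<^sup>2)"
  shows "\<exists>v w. min u0 u1 \<le> v \<and> v \<le> max u0 u1 \<and> min u0 u1 \<le> w \<and> w \<le> max u0 u1 \<and>
    p * tilt l p (- u1) + (1 - p) * tilt l (1 - p) u0 \<le> 1 - 13/25 * p + 13/50 * p * (gauss (m * v) + gauss (- (m * w)))"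
proof (cases "u0 \<le> u1")
  case True
  then show ?thesis using row_ordered[OF p l m True] by (simp add: min_def max_def)
next
  case False
  have l0: "0 \<le> l" using exponent_bounds[OF p l] by simp
  have "p * tilt l p (- u1) \<le> p * tilt l p (- u0)"
    using False p l0 by (intro mult_left_mono tilt_antimono) auto
  moreover obtain v w where "u0 \<le> v" "v \<le> u0" "u0 \<le> w" "w \<le> u0"
    "p * tilt l p (- u0) + (1 - p) * tilt l (1 - p) u0 \<le> 1 - 13/25 * p + 13/50 * p * (gauss (m * v) + gauss (- (m * w)))"
    using row_ordered[OF p l m order_refl[of u0]] by blast
  ultimately show ?thesis using False by (intro exI[of _ v] exI[of _ w]) (auto simp: min_def max_def)
qed

text \<open>
  Both sides are affine in the scale of the exponent up to Bernoulli's inequality, so a smaller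
  exponent is compensated by a proportionally smaller weight of the comparison.
\<close>

lemma row_flat_scaled:
  assumes p: "0 < p" "p \<le> 1/2" and l: "0 < l" "l \<le> 9/20 * p * (1 - p)"
  shows "\<exists>m a. 0 \<le> a \<and> a \<le> 13/25 * p \<and> (\<forall>u0 u1. \<exists>v w. min u0 u1 \<le> v \<and> v \<le> max u0 u1 \<and> min u0 u1 \<le> w \<and> w \<le> max u0 u1 \<and>
    p * tilt l p (- u1) + (1 - p) * tilt l (1 - p) u0 \<le> 1 - a + a / 2 * (gauss (m * v) + gauss (- (m * w))))"
proof -
  have p': "p < 1" "0 < 1 - p" "1 - p < 1" using p by auto
  define k where "k = 9/20 * p * (1 - p)"
  define m where "m = 19/10 * (p * (1 - p)\<^sup>2)"
  have k: "0 < k" using p by (simp add: k_def)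
  define t where "t = l / k"
  have "l \<le> k" using l(2) by (simp only: k_def)
  then have t: "0 \<le> t" "t \<le> 1" using k l(1) by (auto simp: t_def)
  have lk: "l = k * t" using k by (simp add: t_def)
  have tp: "tilt l a u = tilt k a u powr t" if "0 < a" "a < 1" for a u
    by (simp add: tilt_def lk powr_powr)
  have "\<exists>v w. min u0 u1 \<le> v \<and> v \<le> max u0 u1 \<and> min u0 u1 \<le> w \<and> w \<le> max u0 u1 \<and>
    p * tilt l p (- u1) + (1 - p) * tilt l (1 - p) u0 \<le> 1 - t * (13/25 * p) + t * (13/25 * p) / 2 * (gauss (m * v) + gauss (- (m * w)))"
    for u0 u1
  proof -
    obtain v w where vw: "min u0 u1 \<le> v" "v \<le> max u0 u1" "min u0 u1 \<le> w" "w \<le> max u0 u1"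
      and le: "p * tilt k p (- u1) + (1 - p) * tilt k (1 - p) u0 \<le> 1 - 13/25 * p + 13/50 * p * (gauss (m * v) + gauss (- (m * w)))"
      using row_flat[OF p k_def m_def, of u0 u1] by blast
    have "tilt l p (- u1) \<le> 1 + t * (tilt k p (- u1) - 1)"
      unfolding tp[OF p(1) p'(1)] by (intro bernoulli_powr tilt_pos t p(1) p')
    then have "p * tilt l p (- u1) \<le> p * (1 + t * (tilt k p (- u1) - 1))" using p by (intro mult_left_mono) auto
    moreover have "tilt l (1 - p) u0 \<le> 1 + t * (tilt k (1 - p) u0 - 1)"
      unfolding tp[OF p'(2,3)] by (intro bernoulli_powr tilt_pos t p')
    then have "(1 - p) * tilt l (1 - p) u0 \<le> (1 - p) * (1 + t * (tilt k (1 - p) u0 - 1))" using p by (intro mult_left_mono) auto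
    moreover have "t * (p * tilt k p (- u1) + (1 - p) * tilt k (1 - p) u0)
        \<le> t * (1 - 13/25 * p + 13/50 * p * (gauss (m * v) + gauss (- (m * w))))"
      by (rule mult_left_mono[OF le t(1)])
    ultimately have "p * tilt l p (- u1) + (1 - p) * tilt l (1 - p) u0
        \<le> 1 - t * (13/25 * p) + t * (13/25 * p) / 2 * (gauss (m * v) + gauss (- (m * w)))"
      by (simp add: field_simps)
    then show ?thesis using vw by blast
  qed
  moreover have "t * (13/25 * p) \<le> 13/25 * p" using t p by (simp add: mult_left_le_one_le)
  ultimately show ?thesis using t p by (intro exI[of _ m] exI[of _ "t * (13/25 * p)"]) auto
qed

text \<open>For \<open>p > 1/2\<close> the two responses are exchanged and all signs
  reversed.\<close>

lemma row_flat_any: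
  assumes p: "0 < p" "p < 1" and l: "0 < l" "l \<le> 9/20 * p * (1 - p)"
  shows "\<exists>m a. 0 \<le> a \<and> a \<le> 13/25 * p \<and> a \<le> 13/25 * (1 - p) \<and>
    (\<forall>u0 u1. \<exists>v w. min u0 u1 \<le> v \<and> v \<le> max u0 u1 \<and> min u0 u1 \<le> w \<and> w \<le> max u0 u1 \<and>
    p * tilt l p (- u1) + (1 - p) * tilt l (1 - p) u0 \<le> 1 - a + a / 2 * (gauss (m * v) + gauss (- (m * w))))"
proof (cases "p \<le> 1/2")
  case True
  obtain m a where "0 \<le> a" "a \<le> 13/25 * p" and
    ex: "\<forall>u0 u1. \<exists>v w. min u0 u1 \<le> v \<and> v \<le> max u0 u1 \<and> min u0 u1 \<le> w \<and> w \<le> max u0 u1 \<and>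
    p * tilt l p (- u1) + (1 - p) * tilt l (1 - p) u0 \<le> 1 - a + a / 2 * (gauss (m * v) + gauss (- (m * w)))"
    using row_flat_scaled[OF p(1) True l] by blast
  moreover have "a \<le> 13/25 * (1 - p)" using \<open>a \<le> 13/25 * p\<close> True by simp
  ultimately show ?thesis by blast
next
  case False
  have p': "0 < 1 - p" "1 - p \<le> 1/2" "l \<le> 9/20 * (1 - p) * (1 - (1 - p))" using p False l by (auto simp: mult_ac)
  obtain m a where a: "0 \<le> a" "a \<le> 13/25 * (1 - p)" and
    ex: "\<And>u0 u1. \<exists>v w. min u0 u1 \<le> v \<and> v \<le> max u0 u1 \<and> min u0 u1 \<le> w \<and> w \<le> max u0 u1 \<and>
    (1 - p) * tilt l (1 - p) (- u1) + (1 - (1 - p)) * tilt l (1 - (1 - p)) u0 \<le> 1 - a + a / 2 * (gauss (m * v) + gauss (- (m * w)))"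
    using row_flat_scaled[OF p'(1,2) l(1) p'(3)] by blast
  have "\<exists>v w. min u0 u1 \<le> v \<and> v \<le> max u0 u1 \<and> min u0 u1 \<le> w \<and> w \<le> max u0 u1 \<and>
    p * tilt l p (- u1) + (1 - p) * tilt l (1 - p) u0 \<le> 1 - a + a / 2 * (gauss (m * v) + gauss (- (m * w)))" for u0 u1
  proof -
    obtain v w where "min (- u1) (- u0) \<le> v" "v \<le> max (- u1) (- u0)" "min (- u1) (- u0) \<le> w" "w \<le> max (- u1) (- u0)"
      "(1 - p) * tilt l (1 - p) (- (- u0)) + (1 - (1 - p)) * tilt l (1 - (1 - p)) (- u1) \<le> 1 - a + a / 2 * (gauss (m * v) + gauss (- (m * w)))"
      using ex[of "- u1" "- u0"] by blast
    then show ?thesis by (intro exI[of _ "- w"] exI[of _ "- v"]) (auto simp: min_def max_def algebra_simps split: if_splits)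
  qed
  moreover have "a \<le> 13/25 * p" using a False by simp
  ultimately show ?thesis using a by blast
qed

text \<open>
  \<open>S\<close>, \<open>T\<close>, \<open>U\<close> stand for suprema and \<open>A0\<close>, \<open>A1\<close> for the values of the other factors at the maximizers of the
  two likelihoods; along the segment between these, log-concavity bounds the other factors below by \<open>min A0 A1\<close>.
\<close>

lemma row_weighted:
  assumes p: "0 < p" "p < 1" and l: "0 < l" "l \<le> 9/20 * p * (1 - p)"
  shows "\<exists>m a. 0 \<le> a \<and> a \<le> 1 \<and> (\<forall>u0 u1 A0 A1 S T U. 0 \<le> A0 \<longrightarrow> 0 \<le> A1 \<longrightarrow> A0 \<le> S \<longrightarrow> A1 \<le> S \<longrightarrow>
    (\<forall>v. min u0 u1 \<le> v \<longrightarrow> v \<le> max u0 u1 \<longrightarrow> min A0 A1 * gauss (m * v) \<le> T \<and> min A0 A1 * gauss (- (m * v)) \<le> U) \<longrightarrow>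
    p * (A1 * tilt l p (- u1)) + (1 - p) * (A0 * tilt l (1 - p) u0) \<le> (1 - a) * S + a / 2 * (T + U))"
proof -
  obtain m a where a: "0 \<le> a" "a \<le> 13/25 * p" "a \<le> 13/25 * (1 - p)" and
    ex: "\<And>u0 u1. \<exists>v w. min u0 u1 \<le> v \<and> v \<le> max u0 u1 \<and> min u0 u1 \<le> w \<and> w \<le> max u0 u1 \<and>
    p * tilt l p (- u1) + (1 - p) * tilt l (1 - p) u0 \<le> 1 - a + a / 2 * (gauss (m * v) + gauss (- (m * w)))"
    using row_flat_any[OF p l] by blast
  have "p * (1 - p) \<le> 1/4" using zero_le_square[of "p - 1/2"] by (simp add: algebra_simps)
  moreover have "l \<le> 9/20 * (p * (1 - p))" using l(2) by (simp only: mult.assoc)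
  ultimately have l2: "l \<le> 9/80" by linarith
  \<comment> \<open>One response alone contributes at most \<open>q powr (1 - l)\<close>; as
    \<open>13/25 \<le> 1 - l\<close>, the atom of weight \<open>1 - a\<close> absorbs it.\<close>
  have single: "q * tilt l q u \<le> 1 - a" if q: "0 < q" "q < 1" "a \<le> 13/25 * (1 - q)" for q u
  proof -
    have "q * tilt l q u \<le> q * q powr - l" using q l by (intro mult_left_mono tilt_le_limit) auto
    also have "\<dots> = q powr (1 - l)" using q by (simp add: powr_diff powr_minus_divide)
    also have "\<dots> \<le> 1 + (1 - l) * (q - 1)" using q l2 l by (intro bernoulli_powr) auto
    also have "\<dots> \<le> 1 - a" using q l2 mult_right_mono[of "13/25" "1 - l" "1 - q"] by (simp add: field_simps)
    finally show ?thesis .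
  qed
  have E1: "p * tilt l p u \<le> 1 - a" and E0: "(1 - p) * tilt l (1 - p) u \<le> 1 - a" for u
    using single[of p u] single[of "1 - p" u] a p by auto
  have main: "p * (A1 * tilt l p (- u1)) + (1 - p) * (A0 * tilt l (1 - p) u0) \<le> (1 - a) * S + a / 2 * (T + U)"
    if A: "0 \<le> A0" "0 \<le> A1" "A0 \<le> S" "A1 \<le> S" and
      TU: "\<And>v. min u0 u1 \<le> v \<Longrightarrow> v \<le> max u0 u1 \<Longrightarrow> min A0 A1 * gauss (m * v) \<le> T \<and> min A0 A1 * gauss (- (m * v)) \<le> U"
    for u0 u1 A0 A1 S T U
  proof -
    let ?A = "min A0 A1" and ?E1 = "p * tilt l p (- u1)" and ?E0 = "(1 - p) * tilt l (1 - p) u0"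
    obtain v w where vw: "min u0 u1 \<le> v" "v \<le> max u0 u1" "min u0 u1 \<le> w" "w \<le> max u0 u1"
      and le: "?E1 + ?E0 \<le> 1 - a + a / 2 * (gauss (m * v) + gauss (- (m * w)))"
      using ex[of u0 u1] by blast
    have "?A * (?E1 + ?E0) \<le> ?A * (1 - a + a / 2 * (gauss (m * v) + gauss (- (m * w))))"
      using A by (intro mult_left_mono le) auto
    also have "\<dots> = ?A * (1 - a) + a / 2 * (?A * gauss (m * v) + ?A * gauss (- (m * w)))"
      by (simp add: algebra_simps)
    also have "\<dots> \<le> ?A * (1 - a) + a / 2 * (T + U)"
      using TU[OF vw(1,2)] TU[OF vw(3,4)] a by (intro add_left_mono mult_left_mono add_mono) auto
    finally have 1: "?A * (?E1 + ?E0) \<le> ?A * (1 - a) + a / 2 * (T + U)" .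
    \<comment> \<open>The excess of \<open>A0\<close> or \<open>A1\<close> over the minimum weighs
      one response only, so \<open>single\<close> suffices for it.\<close>
    have 2: "(A1 - ?A) * ?E1 \<le> (A1 - ?A) * (1 - a)" "(A0 - ?A) * ?E0 \<le> (A0 - ?A) * (1 - a)"
      by (intro mult_left_mono E1 E0; simp)+
    have "max A0 A1 * (1 - a) \<le> S * (1 - a)" using A a p by (intro mult_right_mono) auto
    moreover have "A1 - ?A + (A0 - ?A) + ?A = max A0 A1" by (simp add: min_def max_def)
    then have "(A1 - ?A) * (1 - a) + (A0 - ?A) * (1 - a) + ?A * (1 - a) = max A0 A1 * (1 - a)"
      by (simp only: distrib_right[symmetric])
    moreover have "p * (A1 * tilt l p (- u1)) + (1 - p) * (A0 * tilt l (1 - p) u0)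
        = (A1 - ?A) * ?E1 + (A0 - ?A) * ?E0 + ?A * (?E1 + ?E0)" by (simp add: algebra_simps)
    ultimately show ?thesis using 1 2 by (simp add: mult.commute[of S])
  qed
  have "a \<le> 1" using a p by simp
  with a main show ?thesis by (intro exI[of _ m] exI[of _ a]) blast
qed

section \<open>Replacing the observations by random quadratic forms\<close>

abbreviation E :: "'a pmf \<Rightarrow> ('a \<Rightarrow> real) \<Rightarrow> real" where
  "E \<equiv> measure_pmf.expectation"

lemma E_mono:
  assumes "finite (set_pmf P)" "\<And>x. x \<in> set_pmf P \<Longrightarrow> f x \<le> g x"
  shows "E P f \<le> E P g"
  using assms by (intro integral_mono_AE integrable_measure_pmf_finite) (auto simp: AE_measure_pmf_iff)

lemma E_bind:
  assumes "finite (set_pmf P)" "\<And>x. x \<in> set_pmf P \<Longrightarrow> finite (set_pmf (Q x))"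
  shows "E (P \<bind> Q) f = E P (\<lambda>x. E (Q x) f)"
  using assms by (subst pmf_expectation_bind[where A = "set_pmf P"]) (auto simp: integral_measure_pmf[of "set_pmf P"])

lemma E_swap:
  assumes "finite (set_pmf P)" "finite (set_pmf Q)"
  shows "E P (\<lambda>x. E Q (\<lambda>y. f x y)) = E Q (\<lambda>y. E P (\<lambda>x. f x y))"
  using assms
  by (simp add: integral_measure_pmf[of "set_pmf P"] integral_measure_pmf[of "set_pmf Q"] sum_distrib_left mult_ac)
     (rule sum.swap)

lemma E_bernoulli:
  assumes "0 \<le> p" "p \<le> 1"
  shows "E (bernoulli_pmf p) f = p * f True + (1 - p) * f False"
  using assms by (simp add: integral_measure_pmf[of UNIV] UNIV_bool)

lemma finite_set_Pi_pmf:
  fixes n :: nat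
  assumes "\<And>i. i < n \<Longrightarrow> finite (set_pmf (P i))"
  shows "finite (set_pmf (Pi_pmf {..<n} d P))"
  unfolding set_Pi_pmf[OF finite_lessThan] using assms by (intro finite_PiE_dflt) auto

lemma E_Pi_Suc:
  assumes "\<And>i. i \<le> n \<Longrightarrow> finite (set_pmf (P i))"
  shows "E (Pi_pmf {..<Suc n} d P) f = E (P n) (\<lambda>a. E (Pi_pmf {..<n} d P) (\<lambda>y. f (y(n := a))))"
proof -
  have fin: "finite (set_pmf (Pi_pmf {..<n} d P))" using assms by (intro finite_set_Pi_pmf) auto
  have "Pi_pmf {..<Suc n} d P = P n \<bind> (\<lambda>a. Pi_pmf {..<n} d P \<bind> (\<lambda>y. return_pmf (y(n := a))))"
    unfolding lessThan_Suc by (rule Pi_pmf_insert') auto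
  then show ?thesis using assms fin by (simp add: E_bind)
qed

definition blend :: "real \<Rightarrow> (nat \<Rightarrow> real) \<Rightarrow> (nat \<Rightarrow> real) \<Rightarrow> nat \<Rightarrow> real" where
  "blend t x y = (\<lambda>j. (1 - t) * x j + t * y j)"

text \<open>Boundedness makes the real-valued supremum in \<open>supexp\<close> a genuine one;
  concavity yields the lower bound on segments. Both survive addition, as the row-by-row induction
  requires.\<close>

definition concave_bdd :: "((nat \<Rightarrow> real) \<Rightarrow> real) \<Rightarrow> bool" where
  "concave_bdd F \<longleftrightarrow> (\<forall>x y t. 0 \<le> t \<longrightarrow> t \<le> 1 \<longrightarrow> (1 - t) * F x + t * F y \<le> F (blend t x y)) \<and> (\<exists>b. \<forall>x. F x \<le> b)"

definition supexp :: "((nat \<Rightarrow> real) \<Rightarrow> real) \<Rightarrow> real" where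
  "supexp F = (SUP c. exp (F c))"

lemma supexp_upper: "concave_bdd F \<Longrightarrow> exp (F c) \<le> supexp F"
proof -
  assume "concave_bdd F"
  then obtain b where "\<And>x. F x \<le> b" by (auto simp: concave_bdd_def)
  then have "bdd_above (range (\<lambda>c. exp (F c)))" by (intro bdd_aboveI[of _ "exp b"]) auto
  then show ?thesis unfolding supexp_def by (intro cSUP_upper) auto
qed

lemma supexp_le: "(\<And>c. exp (F c) \<le> b) \<Longrightarrow> supexp F \<le> b"
  unfolding supexp_def by (intro cSUP_least) auto

lemma concave_bdd_0: "concave_bdd (\<lambda>c. 0)"
  by (auto simp: concave_bdd_def)

lemma concave_bdd_add:
  assumes "concave_bdd F" "concave_bdd G" shows "concave_bdd (\<lambda>c. F c + G c)"
  unfolding concave_bdd_def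
proof (intro conjI allI impI)
  fix x y t assume t: "0 \<le> (t::real)" "t \<le> 1"
  have "(1 - t) * F x + t * F y \<le> F (blend t x y)" "(1 - t) * G x + t * G y \<le> G (blend t x y)"
    using assms t by (auto simp: concave_bdd_def)
  then show "(1 - t) * (F x + G x) + t * (F y + G y) \<le> F (blend t x y) + G (blend t x y)"
    by (simp add: algebra_simps)
next
  obtain a b where "\<And>x. F x \<le> a" "\<And>x. G x \<le> b" using assms unfolding concave_bdd_def by blast
  then have "\<forall>x. F x + G x \<le> a + b" by (simp add: add_mono)
  then show "\<exists>b. \<forall>x. F x + G x \<le> b" by blast
qed

lemma concave_bdd_sum:
  "finite A \<Longrightarrow> (\<And>i. i \<in> A \<Longrightarrow> concave_bdd (F i)) \<Longrightarrow> concave_bdd (\<lambda>c. \<Sum>i\<in>A. F i c)"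
  by (induction rule: finite_induct) (auto intro: concave_bdd_0 concave_bdd_add)

text \<open>A hybrid argument of Lindeberg type. The assumption \<open>row\<close> covers every
  concave \<open>G\<close>, so that the rows already replaced and those still to come can be
  absorbed into \<open>G\<close>.\<close>

lemma replace_rows:
  fixes n :: nat and P :: "nat \<Rightarrow> 'a pmf" and Q :: "nat \<Rightarrow> 'b pmf"
  assumes P: "\<And>i. i < n \<Longrightarrow> finite (set_pmf (P i))" and Q: "\<And>i. i < n \<Longrightarrow> finite (set_pmf (Q i))"
    and f: "\<And>i a. i < n \<Longrightarrow> concave_bdd (f i a)" and g: "\<And>i b. i < n \<Longrightarrow> concave_bdd (g i b)"
    and row: "\<And>i G. i < n \<Longrightarrow> concave_bdd G \<Longrightarrow>
      E (P i) (\<lambda>a. supexp (\<lambda>c. G c + f i a c)) \<le> E (Q i) (\<lambda>b. supexp (\<lambda>c. G c + g i b c))"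
    and G: "concave_bdd G"
  shows "E (Pi_pmf {..<n} d P) (\<lambda>y. supexp (\<lambda>c. G c + (\<Sum>i<n. f i (y i) c)))
    \<le> E (Pi_pmf {..<n} d' Q) (\<lambda>z. supexp (\<lambda>c. G c + (\<Sum>i<n. g i (z i) c)))"
  using assms
proof (induction n arbitrary: G)
  case 0
  then show ?case by simp
next
  case (Suc n)
  let ?P = "Pi_pmf {..<n} d P" and ?Q = "Pi_pmf {..<n} d' Q"
  have fin: "finite (set_pmf ?P)" "finite (set_pmf ?Q)" "finite (set_pmf (P n))" "finite (set_pmf (Q n))"
    using Suc.prems by (auto intro!: finite_set_Pi_pmf)
  have up: "(\<Sum>i<Suc n. h i ((y(n := a)) i) c) = (\<Sum>i<n. h i (y i) c) + h n a c"
    for h :: "nat \<Rightarrow> 'z \<Rightarrow> (nat \<Rightarrow> real) \<Rightarrow> real" and y a c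
  proof -
    have "(\<Sum>i<n. h i ((y(n := a)) i) c) = (\<Sum>i<n. h i (y i) c)" by (intro sum.cong) auto
    then show ?thesis by simp
  qed
  have "E (Pi_pmf {..<Suc n} d P) (\<lambda>y. supexp (\<lambda>c. G c + (\<Sum>i<Suc n. f i (y i) c)))
      = E (P n) (\<lambda>a. E ?P (\<lambda>y. supexp (\<lambda>c. G c + ((\<Sum>i<n. f i (y i) c) + f n a c))))"
    using Suc.prems(1) by (subst E_Pi_Suc) (simp_all only: up less_Suc_eq_le)
  also have "\<dots> = E ?P (\<lambda>y. E (P n) (\<lambda>a. supexp (\<lambda>c. (G c + (\<Sum>i<n. f i (y i) c)) + f n a c)))"
    using E_swap[OF fin(3,1)] by (simp only: add.assoc)
  also have "\<dots> \<le> E ?P (\<lambda>y. E (Q n) (\<lambda>b. supexp (\<lambda>c. (G c + (\<Sum>i<n. f i (y i) c)) + g n b c)))"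
    using Suc.prems by (intro E_mono fin Suc.prems(5) concave_bdd_add concave_bdd_sum) auto
  also have "\<dots> = E (Q n) (\<lambda>b. E ?P (\<lambda>y. supexp (\<lambda>c. (G c + g n b c) + (\<Sum>i<n. f i (y i) c))))"
    using E_swap[OF fin(1,4)] by (simp only: add_ac)
  also have "\<dots> \<le> E (Q n) (\<lambda>b. E ?Q (\<lambda>z. supexp (\<lambda>c. (G c + g n b c) + (\<Sum>i<n. g i (z i) c))))"
    using Suc.prems by (intro E_mono fin Suc.IH concave_bdd_add) auto
  also have "\<dots> = E (Pi_pmf {..<Suc n} d' Q) (\<lambda>z. supexp (\<lambda>c. G c + (\<Sum>i<Suc n. g i (z i) c)))"
    using Suc.prems(2) by (subst E_Pi_Suc) (simp_all only: up less_Suc_eq_le add_ac)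
  finally show ?case .
qed

section \<open>Quadratic forms in random signs\<close>

lemma gaussian_exp_integral:
  "integrable lborel (\<lambda>z. std_normal_density z * exp (t * z))"
  "(\<integral>z. std_normal_density z * exp (t * z) \<partial>lborel) = exp (t\<^sup>2 / 2)"
proof -
  have eq: "std_normal_density z * exp (t * z) = exp (t\<^sup>2 / 2) * normal_density t 1 z" for z
    by (simp add: normal_density_def power2_eq_square algebra_simps add_divide_distrib diff_divide_distrib flip: exp_add)
  show "integrable lborel (\<lambda>z. std_normal_density z * exp (t * z))"
    unfolding eq by (intro integrable_mult_right integrable_normal_density) simp_all
  show "(\<integral>z. std_normal_density z * exp (t * z) \<partial>lborel) = exp (t\<^sup>2 / 2)"
    unfolding eq by simp
qed

text \<open>Completing the square with \<open>q = 24/25\<close>: variance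
  \<open>1 / (1 - q^2) = (25/7)^2\<close>, mean \<open>q * t / (1 - q^2)\<close>, exponent
  \<open>q^2 * t^2 / (2 * (1 - q^2))\<close>. Here \<open>288/625 = q^2 / 2\<close>. The standard
  deviation \<open>25/7\<close> is the price per dimension.\<close>

lemma gaussian_square_integral:
  "integrable lborel (\<lambda>z. std_normal_density z * exp (288/625 * z\<^sup>2 + 24/25 * t * z))"
  "(\<integral>z. std_normal_density z * exp (288/625 * z\<^sup>2 + 24/25 * t * z) \<partial>lborel) = 25/7 * exp (288/49 * t\<^sup>2)"
proof -
  have s: "sqrt (2 * pi * (25/7)\<^sup>2) = 25/7 * sqrt (2 * pi)"
    by (simp add: real_sqrt_mult)
  have eq: "std_normal_density z * exp (288/625 * z\<^sup>2 + 24/25 * t * z)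
      = 25/7 * exp (288/49 * t\<^sup>2) * normal_density (600/49 * t) (25/7) z" for z
  proof -
    have "- z\<^sup>2 / 2 + (288/625 * z\<^sup>2 + 24/25 * t * z) = 288/49 * t\<^sup>2 + - (z - 600/49 * t)\<^sup>2 / (2 * (25/7)\<^sup>2)"
      by (simp add: power2_eq_square field_simps)
    then have "exp (- z\<^sup>2 / 2) * exp (288/625 * z\<^sup>2 + 24/25 * t * z)
        = exp (288/49 * t\<^sup>2) * exp (- (z - 600/49 * t)\<^sup>2 / (2 * (25/7)\<^sup>2))"
      by (simp only: flip: exp_add)
    then show ?thesis unfolding std_normal_density_def normal_density_def s by simp
  qed
  show "integrable lborel (\<lambda>z. std_normal_density z * exp (288/625 * z\<^sup>2 + 24/25 * t * z))"
    unfolding eq by (intro integrable_mult_right integrable_normal_density) simp_all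
  show "(\<integral>z. std_normal_density z * exp (288/625 * z\<^sup>2 + 24/25 * t * z) \<partial>lborel) = 25/7 * exp (288/49 * t\<^sup>2)"
    unfolding eq by simp
qed

definition sign :: "bool \<Rightarrow> real" where
  "sign b = (if b then 1 else - 1)"

lemma sign_sq [simp]: "sign b * sign b = 1" "(sign b * x)\<^sup>2 = x\<^sup>2"
  by (simp_all add: sign_def)

lemma cosh_le_exp_square: "(exp x + exp (- x)) / 2 \<le> exp (x\<^sup>2 / 2)" for x :: real
proof -
  have pos: "(exp x + exp (- x)) / 2 \<le> exp (x\<^sup>2 / 2)" if x: "0 \<le> x" for x :: real
  proof -
    let ?g = "\<lambda>x::real. exp x * (x - 1) + exp (- x) * (x + 1)"
    have g: "0 \<le> ?g x" if "0 \<le> x" for x :: real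
    proof -
      have "?g 0 \<le> ?g x"
      proof (rule DERIV_nonneg_imp_nondecreasing[OF that])
        fix z :: real assume "0 \<le> z"
        then have "0 \<le> z * (exp z - exp (- z))" by simp
        moreover have "(?g has_real_derivative z * (exp z - exp (- z))) (at z)"
          by (auto intro!: derivative_eq_intros simp: algebra_simps)
        ultimately show "\<exists>y. (?g has_real_derivative y) (at z) \<and> 0 \<le> y" by blast
      qed
      then show ?thesis by simp
    qed
    let ?f = "\<lambda>x::real. - ((exp x + exp (- x)) * exp (- (x\<^sup>2 / 2)))"
    have "?f 0 \<le> ?f x"
    proof (rule DERIV_nonneg_imp_nondecreasing[OF x])
      fix z :: real assume "0 \<le> z"
      have "(?f has_real_derivative ?g z * exp (- (z\<^sup>2 / 2))) (at z)"
        by (auto intro!: derivative_eq_intros simp: algebra_simps)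
      then show "\<exists>y. (?f has_real_derivative y) (at z) \<and> 0 \<le> y"
        using g[OF \<open>0 \<le> z\<close>] by (intro exI[of _ "?g z * exp (- (z\<^sup>2 / 2))"]) auto
    qed
    then have "(exp x + exp (- x)) * exp (- (x\<^sup>2 / 2)) \<le> 2" by simp
    then show ?thesis by (simp add: exp_minus field_simps)
  qed
  show ?thesis using pos[of x] pos[of "- x"] by (cases "0 \<le> x") auto
qed

abbreviation coins :: "nat \<Rightarrow> (nat \<Rightarrow> bool) pmf" where
  "coins n \<equiv> Pi_pmf {..<n} False (\<lambda>_. bernoulli_pmf (1/2))"

lemma finite_coins: "finite (set_pmf (coins n))"
  by (rule finite_set_Pi_pmf) auto

lemma coins_exp_linear: "E (coins n) (\<lambda>s. exp (\<Sum>i<n. a i * sign (s i))) \<le> exp ((\<Sum>i<n. (a i)\<^sup>2) / 2)"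
proof (induction n)
  case 0
  then show ?case by simp
next
  case (Suc n)
  have up: "(\<Sum>i<Suc n. a i * sign ((s(n := b)) i)) = a n * sign b + (\<Sum>i<n. a i * sign (s i))" for s b
  proof -
    have "(\<Sum>i<n. a i * sign ((s(n := b)) i)) = (\<Sum>i<n. a i * sign (s i))" by (intro sum.cong) auto
    then show ?thesis by simp
  qed
  let ?e = "E (coins n) (\<lambda>s. exp (\<Sum>i<n. a i * sign (s i)))"
  have e0: "0 \<le> ?e" by (intro Bochner_Integration.integral_nonneg) simp
  have "E (coins (Suc n)) (\<lambda>s. exp (\<Sum>i<Suc n. a i * sign (s i)))
      = E (bernoulli_pmf (1/2)) (\<lambda>b. E (coins n) (\<lambda>s. exp (a n * sign b) * exp (\<Sum>i<n. a i * sign (s i))))"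
    by (subst E_Pi_Suc) (simp_all only: up exp_add finite)
  also have "\<dots> = ((exp (a n) + exp (- a n)) / 2) * ?e"
    by (simp add: E_bernoulli sign_def field_simps)
  also have "\<dots> \<le> exp ((a n)\<^sup>2 / 2) * exp ((\<Sum>i<n. (a i)\<^sup>2) / 2)"
    using e0 by (intro mult_mono cosh_le_exp_square Suc) auto
  also have "\<dots> = exp ((\<Sum>i<Suc n. (a i)\<^sup>2) / 2)" by (simp add: add_divide_distrib flip: exp_add)
  finally show ?case .
qed

definition dot :: "nat \<Rightarrow> (nat \<Rightarrow> real) \<Rightarrow> (nat \<Rightarrow> real) \<Rightarrow> real" where
  "dot n x y = (\<Sum>i<n. x i * y i)"

definition orthonormal :: "nat \<Rightarrow> (nat \<Rightarrow> real) set \<Rightarrow> bool" where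
  "orthonormal n B \<longleftrightarrow> finite B \<and> (\<forall>b\<in>B. \<forall>b'\<in>B. dot n b b' = (if b = b' then 1 else 0))"

lemma dot_commute: "dot n x y = dot n y x"
  by (simp add: dot_def mult.commute)

lemma dot_add_left: "dot n (\<lambda>i. x i + t * y i) z = dot n x z + t * dot n y z"
  by (simp add: dot_def sum.distrib sum_distrib_left algebra_simps)

lemma dot_self_add: "dot n (\<lambda>i. x i + t * y i) (\<lambda>i. x i + t * y i) = dot n x x + 2 * t * dot n x y + t\<^sup>2 * dot n y y"
  by (simp add: dot_def sum.distrib sum_distrib_left algebra_simps power2_eq_square)

text \<open>
  Each square in the exponent is linearised by a Gaussian integral, which adds a multiple of an
  orthonormal vector to the linear form.
\<close>

lemma coins_exp_quadratic:
  assumes "orthonormal n B"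
  shows "E (coins n) (\<lambda>s. exp (dot n a (\<lambda>i. sign (s i)) + 288/625 * (\<Sum>b\<in>B. (dot n b (\<lambda>i. sign (s i)))\<^sup>2)))
    \<le> (25/7) ^ card B * exp (dot n a a / 2 + 288/49 * (\<Sum>b\<in>B. (dot n a b)\<^sup>2))"
proof -
  have "finite B" using assms by (simp add: orthonormal_def)
  then show ?thesis using assms
  proof (induction B arbitrary: a rule: finite_induct)
    case empty
    show ?case using coins_exp_linear[where a = a and n = n] by (simp add: dot_def power2_eq_square)
  next
    case (insert b B)
    have B: "orthonormal n B" and bb: "dot n b b = 1" and b0: "\<And>b'. b' \<in> B \<Longrightarrow> dot n b b' = 0"
      using insert.prems insert.hyps by (auto simp: orthonormal_def)
    let ?s = "\<lambda>s i. sign (s i)"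
    let ?S = "set_pmf (coins n)"
    let ?A = "\<lambda>z i. a i + (24/25 * z) * b i"
    let ?F = "\<lambda>s. exp (dot n a (?s s) + 288/625 * (\<Sum>b\<in>B. (dot n b (?s s))\<^sup>2))"
    let ?K = "(25/7) ^ card B * exp (dot n a a / 2 + 288/49 * (\<Sum>b\<in>B. (dot n a b)\<^sup>2))"
    have "E (coins n) (\<lambda>s. exp (dot n a (?s s) + 288/625 * (\<Sum>b\<in>insert b B. (dot n b (?s s))\<^sup>2)))
      = (\<Sum>s\<in>?S. pmf (coins n) s * (?F s * exp ((24/25 * dot n b (?s s))\<^sup>2 / 2)))"
      using insert.hyps finite_coins
      by (subst integral_measure_pmf[of ?S]) (auto simp: power2_eq_square algebra_simps exp_add[symmetric] intro!: sum.cong)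
    also have "\<dots> = (\<Sum>s\<in>?S. pmf (coins n) s * (?F s * (\<integral>z. std_normal_density z * exp ((24/25 * dot n b (?s s)) * z) \<partial>lborel)))"
      by (simp only: gaussian_exp_integral)
    also have "\<dots> = (\<integral>z. (\<Sum>s\<in>?S. pmf (coins n) s * (?F s * (std_normal_density z * exp ((24/25 * dot n b (?s s)) * z)))) \<partial>lborel)"
      by (subst Bochner_Integration.integral_sum)
         (intro integrable_mult_right gaussian_exp_integral, simp only: integral_mult_right_zero)
    also have "\<dots> \<le> (\<integral>z. ?K * (std_normal_density z * exp (288/625 * z\<^sup>2 + 24/25 * dot n a b * z)) \<partial>lborel)"
    proof (rule integral_mono)
      show "integrable lborel (\<lambda>z. \<Sum>s\<in>?S. pmf (coins n) s * (?F s * (std_normal_density z * exp ((24/25 * dot n b (?s s)) * z))))"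
        by (intro Bochner_Integration.integrable_sum integrable_mult_right gaussian_exp_integral)
      show "integrable lborel (\<lambda>z. ?K * (std_normal_density z * exp (288/625 * z\<^sup>2 + 24/25 * dot n a b * z)))"
        by (intro integrable_mult_right gaussian_square_integral)
      fix z
      have dA: "dot n (?A z) y = dot n a y + (24/25 * z) * dot n b y" for y by (rule dot_add_left)
      have "(\<Sum>s\<in>?S. pmf (coins n) s * (?F s * (std_normal_density z * exp ((24/25 * dot n b (?s s)) * z))))
        = std_normal_density z * (\<Sum>s\<in>?S. pmf (coins n) s * exp (dot n (?A z) (?s s) + 288/625 * (\<Sum>b\<in>B. (dot n b (?s s))\<^sup>2)))"
        unfolding sum_distrib_left dA exp_add
        by (intro sum.cong refl) (simp only: mult_ac)
      also have "\<dots> = std_normal_density z * E (coins n) (\<lambda>s. exp (dot n (?A z) (?s s) + 288/625 * (\<Sum>b\<in>B. (dot n b (?s s))\<^sup>2)))"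
        using finite_coins by (subst integral_measure_pmf[of ?S]) auto
      also have "\<dots> \<le> std_normal_density z * ((25/7) ^ card B * exp (dot n (?A z) (?A z) / 2 + 288/49 * (\<Sum>b\<in>B. (dot n (?A z) b)\<^sup>2)))"
        by (intro mult_left_mono insert.IH B) simp
      \<comment> \<open>The shift along the new vector is invisible to the remaining ones by
        orthogonality.\<close>
      also have "(\<Sum>b\<in>B. (dot n (?A z) b)\<^sup>2) = (\<Sum>b\<in>B. (dot n a b)\<^sup>2)"
        by (intro sum.cong refl) (simp only: dA b0 mult_zero_right add_0_right)
      also have "dot n (?A z) (?A z) / 2 = dot n a a / 2 + (288/625 * z\<^sup>2 + 24/25 * dot n a b * z)"
        unfolding dot_self_add bb by (simp add: power2_eq_square field_simps)
      also have "std_normal_density z * ((25/7) ^ card B * exp (dot n a a / 2 + (288/625 * z\<^sup>2 + 24/25 * dot n a b * z) + 288/49 * (\<Sum>b\<in>B. (dot n a b)\<^sup>2)))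
        = ?K * (std_normal_density z * exp (288/625 * z\<^sup>2 + 24/25 * dot n a b * z))"
        by (simp only: exp_add mult_ac)
      finally show "(\<Sum>s\<in>?S. pmf (coins n) s * (?F s * (std_normal_density z * exp ((24/25 * dot n b (?s s)) * z))))
        \<le> ?K * (std_normal_density z * exp (288/625 * z\<^sup>2 + 24/25 * dot n a b * z))" .
    qed
    also have "\<dots> = ?K * (25/7 * exp (288/49 * (dot n a b)\<^sup>2))"
      by (simp only: integral_mult_right_zero gaussian_square_integral)
    also have "\<dots> = (25/7) ^ card (insert b B) * exp (dot n a a / 2 + 288/49 * (\<Sum>b\<in>insert b B. (dot n a b)\<^sup>2))"
      using insert.hyps by (simp add: exp_add distrib_left)
    finally show ?case .
  qed
qed

text \<open>Gram-Schmidt, adding the normalised residual \<open>r\<close> of each vector; a zero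
  residual adds nothing, so \<open>B\<close> may be smaller than \<open>J\<close>.\<close>

lemma orthonormal_basis:
  assumes "finite J"
  shows "\<exists>B. orthonormal n B \<and> card B \<le> card J \<and> (\<forall>j\<in>J. \<exists>d. \<forall>i<n. w j i = (\<Sum>b\<in>B. d b * b i))"
  using assms
proof (induction J rule: finite_induct)
  case empty
  then show ?case by (intro exI[of _ "{}"]) (simp add: orthonormal_def)
next
  case (insert j J)
  then obtain B where B: "orthonormal n B" "card B \<le> card J" and
    span: "\<And>j. j \<in> J \<Longrightarrow> \<exists>d. \<forall>i<n. w j i = (\<Sum>b\<in>B. d b * b i)" by blast
  have fin: "finite B" using B by (simp add: orthonormal_def)
  define r where "r i = w j i - (\<Sum>b\<in>B. dot n (w j) b * b i)" for i
  have rb: "dot n r b = 0" if b: "b \<in> B" for b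
  proof -
    have "dot n r b = dot n (w j) b - (\<Sum>i<n. \<Sum>b'\<in>B. dot n (w j) b' * (b' i * b i))"
      by (simp add: dot_def r_def left_diff_distrib sum_subtractf sum_distrib_right mult.assoc)
    also have "(\<Sum>i<n. \<Sum>b'\<in>B. dot n (w j) b' * (b' i * b i)) = (\<Sum>b'\<in>B. dot n (w j) b' * dot n b' b)"
      by (subst sum.swap) (simp add: dot_def sum_distrib_left)
    also have "\<dots> = (\<Sum>b'\<in>B. if b' = b then dot n (w j) b else 0)"
      using B(1) b by (intro sum.cong refl) (auto simp: orthonormal_def)
    also have "\<dots> = dot n (w j) b" using fin b by (simp add: sum.delta)
    finally show ?thesis by simp
  qed
  show ?case
  proof (cases "dot n r r = 0")
    case True
    then have "r i = 0" if "i < n" for i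
      using that sum_nonneg_eq_0_iff[of "{..<n}" "\<lambda>i. r i * r i"] by (auto simp: dot_def)
    then have "\<forall>i<n. w j i = (\<Sum>b\<in>B. dot n (w j) b * b i)" by (simp add: r_def)
    then show ?thesis using B span insert.hyps by (intro exI[of _ B]) (auto intro!: exI[of _ "\<lambda>b. dot n (w j) b"])
  next
    case False
    have "0 \<le> dot n r r" by (auto simp: dot_def intro!: sum_nonneg)
    then have pos: "0 < dot n r r" using False by simp
    define c where "c = sqrt (dot n r r)"
    have c: "0 < c" "c * c = dot n r r" using pos by (auto simp: c_def)
    define e where "e i = r i / c" for i
    have ee: "dot n e e = 1"
    proof -
      have "dot n e e = dot n r r / (c * c)" by (simp add: dot_def e_def sum_divide_distrib)
      then show ?thesis using c pos by simp
    qed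
    have eb: "dot n e b = 0" if "b \<in> B" for b
    proof -
      have "dot n e b = dot n r b / c" by (simp add: dot_def e_def sum_divide_distrib)
      then show ?thesis using rb[OF that] by simp
    qed
    have "e \<notin> B" using ee eb by force
    have on: "orthonormal n (insert e B)"
    proof -
      have "dot n b e = 0" if "b \<in> B" for b using eb[OF that] dot_commute[of n b e] by simp
      then show ?thesis using B(1) ee eb \<open>e \<notin> B\<close> by (auto simp: orthonormal_def)
    qed
    have "\<exists>d. \<forall>i<n. w k i = (\<Sum>b\<in>insert e B. d b * b i)" if k: "k \<in> insert j J" for k
    proof (cases "k = j")
      case True
      have "w j i = (\<Sum>b\<in>insert e B. (if b = e then c else dot n (w j) b) * b i)" for i
      proof -
        have "(\<Sum>b\<in>B. (if b = e then c else dot n (w j) b) * b i) = (\<Sum>b\<in>B. dot n (w j) b * b i)"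
          using \<open>e \<notin> B\<close> by (intro sum.cong) auto
        then show ?thesis using fin \<open>e \<notin> B\<close> c by (simp add: e_def r_def)
      qed
      then show ?thesis using True by (intro exI[of _ "\<lambda>b. if b = e then c else dot n (w j) b"]) simp
    next
      case False
      then obtain d where d: "\<forall>i<n. w k i = (\<Sum>b\<in>B. d b * b i)" using span k by blast
      have "(\<Sum>b\<in>B. (d(e := 0)) b * b i) = (\<Sum>b\<in>B. d b * b i)" for i
        using \<open>e \<notin> B\<close> by (intro sum.cong) auto
      then have "\<forall>i<n. w k i = (\<Sum>b\<in>insert e B. (d(e := 0)) b * b i)"
        using fin \<open>e \<notin> B\<close> d by simp
      then show ?thesis by blast
    qed
    then show ?thesis using on B fin \<open>e \<notin> B\<close> insert.hyps by (intro exI[of _ "insert e B"]) auto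
  qed
qed

text \<open>Signs disappear from the squares, so in orthonormal coordinates the exponent separates
  into \<open>q * d * t - d^2/2 \<le> q^2/2 * t^2\<close>. This leaves exactly the quadratic form of
  \<open>coins_exp_quadratic\<close>.\<close>

lemma coins_supexp:
  assumes J: "finite J"
  shows "E (coins n) (\<lambda>s. supexp (\<lambda>c. \<Sum>i<n. 24/25 * (sign (s i) * (\<Sum>j\<in>J. c j * w j i)) - (sign (s i) * (\<Sum>j\<in>J. c j * w j i))\<^sup>2 / 2))
    \<le> (25/7) ^ card J"
proof -
  obtain B where B: "orthonormal n B" "card B \<le> card J" and
    span: "\<And>j. j \<in> J \<Longrightarrow> \<exists>d. \<forall>i<n. w j i = (\<Sum>b\<in>B. d b * b i)" using orthonormal_basis[OF J, of n w] by blast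
  obtain D where D: "\<And>j i. j \<in> J \<Longrightarrow> i < n \<Longrightarrow> w j i = (\<Sum>b\<in>B. D j b * b i)" using span by metis
  have fin: "finite B" using B by (simp add: orthonormal_def)
  have sup: "supexp (\<lambda>c. \<Sum>i<n. 24/25 * (sign (s i) * (\<Sum>j\<in>J. c j * w j i)) - (sign (s i) * (\<Sum>j\<in>J. c j * w j i))\<^sup>2 / 2)
    \<le> exp (dot n (\<lambda>_. 0) (\<lambda>i. sign (s i)) + 288/625 * (\<Sum>b\<in>B. (dot n b (\<lambda>i. sign (s i)))\<^sup>2))" for s
  proof (rule supexp_le)
    fix c
    define d where "d b = (\<Sum>j\<in>J. c j * D j b)" for b
    define x where "x i = (\<Sum>b\<in>B. d b * b i)" for i
    have cw: "(\<Sum>j\<in>J. c j * w j i) = x i" if "i < n" for i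
    proof -
      have "(\<Sum>j\<in>J. c j * w j i) = (\<Sum>j\<in>J. \<Sum>b\<in>B. c j * D j b * b i)"
        using that by (intro sum.cong refl) (simp add: D sum_distrib_left mult.assoc)
      also have "\<dots> = x i" by (subst sum.swap) (simp add: x_def d_def sum_distrib_right)
      finally show ?thesis .
    qed
    have 1: "(\<Sum>i<n. sign (s i) * x i) = (\<Sum>b\<in>B. d b * dot n b (\<lambda>i. sign (s i)))"
      unfolding x_def dot_def sum_distrib_left by (subst sum.swap) (simp add: mult_ac)
    have "(\<Sum>i<n. (x i)\<^sup>2) = (\<Sum>i<n. \<Sum>b\<in>B. d b * (b i * x i))"
      by (intro sum.cong refl) (simp add: power2_eq_square x_def sum_distrib_right mult.assoc)
    also have "\<dots> = (\<Sum>b\<in>B. d b * dot n b x)" by (subst sum.swap) (simp add: dot_def sum_distrib_left)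
    also have "\<dots> = (\<Sum>b\<in>B. (d b)\<^sup>2)"
    proof (intro sum.cong refl)
      fix b assume b: "b \<in> B"
      have "dot n b x = (\<Sum>b'\<in>B. d b' * dot n b b')"
        unfolding dot_def x_def sum_distrib_left by (subst sum.swap) (simp add: mult_ac)
      also have "\<dots> = (\<Sum>b'\<in>B. if b' = b then d b else 0)"
        using B(1) b by (intro sum.cong refl) (auto simp: orthonormal_def)
      also have "\<dots> = d b" using fin b by (simp add: sum.delta)
      finally show "d b * dot n b x = (d b)\<^sup>2" by (simp add: power2_eq_square)
    qed
    finally have 2: "(\<Sum>i<n. (x i)\<^sup>2) = (\<Sum>b\<in>B. (d b)\<^sup>2)" .
    have "(\<Sum>i<n. 24/25 * (sign (s i) * (\<Sum>j\<in>J. c j * w j i)) - (sign (s i) * (\<Sum>j\<in>J. c j * w j i))\<^sup>2 / 2)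
        = 24/25 * (\<Sum>i<n. sign (s i) * x i) - (\<Sum>i<n. (x i)\<^sup>2) / 2"
    proof -
      have "(\<Sum>i<n. 24/25 * (sign (s i) * (\<Sum>j\<in>J. c j * w j i)) - (sign (s i) * (\<Sum>j\<in>J. c j * w j i))\<^sup>2 / 2)
          = (\<Sum>i<n. 24/25 * (sign (s i) * x i) - (x i)\<^sup>2 / 2)"
        by (intro sum.cong refl) (simp add: cw)
      then show ?thesis by (simp add: sum_subtractf sum_distrib_left sum_divide_distrib)
    qed
    also have "\<dots> = (\<Sum>b\<in>B. 24/25 * (d b * dot n b (\<lambda>i. sign (s i))) - (d b)\<^sup>2 / 2)"
      unfolding 1 2 by (simp add: sum_subtractf sum_distrib_left sum_divide_distrib)
    also have "\<dots> \<le> (\<Sum>b\<in>B. 288/625 * (dot n b (\<lambda>i. sign (s i)))\<^sup>2)"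
    proof (rule sum_mono)
      fix b
      have "0 \<le> (d b - 24/25 * dot n b (\<lambda>i. sign (s i)))\<^sup>2" by simp
      then show "24/25 * (d b * dot n b (\<lambda>i. sign (s i))) - (d b)\<^sup>2 / 2 \<le> 288/625 * (dot n b (\<lambda>i. sign (s i)))\<^sup>2"
        by (simp add: power2_eq_square field_simps)
    qed
    finally show "exp (\<Sum>i<n. 24/25 * (sign (s i) * (\<Sum>j\<in>J. c j * w j i)) - (sign (s i) * (\<Sum>j\<in>J. c j * w j i))\<^sup>2 / 2)
      \<le> exp (dot n (\<lambda>_. 0) (\<lambda>i. sign (s i)) + 288/625 * (\<Sum>b\<in>B. (dot n b (\<lambda>i. sign (s i)))\<^sup>2))"
      by (simp add: dot_def sum_distrib_left)
  qed
  have "E (coins n) (\<lambda>s. supexp (\<lambda>c. \<Sum>i<n. 24/25 * (sign (s i) * (\<Sum>j\<in>J. c j * w j i)) - (sign (s i) * (\<Sum>j\<in>J. c j * w j i))\<^sup>2 / 2))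
    \<le> E (coins n) (\<lambda>s. exp (dot n (\<lambda>_. 0) (\<lambda>i. sign (s i)) + 288/625 * (\<Sum>b\<in>B. (dot n b (\<lambda>i. sign (s i)))\<^sup>2)))"
    by (intro E_mono finite_coins sup)
  also have "\<dots> \<le> (25/7) ^ card B * exp (dot n (\<lambda>_. 0) (\<lambda>_. 0) / 2 + 288/49 * (\<Sum>b\<in>B. (dot n (\<lambda>_. 0) b)\<^sup>2))"
    by (rule coins_exp_quadratic[OF B(1)])
  also have "\<dots> = (25/7) ^ card B" by (simp add: dot_def)
  also have "\<dots> \<le> (25/7) ^ card J" using B(2) by (intro power_increasing) auto
  finally show ?thesis .
qed

section \<open>The moment bound for the log-likelihood ratio\<close>

definition affine_form :: "((nat \<Rightarrow> real) \<Rightarrow> real) \<Rightarrow> bool" where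
  "affine_form u \<longleftrightarrow> (\<forall>t x y. u (blend t x y) = (1 - t) * u x + t * u y)"

lemma affine_form_sum: "affine_form (\<lambda>c. \<Sum>j\<in>J. c j * g j)"
  by (simp add: affine_form_def blend_def sum_distrib_left algebra_simps flip: sum.distrib)

lemma affine_form_uminus: "affine_form u \<Longrightarrow> affine_form (\<lambda>c. - u c)"
  by (simp add: affine_form_def)

lemma affine_form_mult: "affine_form u \<Longrightarrow> affine_form (\<lambda>c. k * u c)"
  by (auto simp only: affine_form_def distrib_left mult.left_commute)

lemma concave_bdd_compose:
  assumes "affine_form u" "\<And>x y t. 0 \<le> t \<Longrightarrow> t \<le> 1 \<Longrightarrow> (1 - t) * \<phi> x + t * \<phi> y \<le> \<phi> ((1 - t) * x + t * y)"
    "\<And>x. \<phi> x \<le> b"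
  shows "concave_bdd (\<lambda>c. \<phi> (u c))"
  using assms unfolding concave_bdd_def affine_form_def by metis

lemma ln_tilt: "0 < a \<Longrightarrow> a < 1 \<Longrightarrow> ln (tilt l a u) = - l * ln (a + (1 - a) * exp u)"
  using tilt_base_pos[of a u] by (simp add: tilt_def)

text \<open>Hoelder's inequality for two terms, obtained from Young's inequality for the terms
  normalised by \<open>A\<close> and \<open>B\<close>.\<close>

lemma ln_weighted_exp_convex:
  fixes a x y t :: real
  assumes a: "0 < a" "a < 1" and t: "0 \<le> t" "t \<le> 1"
  shows "ln (a + (1 - a) * exp ((1 - t) * x + t * y)) \<le> (1 - t) * ln (a + (1 - a) * exp x) + t * ln (a + (1 - a) * exp y)"
proof -
  define A B where "A = a + (1 - a) * exp x" and "B = a + (1 - a) * exp y"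
  have AB: "0 < A" "0 < B" using a by (simp_all add: A_def B_def add_pos_pos)
  define D where "D = A powr (1 - t) * B powr t"
  have D: "0 < D" using AB by (simp add: D_def)
  have "(a / A) powr (1 - t) * (a / B) powr t \<le> (1 - t) * (a / A) + t * (a / B)"
    using a t AB by (intro Youngs_inequality_0) auto
  moreover have "(a / A) powr (1 - t) * (a / B) powr t = a / D"
    using a AB by (simp add: D_def powr_divide) (simp add: powr_diff)
  moreover have "((1 - a) * exp x / A) powr (1 - t) * ((1 - a) * exp y / B) powr t \<le> (1 - t) * ((1 - a) * exp x / A) + t * ((1 - a) * exp y / B)"
    using a t AB by (intro Youngs_inequality_0) auto
  moreover have "((1 - a) * exp x / A) powr (1 - t) * ((1 - a) * exp y / B) powr t = (1 - a) * exp ((1 - t) * x + t * y) / D"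
  proof -
    have "((1 - a) * exp x) powr (1 - t) * ((1 - a) * exp y) powr t
        = ((1 - a) powr (1 - t) * (1 - a) powr t) * (exp x powr (1 - t) * exp y powr t)"
      using a by (simp add: powr_mult)
    also have "(1 - a) powr (1 - t) * (1 - a) powr t = 1 - a" using a by (simp flip: powr_add)
    also have "exp x powr (1 - t) * exp y powr t = exp ((1 - t) * x + t * y)"
      by (simp add: powr_def flip: exp_add)
    finally show ?thesis using a AB by (simp add: D_def powr_divide)
  qed
  moreover have "(1 - t) * (a / A) + (1 - t) * ((1 - a) * exp x / A) = 1 - t"
  proof -
    have "a / A + (1 - a) * exp x / A = 1" using AB by (simp add: A_def flip: add_divide_distrib)
    from arg_cong[OF this, of "(*) (1 - t)"] show ?thesis by (simp only: distrib_left mult_1_right)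
  qed
  moreover have "t * (a / B) + t * ((1 - a) * exp y / B) = t"
  proof -
    have "a / B + (1 - a) * exp y / B = 1" using AB by (simp add: B_def flip: add_divide_distrib)
    from arg_cong[OF this, of "(*) t"] show ?thesis by (simp only: distrib_left mult_1_right)
  qed
  ultimately have "a / D + (1 - a) * exp ((1 - t) * x + t * y) / D \<le> 1" by linarith
  then have "a + (1 - a) * exp ((1 - t) * x + t * y) \<le> D"
    using D by (simp add: field_simps)
  then have "ln (a + (1 - a) * exp ((1 - t) * x + t * y)) \<le> ln D"
    using a D by (subst ln_le_cancel_iff) (auto simp: add_pos_pos)
  also have "ln D = (1 - t) * ln A + t * ln B" using AB by (simp add: D_def ln_mult)
  finally show ?thesis by (simp add: A_def B_def)
qed

lemma concave_bdd_ln_tilt: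
  assumes a: "0 < a" "a < 1" and l: "0 \<le> l" and u: "affine_form u"
  shows "concave_bdd (\<lambda>c. ln (tilt l a (u c)))"
proof (rule concave_bdd_compose[OF u])
  fix x y t :: real assume t: "0 \<le> t" "t \<le> 1"
  from mult_left_mono[OF ln_weighted_exp_convex[OF a t, of x y] l]
  show "(1 - t) * ln (tilt l a x) + t * ln (tilt l a y) \<le> ln (tilt l a ((1 - t) * x + t * y))"
    using a by (simp add: ln_tilt algebra_simps)
next
  fix x
  show "ln (tilt l a x) \<le> ln (a powr - l)"
    using tilt_le_limit[OF a l, of x] tilt_pos[OF a, of l x] by (subst ln_le_cancel_iff) (use a in auto)
qed

definition quad :: "real \<Rightarrow> real" where
  "quad v = 24/25 * v - v\<^sup>2 / 2"

lemma concave_bdd_quad: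
  assumes u: "affine_form u" shows "concave_bdd (\<lambda>c. quad (u c))"
proof (rule concave_bdd_compose[OF u])
  fix x y t :: real assume t: "0 \<le> t" "t \<le> 1"
  have "quad ((1 - t) * x + t * y) - ((1 - t) * quad x + t * quad y) = t * (1 - t) * (x - y)\<^sup>2 / 2"
    by (simp add: quad_def power2_eq_square field_simps)
  also have "\<dots> \<ge> 0" using t by simp
  finally show "(1 - t) * quad x + t * quad y \<le> quad ((1 - t) * x + t * y)" by simp
next
  fix x :: real
  have "0 \<le> (x - 24/25)\<^sup>2" by simp
  then show "quad x \<le> 1" by (simp add: quad_def power2_eq_square algebra_simps)
qed

text \<open>The inequality is proved for fixed parameters \<open>c0\<close> and \<open>c1\<close>,
  and the suprema are taken afterwards. Any \<open>v\<close> between the two predictors is the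
  predictor of a point on their segment, where concavity gives \<open>G\<close> at least the smaller
  end value.\<close>

lemma row_operator:
  assumes p: "0 < p" "p < 1" and l: "0 < l" "l \<le> 9/20 * p * (1 - p)"
  shows "\<exists>m a. 0 \<le> a \<and> a \<le> 1 \<and> (\<forall>G u. concave_bdd G \<longrightarrow> affine_form u \<longrightarrow>
    p * supexp (\<lambda>c. G c + ln (tilt l p (- u c))) + (1 - p) * supexp (\<lambda>c. G c + ln (tilt l (1 - p) (u c)))
    \<le> (1 - a) * supexp G + a / 2 * (supexp (\<lambda>c. G c + quad (m * u c)) + supexp (\<lambda>c. G c + quad (- (m * u c)))))"
proof -
  obtain m a where a: "0 \<le> a" "a \<le> 1" and
    row: "\<And>u0 u1 A0 A1 S T U. 0 \<le> A0 \<Longrightarrow> 0 \<le> A1 \<Longrightarrow> A0 \<le> S \<Longrightarrow> A1 \<le> S \<Longrightarrow>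
    (\<forall>v. min u0 u1 \<le> v \<longrightarrow> v \<le> max u0 u1 \<longrightarrow> min A0 A1 * gauss (m * v) \<le> T \<and> min A0 A1 * gauss (- (m * v)) \<le> U) \<Longrightarrow>
    p * (A1 * tilt l p (- u1)) + (1 - p) * (A0 * tilt l (1 - p) u0) \<le> (1 - a) * S + a / 2 * (T + U)"
    using row_weighted[OF p l] by metis
  have "p * supexp (\<lambda>c. G c + ln (tilt l p (- u c))) + (1 - p) * supexp (\<lambda>c. G c + ln (tilt l (1 - p) (u c)))
    \<le> (1 - a) * supexp G + a / 2 * (supexp (\<lambda>c. G c + quad (m * u c)) + supexp (\<lambda>c. G c + quad (- (m * u c))))"
    (is "_ \<le> ?R") if G: "concave_bdd G" and u: "affine_form u" for G u
  proof -
    have Q: "concave_bdd (\<lambda>c. G c + quad (m * u c))" "concave_bdd (\<lambda>c. G c + quad (- (m * u c)))"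
      by (intro concave_bdd_add G concave_bdd_quad affine_form_uminus affine_form_mult u)+
    have pt: "p * exp (G c1 + ln (tilt l p (- u c1))) + (1 - p) * exp (G c0 + ln (tilt l (1 - p) (u c0))) \<le> ?R" for c0 c1
    proof -
      have "p * (exp (G c1) * tilt l p (- u c1)) + (1 - p) * (exp (G c0) * tilt l (1 - p) (u c0)) \<le> ?R"
      proof (rule row)
        show "\<forall>v. min (u c0) (u c1) \<le> v \<longrightarrow> v \<le> max (u c0) (u c1) \<longrightarrow>
          min (exp (G c0)) (exp (G c1)) * gauss (m * v) \<le> supexp (\<lambda>c. G c + quad (m * u c)) \<and>
          min (exp (G c0)) (exp (G c1)) * gauss (- (m * v)) \<le> supexp (\<lambda>c. G c + quad (- (m * u c)))"
        proof (intro allI impI)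
          fix v assume v: "min (u c0) (u c1) \<le> v" "v \<le> max (u c0) (u c1)"
          obtain t where t: "0 \<le> t" "t \<le> 1" "v = (1 - t) * u c0 + t * u c1"
          proof (cases "u c0 = u c1")
            case True
            then show ?thesis using v by (intro that[of 0]) auto
          next
            case False
            define t where "t = (v - u c0) / (u c1 - u c0)"
            have "t * (u c1 - u c0) = v - u c0" using False by (simp add: t_def)
            then have "v = (1 - t) * u c0 + t * u c1" by (simp add: algebra_simps)
            moreover have "0 \<le> t" "t \<le> 1"
              using v False by (auto simp: t_def min_def max_def divide_simps split: if_splits)
            ultimately show ?thesis by (intro that)
          qed
          define c where "c = blend t c0 c1"
          have uc: "u c = v" using u t by (simp add: c_def affine_form_def)
          have "min (G c0) (G c1) \<le> (1 - t) * G c0 + t * G c1"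
          proof -
            have "(1 - t) * min (G c0) (G c1) + t * min (G c0) (G c1) \<le> (1 - t) * G c0 + t * G c1"
              using t by (intro add_mono mult_left_mono) auto
            then show ?thesis by (simp add: algebra_simps)
          qed
          also have "\<dots> \<le> G c" using G t unfolding concave_bdd_def c_def by blast
          finally have "min (exp (G c0)) (exp (G c1)) \<le> exp (G c)" by (simp add: min_def split: if_splits)
          then have "min (exp (G c0)) (exp (G c1)) * gauss w \<le> exp (G c + quad w)" for w
            by (simp add: exp_add quad_def gauss_def)
          from this[of "m * v"] this[of "- (m * v)"]
            supexp_upper[OF Q(1), of c] supexp_upper[OF Q(2), of c]
          show "min (exp (G c0)) (exp (G c1)) * gauss (m * v) \<le> supexp (\<lambda>c. G c + quad (m * u c)) \<and>
            min (exp (G c0)) (exp (G c1)) * gauss (- (m * v)) \<le> supexp (\<lambda>c. G c + quad (- (m * u c)))"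
            unfolding uc by linarith
        qed
      qed (auto intro: supexp_upper[OF G])
      moreover have "0 < tilt l p (- u c1)" "0 < tilt l (1 - p) (u c0)" using p by (auto intro: tilt_pos)
      ultimately show ?thesis by (simp add: exp_add)
    qed
    \<comment> \<open>First the supremum over \<open>c0\<close> with \<open>c1\<close> fixed, then
      the one over \<open>c1\<close>.\<close>
    have 1: "p * exp (G c1 + ln (tilt l p (- u c1))) + (1 - p) * supexp (\<lambda>c. G c + ln (tilt l (1 - p) (u c))) \<le> ?R" for c1
    proof -
      have "supexp (\<lambda>c. G c + ln (tilt l (1 - p) (u c))) \<le> (?R - p * exp (G c1 + ln (tilt l p (- u c1)))) / (1 - p)"
        using pt[of c1] p by (intro supexp_le) (simp add: field_simps)
      then show ?thesis using p by (simp add: field_simps)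
    qed
    have "supexp (\<lambda>c. G c + ln (tilt l p (- u c))) \<le> (?R - (1 - p) * supexp (\<lambda>c. G c + ln (tilt l (1 - p) (u c)))) / p"
      using 1 p by (intro supexp_le) (simp add: field_simps)
    then show ?thesis using p by (simp add: field_simps)
  qed
  with a show ?thesis by blast
qed

theorem log_likelihood_moment:
  fixes p :: "nat \<Rightarrow> real" and g :: "nat \<Rightarrow> nat \<Rightarrow> real"
  assumes p: "\<And>i. i < n \<Longrightarrow> 0 < p i \<and> p i < 1 \<and> l \<le> 9/20 * p i * (1 - p i)" and l: "0 < l"
    and J: "finite J"
  shows "E (responses n p) (\<lambda>y. supexp (\<lambda>c. \<Sum>i<n. if y i then ln (tilt l (p i) (- (\<Sum>j\<in>J. c j * g j i)))
      else ln (tilt l (1 - p i) (\<Sum>j\<in>J. c j * g j i)))) \<le> (25/7) ^ card J"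
proof -
  define u where "u i c = (\<Sum>j\<in>J. c j * g j i)" for i and c :: "nat \<Rightarrow> real"
  have u: "affine_form (u i)" for i unfolding u_def [abs_def] by (rule affine_form_sum)
  define R where "R i m a \<longleftrightarrow> 0 \<le> a \<and> a \<le> 1 \<and> (\<forall>G u. concave_bdd G \<longrightarrow> affine_form u \<longrightarrow>
    p i * supexp (\<lambda>c. G c + ln (tilt l (p i) (- u c))) + (1 - p i) * supexp (\<lambda>c. G c + ln (tilt l (1 - p i) (u c)))
    \<le> (1 - a) * supexp G + a / 2 * (supexp (\<lambda>c. G c + quad (m * u c)) + supexp (\<lambda>c. G c + quad (- (m * u c)))))"
    for i m a
  have "\<exists>x. i < n \<longrightarrow> R i (fst x) (snd x)" for i
    using row_operator[of "p i" l] p[of i] l unfolding R_def by (cases "i < n") auto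
  then obtain x where x: "\<And>i. i < n \<Longrightarrow> R i (fst (x i)) (snd (x i))" by metis
  define m where "m i = fst (x i)" for i
  define a where "a i = snd (x i)" for i
  have a: "0 \<le> a i \<and> a i \<le> 1" if "i < n" for i using x[OF that] by (simp add: R_def a_def)
  have row: "p i * supexp (\<lambda>c. G c + ln (tilt l (p i) (- u c))) + (1 - p i) * supexp (\<lambda>c. G c + ln (tilt l (1 - p i) (u c)))
    \<le> (1 - a i) * supexp G + a i / 2 * (supexp (\<lambda>c. G c + quad (m i * u c)) + supexp (\<lambda>c. G c + quad (- (m i * u c))))"
    if "i < n" "concave_bdd G" "affine_form u" for i G u
    using x[OF that(1)] that(2,3) unfolding R_def a_def m_def by blast
  define h where "h i b s = (if b then sign s * m i else 0)" for i b s
  \<comment> \<open>The three-point law on 0 and \<open>\<plusminus>m i\<close>, drawn in two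
    stages: whether the row is active, then a fair sign. Given the active rows, only fair signs
    remain.\<close>
  define Q where "Q i = bernoulli_pmf (a i) \<bind> (\<lambda>b. bernoulli_pmf (1/2) \<bind> (\<lambda>s. return_pmf (h i b s)))" for i
  let ?f = "\<lambda>i y c. if y then ln (tilt l (p i) (- u i c)) else ln (tilt l (1 - p i) (u i c))"
  let ?F = "\<lambda>z. supexp (\<lambda>c. 0 + (\<Sum>i<n. quad (z i * u i c)))"
  have "E (responses n p) (\<lambda>y. supexp (\<lambda>c. 0 + (\<Sum>i<n. ?f i (y i) c))) \<le> E (Pi_pmf {..<n} 0 Q) ?F"
    unfolding responses_def
  proof (rule replace_rows)
    fix i G assume i: "i < n" and G: "concave_bdd G"
    have EQ: "E (Q i) H = (1 - a i) * H 0 + a i / 2 * (H (m i) + H (- m i))" for H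
      using a[OF i] by (simp add: Q_def E_bind E_bernoulli h_def sign_def field_simps)
    have "E (bernoulli_pmf (p i)) (\<lambda>y. supexp (\<lambda>c. G c + ?f i y c))
      = p i * supexp (\<lambda>c. G c + ln (tilt l (p i) (- u i c))) + (1 - p i) * supexp (\<lambda>c. G c + ln (tilt l (1 - p i) (u i c)))"
      using p[OF i] by (simp add: E_bernoulli)
    also have "\<dots> \<le> E (Q i) (\<lambda>z. supexp (\<lambda>c. G c + quad (z * u i c)))"
      unfolding EQ using row[OF i G u] by (simp add: quad_def)
    finally show "E (bernoulli_pmf (p i)) (\<lambda>y. supexp (\<lambda>c. G c + ?f i y c)) \<le> E (Q i) (\<lambda>z. supexp (\<lambda>c. G c + quad (z * u i c)))" .
  next
    show "concave_bdd (?f i y)" if "i < n" for i y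
      using p[OF that] l u[of i] by (cases y) (auto intro!: concave_bdd_ln_tilt affine_form_uminus)
    show "concave_bdd (\<lambda>c. quad (z * u i c))" for i z
      by (intro concave_bdd_quad affine_form_mult u)
  qed (auto simp: Q_def concave_bdd_0)
  also have "Pi_pmf {..<n} 0 Q = Pi_pmf {..<n} False (\<lambda>i. bernoulli_pmf (a i)) \<bind> (\<lambda>b. coins n \<bind>
      (\<lambda>s. return_pmf (\<lambda>i. if i \<in> {..<n} then h i (b i) (s i) else 0)))"
    unfolding Q_def [abs_def]
    by (subst Pi_pmf_bind[where d' = False], simp, subst Pi_pmf_bind[where d' = False], simp, subst Pi_pmf_return_pmf, simp, rule refl)
  also have "E \<dots> ?F = E (Pi_pmf {..<n} False (\<lambda>i. bernoulli_pmf (a i))) (\<lambda>b. E (coins n) (\<lambda>s. ?F (\<lambda>i. if i \<in> {..<n} then h i (b i) (s i) else 0)))"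
    by (simp add: E_bind finite_coins finite_set_Pi_pmf)
  also have "\<dots> \<le> E (Pi_pmf {..<n} False (\<lambda>i. bernoulli_pmf (a i))) (\<lambda>b. (25/7) ^ card J)"
  proof (rule E_mono)
    fix b
    \<comment> \<open>Inactive rows get a zero design row, so the number of directions stays at most
      \<open>card J\<close> for every \<open>b\<close>.\<close>
    define w where "w j i = (if b i then m i else 0) * g j i" for j i
    have w: "(\<Sum>j\<in>J. c j * w j i) = (if b i then m i else 0) * u i c" for i c
      by (simp add: w_def u_def sum_distrib_left mult.left_commute)
    have t: "quad ((if i \<in> {..<n} then h i (b i) (s i) else 0) * u i c)
      = 24/25 * (sign (s i) * (\<Sum>j\<in>J. c j * w j i)) - (sign (s i) * (\<Sum>j\<in>J. c j * w j i))\<^sup>2 / 2"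
      if "i \<in> {..<n}" for i c s
      using that unfolding w by (cases "b i") (simp_all add: h_def quad_def mult.assoc)
    have "?F (\<lambda>i. if i \<in> {..<n} then h i (b i) (s i) else 0)
      = supexp (\<lambda>c. \<Sum>i<n. 24/25 * (sign (s i) * (\<Sum>j\<in>J. c j * w j i)) - (sign (s i) * (\<Sum>j\<in>J. c j * w j i))\<^sup>2 / 2)" for s
      unfolding add_0 by (intro arg_cong[where f = supexp] ext sum.cong refl t)
    then show "E (coins n) (\<lambda>s. ?F (\<lambda>i. if i \<in> {..<n} then h i (b i) (s i) else 0)) \<le> (25/7) ^ card J"
      using coins_supexp[OF J, of n w] by simp
  qed (auto intro: finite_set_Pi_pmf)
  also have "\<dots> = (25/7) ^ card J" by simp
  finally have "E (responses n p) (\<lambda>y. supexp (\<lambda>c. \<Sum>i<n. ?f i (y i) c)) \<le> (25/7) ^ card J" by simp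
  then show ?thesis unfolding u_def .
qed

section \<open>Models and penalties\<close>

text \<open>A column outside the span of \<open>J\<close> would give \<open>r + 1\<close>
  independent columns, against the rank.\<close>

lemma columns_span:
  assumes X: "X \<in> carrier_mat n d" and rank: "vec_space.rank n X = r"
    and J: "J \<subseteq> {..<d}" "card J = r" "cols_lin_indpt X J" and k: "k < d"
  shows "\<exists>c. \<forall>i<n. X $$ (i, k) = (\<Sum>j\<in>J. c j * X $$ (i, j))"
proof -
  interpret vec_space "TYPE(real)" n .
  let ?S = "col X ` J"
  have inj: "inj_on (col X) J" and ind: "lin_indpt ?S" using J(3) X by (auto simp: cols_lin_indpt_def)
  have finJ: "finite J" using J(1) finite_subset by blast
  have cols: "set (cols X) = col X ` {..<d}" using X by (auto simp: cols_def)
  have S: "?S \<subseteq> carrier_vec n" "?S \<subseteq> set (cols X)" using J(1) X by (auto simp: cols)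
  have kc: "col X k \<in> carrier_vec n" "col X k \<in> set (cols X)" using k X by (auto simp: cols)
  have "col X k \<in> span ?S"
  proof (cases "col X k \<in> ?S")
    case True
    then show ?thesis using in_own_span[OF S(1)] by blast
  next
    case False
    show ?thesis
    proof (rule ccontr)
      assume "col X k \<notin> span ?S"
      then have "lin_indpt (?S \<union> {col X k})"
        using lin_dep_iff_in_span[OF _ ind _ False] S kc by simp
      then have "card (?S \<union> {col X k}) \<le> rank X"
        using S kc X by (intro rank_ge_card_indpt) auto
      moreover have "card (?S \<union> {col X k}) = Suc r" using False finJ inj J(2) by (simp add: card_image)
      ultimately show False using rank by simp
    qed
  qed
  then obtain a where a: "lincomb a ?S = col X k"
    using finite_in_span[of ?S "col X k"] finJ S(1) by auto
  have "X $$ (i, k) = (\<Sum>j\<in>J. a (col X j) * X $$ (i, j))" if i: "i < n" for i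
  proof -
    have "X $$ (i, k) = lincomb a ?S $ i" using a i k X by simp
    also have "\<dots> = (\<Sum>v\<in>?S. a v * v $ i)" by (rule lincomb_index[OF i S(1)])
    also have "\<dots> = (\<Sum>j\<in>J. a (col X j) * col X j $ i)" by (simp add: sum.reindex[OF inj])
    also have "\<dots> = (\<Sum>j\<in>J. a (col X j) * X $$ (i, j))"
      using J(1) i X by (intro sum.cong) auto
    finally show ?thesis .
  qed
  then show ?thesis by (intro exI[of _ "\<lambda>j. a (col X j)"]) auto
qed

lemma rank_le_dim_col:
  assumes "X \<in> carrier_mat n d" shows "vec_space.rank n (X :: real mat) \<le> d"
  by (rule vec_space.rank_le_nc[OF assms])

lemma scalar_prod_row:
  assumes "X \<in> carrier_mat n d" "b \<in> carrier_vec d" "i < n"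
  shows "b \<bullet> row X i = (\<Sum>k<d. b $ k * X $$ (i, k))"
  using assms by (simp add: scalar_prod_def lessThan_atLeast0)

lemma predictors_span:
  assumes X: "X \<in> carrier_mat n d" and rank: "vec_space.rank n X = r"
    and J: "J \<subseteq> {..<d}" "card J = r" "cols_lin_indpt X J" and b: "b \<in> carrier_vec d"
  shows "\<exists>c. \<forall>i<n. b \<bullet> row X i = (\<Sum>j\<in>J. c j * X $$ (i, j))"
proof -
  have "\<forall>k. \<exists>c. k < d \<longrightarrow> (\<forall>i<n. X $$ (i, k) = (\<Sum>j\<in>J. c j * X $$ (i, j)))"
    using columns_span[OF X rank J] by blast
  then obtain C where C: "\<And>k i. k < d \<Longrightarrow> i < n \<Longrightarrow> X $$ (i, k) = (\<Sum>j\<in>J. C k j * X $$ (i, j))" by metis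
  have "b \<bullet> row X i = (\<Sum>j\<in>J. (\<Sum>k<d. b $ k * C k j) * X $$ (i, j))" if i: "i < n" for i
  proof -
    have "b \<bullet> row X i = (\<Sum>k<d. \<Sum>j\<in>J. b $ k * C k j * X $$ (i, j))"
      unfolding scalar_prod_row[OF X b i]
      by (intro sum.cong refl) (simp add: C[OF _ i] sum_distrib_left mult.assoc)
    also have "\<dots> = (\<Sum>j\<in>J. (\<Sum>k<d. b $ k * C k j) * X $$ (i, j))"
      by (subst sum.swap) (simp add: sum_distrib_right)
    finally show ?thesis .
  qed
  then show ?thesis by (intro exI[of _ "\<lambda>j. \<Sum>k<d. b $ k * C k j"]) auto
qed

lemma model_space_scalar_prod:
  assumes X: "X \<in> carrier_mat n d" and b: "b \<in> model_space d M" and M: "M \<subseteq> {..<d}" and i: "i < n"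
  shows "b \<bullet> row X i = (\<Sum>j\<in>M. b $ j * X $$ (i, j))"
proof -
  have "b \<bullet> row X i = (\<Sum>k<d. b $ k * X $$ (i, k))"
    using b by (intro scalar_prod_row[OF X _ i]) (simp add: model_space_def)
  also have "\<dots> = (\<Sum>j\<in>M. b $ j * X $$ (i, j))"
    using b M by (intro sum.mono_neutral_right) (auto simp: model_space_def)
  finally show ?thesis .
qed

lemma full_model_contains:
  assumes X: "X \<in> carrier_mat n d" and rank: "vec_space.rank n X = r"
    and J: "J \<subseteq> {..<d}" "card J = r" "cols_lin_indpt X J" and b: "b \<in> carrier_vec d"
  shows "\<exists>v\<in>model_space d J. \<forall>i<n. v \<bullet> row X i = b \<bullet> row X i"
proof -
  obtain c where c: "\<And>i. i < n \<Longrightarrow> b \<bullet> row X i = (\<Sum>j\<in>J. c j * X $$ (i, j))"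
    using predictors_span[OF X rank J b] by blast
  define v where "v = vec d (\<lambda>j. if j \<in> J then c j else 0)"
  have v: "v \<in> model_space d J" by (simp add: v_def model_space_def)
  have "v \<bullet> row X i = b \<bullet> row X i" if i: "i < n" for i
    unfolding model_space_scalar_prod[OF X v J(1) i] c[OF i]
    using J(1) by (intro sum.cong) (auto simp: v_def)
  with v show ?thesis by blast
qed

text \<open>\<open>m^m / fact m\<close> is a single term of the series of
  \<open>exp m\<close>.\<close>

lemma binomial_le_exp:
  assumes "1 \<le> m" "m \<le> d"
  shows "real (d choose m) \<le> exp (real m * ln (real d * exp 1 / real m))"
proof -
  have "real m ^ m / fact m \<le> exp (real m)"
  proof -
    have "(\<Sum>k\<in>{m}. inverse (fact k) * real m ^ k) \<le> (\<Sum>k. inverse (fact k) * real m ^ k)"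
      using summable_exp[of "real m"] by (intro sum_le_suminf) auto
    then show ?thesis by (simp add: exp_def scaleR_conv_of_real field_simps)
  qed
  then have "real m ^ m \<le> exp (real m) * fact m" by (simp add: field_simps)
  moreover have "real (d choose m) * fact m \<le> real d ^ m"
    using binomial_fact_pow[of d m] by (metis of_nat_fact of_nat_le_iff of_nat_mult of_nat_power)
  ultimately have "real (d choose m) * real m ^ m * fact m \<le> real d ^ m * exp (real m) * fact m"
    using mult_mono[of "real (d choose m) * fact m" "real d ^ m" "real m ^ m" "exp (real m) * fact m"]
    by (simp add: mult_ac)
  then have 1: "real (d choose m) * real m ^ m \<le> real d ^ m * exp (real m)" by simp
  have pos: "0 < real d * exp 1 / real m" using assms by simp
  have "exp (real m * ln (real d * exp 1 / real m)) = (real d * exp 1 / real m) ^ m"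
    using pos by (simp add: exp_of_nat_mult)
  also have "\<dots> = real d ^ m * exp (real m) / real m ^ m"
    by (simp add: power_divide power_mult_distrib flip: exp_of_nat_mult)
  finally have eq: "exp (real m * ln (real d * exp 1 / real m)) = real d ^ m * exp (real m) / real m ^ m" .
  show ?thesis unfolding eq using 1 assms by (subst pos_le_divide_eq) auto
qed

lemma sum_models:
  fixes f :: "nat \<Rightarrow> real"
  assumes "finite A"
  shows "(\<Sum>M | M \<subseteq> A \<and> P (card M). f (card M)) = (\<Sum>m | m \<le> card A \<and> P m. real (card A choose m) * f m)"
proof -
  let ?S = "{M. M \<subseteq> A \<and> P (card M)}"
  have fin: "finite ?S" using assms by simp
  have img: "card ` ?S = {m. m \<le> card A \<and> P m}"
  proof (intro equalityI subsetI)
    fix m assume "m \<in> {m. m \<le> card A \<and> P m}"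
    then obtain M where "M \<subseteq> A" "card M = m" "P m" using obtain_subset_with_card_n[of m A] by auto
    then show "m \<in> card ` ?S" by blast
  qed (auto intro: card_mono[OF assms])
  have "(\<Sum>M\<in>?S. f (card M)) = (\<Sum>m\<in>card ` ?S. \<Sum>M | M \<in> ?S \<and> card M = m. f (card M))"
    using fin by (intro sum.group[symmetric]) auto
  also have "\<dots> = (\<Sum>m\<in>card ` ?S. real (card A choose m) * f m)"
  proof (intro sum.cong refl)
    fix m assume "m \<in> card ` ?S"
    then have "{M. M \<in> ?S \<and> card M = m} = {M. M \<subseteq> A \<and> card M = m}" by auto
    then show "(\<Sum>M | M \<in> ?S \<and> card M = m. f (card M)) = real (card A choose m) * f m"
      using n_subsets[OF assms, of m] by simp
  qed
  finally show ?thesis by (simp add: img)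
qed

text \<open>\<open>13033/10000\<close> is just below \<open>782/1000 * 5/3\<close>, the exponent
  left per dimension for small models; \<open>13365/10000 = 99/100 * 9/5 * 3/4\<close> is the one
  for large models. The factor \<open>49/50\<close> leaves a convergent geometric series.\<close>

lemma cubic_exp_bounds: "25/7 \<le> exp (13033/10000 :: real) * (49/50)" "25/7 \<le> exp (13365/10000 :: real)"
proof -
  have t: "(1 + x + x\<^sup>2 / 2) ^ 4 \<le> exp (4 * x)" if "0 \<le> x" for x :: real
  proof -
    have "1 + x + x\<^sup>2 / 2 \<le> exp x" using that by (rule exp_lower_Taylor_quadratic)
    then have "(1 + x + x\<^sup>2 / 2) ^ 4 \<le> exp x ^ 4" using that by (intro power_mono) auto
    then show ?thesis by (simp flip: exp_of_nat_mult)
  qed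
  have u: "(1 + x + x\<^sup>2 / 2) ^ 16 \<le> exp (16 * x)" if "0 \<le> x" for x :: real
  proof -
    have "1 + x + x\<^sup>2 / 2 \<le> exp x" using that by (rule exp_lower_Taylor_quadratic)
    then have "(1 + x + x\<^sup>2 / 2) ^ 16 \<le> exp x ^ 16" using that by (intro power_mono) auto
    then show ?thesis by (simp flip: exp_of_nat_mult)
  qed
  show "25/7 \<le> exp (13033/10000 :: real) * (49/50)" using u[of "13033/160000"] by (simp add: power2_eq_square numeral_eq_Suc)
  show "25/7 \<le> exp (13365/10000 :: real)" using t[of "13365/40000"] by (simp add: power2_eq_square numeral_eq_Suc)
qed

text \<open>
  The factor \<open>25/7\<close> per dimension is beaten by the penalty because \<open>99/100 * 9/5 > 1 + ln (25/7) / (1 + ln 2)\<close>;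
  this is where the lower bound on \<open>c\<close> enters.
\<close>

lemma small_models_sum:
  fixes t :: real
  assumes t: "1782/1000 \<le> t"
  shows "(\<Sum>M | M \<subseteq> {..<d} \<and> 2 * card M \<le> d. (25/7) ^ Suc (card M) * exp (- (t * (real (card M) * ln (real d * exp 1 / real (card M)))))) \<le> 1250/7"
proof -
  let ?f = "\<lambda>m. (25/7) ^ Suc m * exp (- (t * (real m * ln (real d * exp 1 / real m))))"
  have "(\<Sum>M | M \<subseteq> {..<d} \<and> 2 * card M \<le> d. ?f (card M))
    = (\<Sum>m | m \<le> d \<and> 2 * m \<le> d. real (d choose m) * ?f m)"
    using sum_models[where A = "{..<d}" and P = "\<lambda>m. 2 * m \<le> d" and f = ?f] by simp
  also have "\<dots> \<le> (\<Sum>m | m \<le> d \<and> 2 * m \<le> d. 25/7 * (49/50) ^ m)"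
  proof (rule sum_mono)
    fix m assume m: "m \<in> {m. m \<le> d \<and> 2 * m \<le> d}"
    show "real (d choose m) * ?f m \<le> 25/7 * (49/50) ^ m"
    proof (cases "m = 0")
      case False
      define L where "L = ln (real d * exp 1 / real m)"
      have "L = 1 + ln (real d / real m)" using False m by (simp add: L_def ln_div ln_mult)
      moreover have "ln 2 \<le> ln (real d / real m)" using False m by (intro ln_mono) (auto simp: field_simps)
      ultimately have L: "5/3 \<le> L" using ln2_ge_two_thirds by linarith
      have "real (d choose m) * exp (- (t * (real m * L))) \<le> exp (real m * L) * exp (- (t * (real m * L)))"
        using binomial_le_exp[of m d] False m by (intro mult_right_mono) (auto simp: L_def)
      also have "\<dots> = exp (real m * - ((t - 1) * L))" by (simp add: algebra_simps flip: exp_add)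
      also have "\<dots> = exp (- ((t - 1) * L)) ^ m" by (simp only: exp_of_nat_mult)
      finally have 1: "real (d choose m) * exp (- (t * (real m * L))) \<le> exp (- ((t - 1) * L)) ^ m" .
      have "13033/10000 \<le> (t - 1) * L" using mult_mono[of "782/1000" "t - 1" "5/3" L] t L by simp
      then have "exp (- ((t - 1) * L)) \<le> exp (- (13033/10000))" by simp
      also have "\<dots> \<le> 7/25 * (49/50)"
        using cubic_exp_bounds(1) by (simp add: exp_minus field_simps)
      finally have "(25/7 * exp (- ((t - 1) * L))) ^ m \<le> (49/50) ^ m" by (intro power_mono) auto
      then have "25/7 * (25/7 * exp (- ((t - 1) * L))) ^ m \<le> 25/7 * (49/50) ^ m" by simp
      moreover have "(25/7) ^ Suc m * (real (d choose m) * exp (- (t * (real m * L)))) \<le> (25/7) ^ Suc m * exp (- ((t - 1) * L)) ^ m"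
        by (intro mult_left_mono 1) simp
      moreover have "(25/7) ^ Suc m * exp (- ((t - 1) * L)) ^ m = 25/7 * (25/7 * exp (- ((t - 1) * L))) ^ m"
        by (simp only: power_mult_distrib power_Suc mult.assoc)
      ultimately have "(25/7) ^ Suc m * (real (d choose m) * exp (- (t * (real m * L)))) \<le> 25/7 * (49/50) ^ m" by linarith
      then show ?thesis by (simp add: L_def mult_ac)
    qed simp
  qed
  also have "\<dots> \<le> (\<Sum>m<Suc d. 25/7 * (49/50) ^ m)" by (intro sum_mono2) auto
  also have "\<dots> = 25/7 * (\<Sum>m<Suc d. (49/50) ^ m)" by (simp only: sum_distrib_left)
  also have "(\<Sum>m<Suc d. (49/50::real) ^ m) \<le> 50"
    unfolding geometric_sum[of "49/50::real", simplified] by simp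
  finally show ?thesis by simp
qed

section \<open>From the likelihood to the excess risk\<close>

text \<open>With \<open>A\<close>, \<open>B\<close> the arctangents of \<open>exp (a/2)\<close>,
  \<open>exp (b/2)\<close>, the success probabilities are the squared sines and the gap is
  \<open>- ln (cos (A - B))\<close>. Their difference is \<open>sin (A + B) * sin (A - B)\<close> up
  to sign, and \<open>sin^2 \<le> - ln (cos^2)\<close>. Predictors of opposite sign put
  \<open>1/2\<close> between the probabilities.\<close>

lemma half_sq_le_gap:
  assumes "a \<le> 0 \<and> 0 \<le> b \<or> b \<le> 0 \<and> 0 \<le> a"
  shows "(exp b / (1 + exp b) - 1/2)\<^sup>2 / 2 \<le> gap a b"
proof -
  define A B where "A = arctan (exp (a/2))" and "B = arctan (exp (b/2))"
  have sig: "exp x / (1 + exp x) = (sin (arctan (exp (x/2))))\<^sup>2" for x :: real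
  proof -
    have "exp x = (exp (x/2))\<^sup>2" by (simp add: power2_eq_square flip: exp_add)
    moreover have "0 < 1 + (exp (x/2))\<^sup>2" by (simp add: add_pos_pos)
    ultimately show ?thesis by (simp add: sin_arctan power_divide)
  qed
  have AB: "0 < A" "A < pi/2" "0 < B" "B < pi/2"
    using arctan_ubound[of "exp (a/2)"] arctan_ubound[of "exp (b/2)"] by (simp_all add: A_def B_def)
  have c: "0 < cos (A - B)" using AB by (intro cos_gt_zero_pi) auto
  have gap: "gap a b = - ln (cos (A - B))"
  proof -
    have "1 + (tan (A - B))\<^sup>2 = inverse ((cos (A - B))\<^sup>2)"
      using c sin_squared_eq[of "A - B"] by (simp add: tan_def power_divide field_simps)
    then show ?thesis using c by (simp add: gap_eq A_def[symmetric] B_def[symmetric] ln_inverse ln_realpow)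
  qed
  have "(exp b / (1 + exp b) - exp a / (1 + exp a))\<^sup>2 \<le> (sin (A - B))\<^sup>2"
  proof -
    have "sin (A + B) * sin (A - B) = (sin A)\<^sup>2 * (cos B)\<^sup>2 - (cos A)\<^sup>2 * (sin B)\<^sup>2"
      by (simp add: sin_add sin_diff power2_eq_square algebra_simps)
    then have "(sin B)\<^sup>2 - (sin A)\<^sup>2 = - (sin (A + B) * sin (A - B))"
      by (simp add: cos_squared_eq algebra_simps)
    then have "(exp b / (1 + exp b) - exp a / (1 + exp a))\<^sup>2 = (sin (A + B))\<^sup>2 * (sin (A - B))\<^sup>2"
      unfolding sig A_def[symmetric] B_def[symmetric] by (simp add: power_mult_distrib)
    also have "\<dots> \<le> 1 * (sin (A - B))\<^sup>2" by (intro mult_right_mono) (auto simp: abs_square_le_1)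
    finally show ?thesis by simp
  qed
  also have "\<dots> = 1 - (cos (A - B))\<^sup>2" by (simp add: sin_squared_eq)
  also have "\<dots> \<le> - ln ((cos (A - B))\<^sup>2)" using ln_le_minus_one[of "(cos (A - B))\<^sup>2"] c by simp
  also have "\<dots> = 2 * gap a b" using c by (simp add: gap ln_realpow)
  finally have 1: "(exp b / (1 + exp b) - exp a / (1 + exp a))\<^sup>2 \<le> 2 * gap a b" .
  have half: "(exp x / (1 + exp x) \<le> 1/2) = (x \<le> 0)" "(1/2 \<le> exp x / (1 + exp x)) = (0 \<le> x)" for x :: real
    by (simp_all add: field_simps add_pos_pos)
  have "\<bar>exp b / (1 + exp b) - 1/2\<bar> \<le> \<bar>exp b / (1 + exp b) - exp a / (1 + exp a)\<bar>"
    using assms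
  proof (elim disjE conjE)
    assume "a \<le> 0" "0 \<le> b"
    then have "exp a / (1 + exp a) \<le> 1/2" "1/2 \<le> exp b / (1 + exp b)" by (simp_all only: half)
    then show ?thesis by linarith
  next
    assume "b \<le> 0" "0 \<le> a"
    then have "exp b / (1 + exp b) \<le> 1/2" "1/2 \<le> exp a / (1 + exp a)" by (simp_all only: half)
    then show ?thesis by linarith
  qed
  then have "(exp b / (1 + exp b) - 1/2)\<^sup>2 \<le> (exp b / (1 + exp b) - exp a / (1 + exp a))\<^sup>2"
    by (simp add: abs_le_square_iff)
  with 1 show ?thesis by simp
qed

lemma isCont_gap: "isCont (\<lambda>a. gap a b) x"
  unfolding gap_def by (intro continuous_intros) (auto simp: add_pos_pos less_imp_neq[symmetric])

text \<open>The loss \<open>\<epsilon>\<close> is for a limit equal to 0, classified as 1: the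
  sequence may approach it from below, where the signs agree with \<open>b < 0\<close>. Continuity
  of \<open>gap\<close> at 0 then replaces the sign condition.\<close>

lemma disagreement_gap:
  assumes conv: "convergent (\<lambda>k. ereal (f k))" and ne: "(0 \<le> lim (\<lambda>k. ereal (f k))) \<noteq> (0 \<le> b)" and e: "0 < \<epsilon>"
  shows "\<forall>\<^sub>F k in sequentially. (exp b / (1 + exp b) - 1/2)\<^sup>2 / 2 - \<epsilon> \<le> gap (f k) b"
proof -
  let ?D = "(exp b / (1 + exp b) - 1/2)\<^sup>2 / 2"
  let ?L = "lim (\<lambda>k. ereal (f k))"
  have L: "(\<lambda>k. ereal (f k)) \<longlonglongrightarrow> ?L" using conv by (simp add: convergent_LIMSEQ_iff)
  show ?thesis
  proof (cases "0 \<le> b")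
    case True
    then have "?L < 0" using ne by simp
    then have "\<forall>\<^sub>F k in sequentially. ereal (f k) < 0" by (rule order_tendstoD(2)[OF L])
    then show ?thesis
    proof eventually_elim
      case (elim k)
      then have "?D \<le> gap (f k) b" using True by (intro half_sq_le_gap) auto
      then show ?case using e by simp
    qed
  next
    case False
    have gt: "?D - \<epsilon> < gap 0 b" using half_sq_le_gap[of 0 b] False e by simp
    have "((\<lambda>a. gap a b) \<longlongrightarrow> gap 0 b) (at 0)" using isCont_gap[of 0 b] unfolding isCont_def .
    then have "\<forall>\<^sub>F a in at 0. ?D - \<epsilon> < gap a b" using gt by (rule order_tendstoD(1))
    then obtain s where s: "0 < s" "\<And>a. a \<noteq> 0 \<Longrightarrow> dist a 0 < s \<Longrightarrow> ?D - \<epsilon> < gap a b"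
      unfolding eventually_at by auto
    have "ereal (- s) < 0" using s(1) by simp
    also have "0 \<le> ?L" using False ne by simp
    finally have "ereal (- s) < ?L" .
    then have "\<forall>\<^sub>F k in sequentially. ereal (- s) < ereal (f k)" by (rule order_tendstoD(1)[OF L])
    then show ?thesis
    proof eventually_elim
      case (elim k)
      show ?case
      proof (cases "0 \<le> f k")
        case True
        then have "?D \<le> gap (f k) b" using False by (intro half_sq_le_gap) auto
        then show ?thesis using e by simp
      next
        case neg: False
        then have "?D - \<epsilon> < gap (f k) b" using elim by (intro s) (auto simp: dist_real_def)
        then show ?thesis by simp
      qed
    qed
  qed
qed

lemma log_lik_ratio:
  assumes l: "0 < (l::real)" and p: "\<And>i. i < dim_row X \<Longrightarrow> 0 < p i \<and> p i < 1 \<and> ln (p i / (1 - p i)) = \<beta> \<bullet> row X i"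
    and u: "\<And>i. i < dim_row X \<Longrightarrow> b \<bullet> row X i - \<beta> \<bullet> row X i = u i"
  shows "(\<Sum>i<dim_row X. if y i then ln (tilt l (p i) (- u i)) else ln (tilt l (1 - p i) (u i)))
    = l * (log_lik X y b - log_lik X y \<beta>)"
proof -
  have t: "(if y i then ln (tilt l (p i) (- u i)) else ln (tilt l (1 - p i) (u i)))
    = l * ((b \<bullet> row X i) * of_bool (y i) - ln (1 + exp (b \<bullet> row X i)) - ((\<beta> \<bullet> row X i) * of_bool (y i) - ln (1 + exp (\<beta> \<bullet> row X i))))"
    if i: "i < dim_row X" for i
  proof -
    let ?\<eta> = "\<beta> \<bullet> row X i"
    have pi: "0 < p i" "p i < 1" "ln (p i / (1 - p i)) = ?\<eta>" using p[OF i] by blast+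
    have eta: "exp ?\<eta> = p i / (1 - p i)" unfolding pi(3)[symmetric] using pi(1,2) by (intro exp_ln) simp
    have b: "b \<bullet> row X i = ?\<eta> + u i" using u[OF i] by simp
    have q: "1 / (1 - p i) = 1 + exp ?\<eta>" using pi by (simp add: eta field_simps)
    have pos: "0 < (1 - p i) + p i * exp (u i)" "0 < p i + (1 - p i) * exp (- u i)" using pi by (simp_all add: add_pos_pos)
    have "1 + exp (b \<bullet> row X i) = ((1 - p i) + p i * exp (u i)) * (1 / (1 - p i))"
      using pi by (simp add: b exp_add eta field_simps)
    then have h1: "ln (1 + exp (b \<bullet> row X i)) = ln ((1 - p i) + p i * exp (u i)) + ln (1 + exp ?\<eta>)"
      using ln_mult_pos[OF pos(1), of "1 + exp ?\<eta>"] by (simp add: q add_pos_pos)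
    have "p i + (1 - p i) * exp (- u i) = exp (- u i) * ((1 - p i) + p i * exp (u i))"
      by (simp add: algebra_simps flip: exp_add)
    then have "ln (p i + (1 - p i) * exp (- u i)) = ln ((1 - p i) + p i * exp (u i)) - u i"
      using ln_mult_pos[OF exp_gt_zero pos(1), of "- u i"] by simp
    then have t1: "ln (tilt l (p i) (- u i)) = - l * (ln ((1 - p i) + p i * exp (u i)) - u i)"
      using pi by (simp only: ln_tilt)
    have t0: "ln (tilt l (1 - p i) (u i)) = - l * ln ((1 - p i) + p i * exp (u i))"
      using pi ln_tilt[of "1 - p i" l "u i"] by simp
    show ?thesis unfolding t1 t0 h1 unfolding b by (simp add: right_diff_distrib distrib_left)
  qed
  show ?thesis
    unfolding log_lik_def sum_subtractf[symmetric] sum_distrib_left by (intro sum.cong refl) (simp add: t)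
qed

lemma neg_log_lik_eq:
  assumes "maximizing_seq X y M b"
  shows "neg_log_lik X y b = - (SUP \<beta>\<in>model_space (dim_col X) M. log_lik X y \<beta>)"
    "(\<lambda>k. log_lik X y (b k)) \<longlonglongrightarrow> - neg_log_lik X y b"
proof -
  have lim: "(\<lambda>k. log_lik X y (b k)) \<longlonglongrightarrow> (SUP \<beta>\<in>model_space (dim_col X) M. log_lik X y \<beta>)"
    using assms by (simp add: maximizing_seq_def)
  have "(\<lambda>k. - log_lik X y (b k)) \<longlonglongrightarrow> - (SUP \<beta>\<in>model_space (dim_col X) M. log_lik X y \<beta>)"
    by (intro tendsto_minus lim)
  moreover have "- log_lik X y (b k) = (\<Sum>i<dim_row X. ln (1 + exp (b k \<bullet> row X i)) - (b k \<bullet> row X i) * of_bool (y i))" for k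
    by (simp add: log_lik_def sum_negf[symmetric])
  ultimately show 1: "neg_log_lik X y b = - (SUP \<beta>\<in>model_space (dim_col X) M. log_lik X y \<beta>)"
    unfolding neg_log_lik_def by (simp add: limI)
  show "(\<lambda>k. log_lik X y (b k)) \<longlonglongrightarrow> - neg_log_lik X y b" using lim 1 by simp
qed

text \<open>
  Concavity along the segment from the true parameter to the estimator: the value at the midpoint
  exceeds the average of the end points by the gaps, which control the disagreement of the classifiers.
\<close>

lemma selection_bound:
  assumes X: "X \<in> carrier_mat n d" and sel: "penalized_ml_selection X c r bhat Mhat" and \<beta>: "\<beta> \<in> carrier_vec d"
    and p: "\<And>i. i < n \<Longrightarrow> 0 < p i \<and> p i < 1 \<and> ln (p i / (1 - p i)) = \<beta> \<bullet> row X i"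
    and M0: "M0 \<subseteq> {..<d}" "card M0 \<le> r" and v: "v \<in> model_space d M0" "\<And>i. i < n \<Longrightarrow> v \<bullet> row X i = \<beta> \<bullet> row X i"
    and Z: "\<And>b. b \<in> model_space d (Mhat y) \<Longrightarrow> log_lik X y b - log_lik X y \<beta> \<le> Z"
      "\<And>b. b \<in> model_space d (Mhat y) \<Longrightarrow> log_lik X y ((1/2) \<cdot>\<^sub>v (b + \<beta>)) - log_lik X y \<beta> \<le> Z"
  shows "99/100 * (Pen c d r (card (Mhat y)) - Pen c d r (card M0))
    + 1/100 * (\<Sum>i | i < n \<and> plug_in (bhat y (Mhat y)) (row X i) \<noteq> bayes \<beta> (row X i). (p i - 1/2)\<^sup>2) \<le> Z"
proof -
  let ?M = "Mhat y" and ?b = "bhat y (Mhat y)"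
  let ?A = "{i. i < n \<and> plug_in ?b (row X i) \<noteq> bayes \<beta> (row X i)}"
  let ?P = "Pen c d r (card ?M) - Pen c d r (card M0)" and ?D = "\<Sum>i\<in>?A. (p i - 1/2)\<^sup>2"
  have dims: "dim_row X = n" "dim_col X = d" using X by auto
  have mle: "M \<subseteq> {..<d} \<Longrightarrow> card M \<le> r \<Longrightarrow> maximizing_seq X y M (bhat y M)" for M
    using sel by (auto simp: penalized_ml_selection_def dims intro: mle_seq_imp_maximizing_seq)
  have M: "?M \<subseteq> {..<d}" "card ?M \<le> r" and
    min: "\<And>M. M \<subseteq> {..<d} \<Longrightarrow> card M \<le> r \<Longrightarrow> neg_log_lik X y ?b + Pen c d r (card ?M) \<le> neg_log_lik X y (bhat y M) + Pen c d r (card M)"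
    using sel by (auto simp: penalized_ml_selection_def dims is_arg_min_linorder)
  have seq: "maximizing_seq X y ?M ?b" by (rule mle[OF M])
  have vl: "log_lik X y v = log_lik X y \<beta>" unfolding log_lik_def using v(2) by (intro sum.cong) (auto simp: dims)
  have "log_lik X y \<beta> \<le> - neg_log_lik X y (bhat y M0)"
    using cSUP_upper[OF v(1) bdd_above_log_lik, of X y] neg_log_lik_eq(1)[OF mle[OF M0]] by (simp add: dims vl)
  with min[OF M0] have lim_ge: "?P \<le> - neg_log_lik X y ?b - log_lik X y \<beta>" by simp
  have pe: "exp (\<beta> \<bullet> row X i) / (1 + exp (\<beta> \<bullet> row X i)) = p i" if i: "i < n" for i
  proof -
    have pi: "0 < p i" "p i < 1" "ln (p i / (1 - p i)) = \<beta> \<bullet> row X i" using p[OF i] by blast+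
    have "exp (\<beta> \<bullet> row X i) = p i / (1 - p i)" unfolding pi(3)[symmetric] using pi(1,2) by (intro exp_ln) simp
    moreover have "1 + p i / (1 - p i) = 1 / (1 - p i)" using pi(1,2) by (simp add: field_simps)
    ultimately show ?thesis using pi(1,2) by simp
  qed
  show ?thesis
  proof (rule field_le_epsilon)
    fix \<epsilon> :: real assume e: "0 < \<epsilon>"
    \<comment> \<open>Shared between at most \<open>n\<close> gaps and the likelihood
      itself.\<close>
    define \<epsilon>' where "\<epsilon>' = \<epsilon> / (2 * (1 + real n))"
    have "(1 + real n) * \<epsilon>' = \<epsilon> / 2" unfolding \<epsilon>'_def by (simp add: divide_simps)
    moreover have "0 < \<epsilon>'" using e by (simp add: \<epsilon>'_def add_pos_nonneg)
    ultimately have e': "0 < \<epsilon>'" "real n * \<epsilon>' + \<epsilon>' \<le> \<epsilon>" using e by (simp_all add: algebra_simps)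
    have "\<forall>\<^sub>F k in sequentially. ?P + log_lik X y \<beta> - \<epsilon>' < log_lik X y (?b k)"
      using lim_ge e' by (intro order_tendstoD(1)[OF neg_log_lik_eq(2)[OF seq]]) simp
    moreover have "\<forall>\<^sub>F k in sequentially. \<forall>i\<in>?A. (p i - 1/2)\<^sup>2 / 2 - \<epsilon>' \<le> gap (?b k \<bullet> row X i) (\<beta> \<bullet> row X i)"
    proof (rule eventually_ball_finite)
      show "\<forall>i\<in>?A. \<forall>\<^sub>F k in sequentially. (p i - 1/2)\<^sup>2 / 2 - \<epsilon>' \<le> gap (?b k \<bullet> row X i) (\<beta> \<bullet> row X i)"
      proof
        fix i assume i: "i \<in> ?A"
        then have c: "convergent (\<lambda>k. ereal (?b k \<bullet> row X i))" using seq by (simp add: maximizing_seq_def dims)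
        have "(0 \<le> lim (\<lambda>k. ereal (?b k \<bullet> row X i))) \<noteq> (0 \<le> \<beta> \<bullet> row X i)" using i by (simp add: plug_in_def bayes_def)
        from disagreement_gap[OF c this e'(1)] i pe
        show "\<forall>\<^sub>F k in sequentially. (p i - 1/2)\<^sup>2 / 2 - \<epsilon>' \<le> gap (?b k \<bullet> row X i) (\<beta> \<bullet> row X i)" by simp
      qed
    qed simp
    ultimately have "\<forall>\<^sub>F k in sequentially. ?P + log_lik X y \<beta> - \<epsilon>' < log_lik X y (?b k) \<and>
      (\<forall>i\<in>?A. (p i - 1/2)\<^sup>2 / 2 - \<epsilon>' \<le> gap (?b k \<bullet> row X i) (\<beta> \<bullet> row X i))" by (rule eventually_conj)
    then obtain k where k: "?P + log_lik X y \<beta> - \<epsilon>' < log_lik X y (?b k)"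
      "\<And>i. i \<in> ?A \<Longrightarrow> (p i - 1/2)\<^sup>2 / 2 - \<epsilon>' \<le> gap (?b k \<bullet> row X i) (\<beta> \<bullet> row X i)"
      using eventually_happens'[OF sequentially_bot] by blast
    have bk: "?b k \<in> model_space d ?M" using seq by (simp add: maximizing_seq_def dims)
    then have bc: "?b k \<in> carrier_vec d" by (simp add: model_space_def)
    have mid: "log_lik X y ((1/2) \<cdot>\<^sub>v (?b k + \<beta>)) =
      (log_lik X y (?b k) + log_lik X y \<beta>) / 2 + (\<Sum>i<n. gap (?b k \<bullet> row X i) (\<beta> \<bullet> row X i))"
      using log_lik_midpoint[of "?b k" X \<beta> y] bc \<beta> by (simp add: dims)
    have "?D / 2 - real n * \<epsilon>' \<le> (\<Sum>i\<in>?A. (p i - 1/2)\<^sup>2 / 2 - \<epsilon>')"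
    proof -
      have "real (card ?A) * \<epsilon>' \<le> real n * \<epsilon>'"
        using e' card_mono[of "{..<n}" ?A] by (intro mult_right_mono) auto
      then show ?thesis by (simp add: sum_subtractf sum_divide_distrib)
    qed
    also have "\<dots> \<le> (\<Sum>i\<in>?A. gap (?b k \<bullet> row X i) (\<beta> \<bullet> row X i))" by (intro sum_mono k(2))
    also have "\<dots> \<le> (\<Sum>i<n. gap (?b k \<bullet> row X i) (\<beta> \<bullet> row X i))" by (intro sum_mono2) (auto simp: gap_nonneg)
    finally have G: "?D / 2 - real n * \<epsilon>' \<le> (\<Sum>i<n. gap (?b k \<bullet> row X i) (\<beta> \<bullet> row X i))" .
    have 1: "?P - \<epsilon>' \<le> Z" using Z(1)[OF bk] k(1) by linarith
    have 2: "?P / 2 - \<epsilon>' / 2 + (?D / 2 - real n * \<epsilon>') \<le> Z" using Z(2)[OF bk] k(1) G unfolding mid by argo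
    have "0 \<le> real n * \<epsilon>'" using e' by simp
    \<comment> \<open>Weights \<open>49/50\<close> on 1 and \<open>1/50\<close> on 2: the penalty
      gets \<open>49/50 + 1/100\<close>, the disagreement term \<open>1/100\<close>.\<close>
    with 1 2 e' show "99/100 * ?P + 1/100 * ?D \<le> Z + \<epsilon>" by argo
  qed
qed

section \<open>Penalties of the competitor and of large models\<close>

text \<open>The competitor of the selected model is the support of the true parameter or a full
  model, whichever is cheaper.\<close>

lemma pen_comparison_le:
  fixes c :: real
  assumes c: "0 < c" and m: "m \<le> d0" "d0 \<le> r" "r \<le> d" "1 \<le> d0"
  shows "min (Pen c d r m) (Pen c d r r) \<le> c * min (real d0 * ln (real d * exp 1 / real d0)) (real r)"
proof -
  \<comment> \<open>\<open>m * ln (d * e / m)\<close> increases up to \<open>m = d\<close>; here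
    from \<open>ln x \<le> x - 1\<close> and a logarithm of at least 1.\<close>
  have mono: "real m * ln (real d * exp 1 / real m) \<le> real d0 * ln (real d * exp 1 / real d0)" if m0: "0 < m"
  proof (cases "m = d0")
    case False
    have "ln (real d0 / real m) \<le> real d0 / real m - 1" using m m0 by (intro ln_le_minus_one) auto
    then have "real m * ln (real d0 / real m) \<le> real d0 - real m"
      using m0 mult_left_mono[of "ln (real d0 / real m)" "real d0 / real m - 1" "real m"] by (simp add: right_diff_distrib)
    moreover have "ln (real d * exp 1 / real m) = ln (real d0 / real m) + ln (real d * exp 1 / real d0)"
      using m m0 by (simp add: ln_div ln_mult)
    moreover have "1 \<le> ln (real d * exp 1 / real d0)"
      using m by (simp add: ln_div ln_mult)
    then have "(real d0 - real m) * 1 \<le> (real d0 - real m) * ln (real d * exp 1 / real d0)"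
      using m by (intro mult_left_mono) auto
    ultimately show ?thesis by (simp add: algebra_simps)
  qed simp
  have "1 \<le> ln (real d * exp 1 / real d0)" using m by (simp add: ln_div ln_mult)
  then have ge: "0 \<le> real d0 * ln (real d * exp 1 / real d0)" by (intro mult_nonneg_nonneg) auto
  have A: "Pen c d r r \<le> c * real r" using c m by (simp add: Pen_def)
  show ?thesis
  proof (cases "real d0 * ln (real d * exp 1 / real d0) \<le> real r")
    case False
    then show ?thesis using A by (simp add: min_def)
  next
    case True
    consider "m = 0" | "0 < m" "m < r" | "m = r" using m by linarith
    then have "Pen c d r m \<le> c * (real d0 * ln (real d * exp 1 / real d0))"
    proof cases
      case 1
      then show ?thesis using c ge by (simp add: Pen_def)
    next
      case 2
      then have "Pen c d r m = c * (real m * ln (real d * exp 1 / real m))" by (simp add: Pen_def)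
      then show ?thesis using mono[OF 2(1)] c by simp
    next
      case 3
      then have "d0 = r" using m by simp
      have "1 \<le> ln (real d * exp 1 / real d0)" using m by (simp add: ln_div ln_mult)
      then have "real r * 1 \<le> real d0 * ln (real d * exp 1 / real d0)" using \<open>d0 = r\<close> by (intro mult_mono) auto
      then have "c * real r \<le> c * (real d0 * ln (real d * exp 1 / real d0))" using c by simp
      then show ?thesis using 3 A by simp
    qed
    then show ?thesis using True by (simp add: min_def)
  qed
qed

text \<open>Above half of the columns, \<open>ln x \<le> x - 1\<close> gives
  \<open>m * (2 - m/d) \<ge> 3/4 * d\<close>, with equality at \<open>m = d/2\<close>. Such a
  penalty alone beats \<open>(25/7)^r\<close>, the moment of the full model, so large models need no
  union bound.\<close>

lemma pen_large_ge:
  fixes c :: real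
  assumes m: "m \<le> r" "r \<le> d" "d < 2 * m \<or> m = r" and l: "0 \<le> l" "9/5 \<le> l * c" and r: "1 \<le> r"
  shows "13365/10000 * real r \<le> 99/100 * l * Pen c d r m"
proof (cases "m = r")
  case True
  then have "l * Pen c d r m = (l * c) * real r" using r by (simp add: Pen_def)
  also have "\<dots> \<ge> 9/5 * real r" using l by (intro mult_right_mono) auto
  finally show ?thesis by simp
next
  case False
  then have m2: "d < 2 * m" "0 < m" "m < r" using m by auto
  have dm: "0 < real d" "real m \<le> real d" using m m2 by auto
  have "ln (real m / real d) \<le> real m / real d - 1" using dm m2 by (intro ln_le_minus_one) auto
  then have "2 - real m / real d \<le> ln (real d * exp 1 / real m)"
    using m2 dm by (simp add: ln_div ln_mult)
  then have "real m * (2 - real m / real d) \<le> real m * ln (real d * exp 1 / real m)" by (intro mult_left_mono) auto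
  moreover have "3/4 * real d \<le> real m * (2 - real m / real d)"
  proof -
    have "0 \<le> (real m - real d / 2) * (3 * real d / 2 - real m)" using m2 dm by (intro mult_nonneg_nonneg) auto
    then have "3/4 * (real d * real d) \<le> real m * (2 * real d - real m)" by (simp add: field_simps)
    then have "3/4 * real d \<le> real m * (2 * real d - real m) / real d" using dm by (simp add: pos_le_divide_eq)
    also have "\<dots> = real m * (2 - real m / real d)" using dm by (simp add: field_simps)
    finally show ?thesis .
  qed
  moreover have "3/4 * real r \<le> 3/4 * real d" using m by simp
  ultimately have "3/4 * real r \<le> real m * ln (real d * exp 1 / real m)" by argo
  moreover have "0 \<le> real r" by simp
  ultimately have "9/5 * (3/4 * real r) \<le> l * c * (real m * ln (real d * exp 1 / real m))"
    using l by (intro mult_mono[of "9/5" "l * c"]) auto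
  moreover have "l * Pen c d r m = l * c * (real m * ln (real d * exp 1 / real m))" using m2 by (simp add: Pen_def)
  ultimately show ?thesis by (simp only: mult.assoc)
qed

section \<open>Expected disagreement and excess risk\<close>

text \<open>A disagreement costs at most \<open>2 * \<bar>p i - 1/2\<bar>\<close>, and
  \<open>2 * \<bar>x\<bar> \<le> x^2 / t + t\<close>; \<open>t\<close> is optimised only after
  taking expectations.\<close>

lemma misclass_diff_le:
  assumes X: "dim_row X = n" and p: "\<And>i. i < n \<Longrightarrow> 0 < p i \<and> p i < 1" and t: "0 < t"
  shows "misclass_error X p \<eta>' - misclass_error X p \<eta>
    \<le> (1 / real n) * ((\<Sum>i | i < n \<and> \<eta>' (row X i) \<noteq> \<eta> (row X i). (p i - 1/2)\<^sup>2) / t + real n * t)"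
proof -
  let ?A = "{i. i < n \<and> \<eta>' (row X i) \<noteq> \<eta> (row X i)}"
  have pr: "measure_pmf.prob (bernoulli_pmf (p i)) {z. z \<noteq> b} = (if b then 1 - p i else p i)" if "i < n" for i b
  proof -
    have "{z. z \<noteq> b} = {\<not> b}" by auto
    then show ?thesis using p[OF that] by (simp add: measure_pmf_single)
  qed
  have "misclass_error X p \<eta>' - misclass_error X p \<eta> = (1 / real n) *
      (\<Sum>i<n. (if \<eta>' (row X i) then 1 - p i else p i) - (if \<eta> (row X i) then 1 - p i else p i))"
  proof -
    have "(\<Sum>i<n. measure_pmf.prob (bernoulli_pmf (p i)) {z. z \<noteq> \<theta> (row X i)}) = (\<Sum>i<n. if \<theta> (row X i) then 1 - p i else p i)" for \<theta>
      by (intro sum.cong refl pr) auto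
    then show ?thesis unfolding misclass_error_def X by (simp only: sum_subtractf right_diff_distrib)
  qed
  also have "\<dots> \<le> (1 / real n) * (\<Sum>i<n. (if i \<in> ?A then (p i - 1/2)\<^sup>2 / t else 0) + t)"
  proof (intro mult_left_mono sum_mono)
    fix i assume i: "i \<in> {..<n}"
    have am: "2 * \<bar>x\<bar> \<le> x\<^sup>2 / t + t" for x :: real
    proof -
      have "0 \<le> (\<bar>x\<bar> - t)\<^sup>2" by simp
      then have "2 * \<bar>x\<bar> * t \<le> x\<^sup>2 + t * t" by (simp add: power2_eq_square algebra_simps)
      then have "2 * \<bar>x\<bar> * t / t \<le> (x\<^sup>2 + t * t) / t" using t by (intro divide_right_mono) auto
      then show ?thesis using t by (simp add: add_divide_distrib)
    qed
    show "(if \<eta>' (row X i) then 1 - p i else p i) - (if \<eta> (row X i) then 1 - p i else p i)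
      \<le> (if i \<in> ?A then (p i - 1/2)\<^sup>2 / t else 0) + t"
      using am[of "p i - 1/2"] t i by (auto simp: abs_if split: if_splits)
  qed simp
  also have "\<dots> = (1 / real n) * ((\<Sum>i\<in>?A. (p i - 1/2)\<^sup>2) / t + real n * t)"
  proof -
    have "(\<Sum>i<n. if i \<in> ?A then (p i - 1/2)\<^sup>2 / t else 0) = (\<Sum>i\<in>?A. (p i - 1/2)\<^sup>2 / t)"
      by (simp add: sum.If_cases Int_def)
    then show ?thesis by (simp add: sum.distrib sum_divide_distrib)
  qed
  finally show ?thesis .
qed

lemma disagreement_expectation:
  fixes X :: "real mat" and c :: real
  assumes X: "X \<in> carrier_mat n d" and rank: "vec_space.rank n X = r"
    and ind: "\<forall>J. J \<subseteq> {..<d} \<and> card J = r \<longrightarrow> cols_lin_indpt X J"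
    and sel: "penalized_ml_selection X c r bhat Mhat" and \<beta>: "\<beta> \<in> carrier_vec d"
    and p: "\<And>i. i < n \<Longrightarrow> 0 < p i \<and> p i < 1 \<and> ln (p i / (1 - p i)) = \<beta> \<bullet> row X i \<and> l \<le> 9/20 * p i * (1 - p i)"
    and l: "0 < l" "9/5 \<le> l * c" and d0: "1 \<le> d0" "d0 \<le> r" "l0_norm \<beta> \<le> d0"
  shows "E (responses n p) (\<lambda>y. \<Sum>i | i < n \<and> plug_in (bhat y (Mhat y)) (row X i) \<noteq> bayes \<beta> (row X i). (p i - 1/2)\<^sup>2)
    \<le> 100 * (99/100 * c * min (real d0 * ln (real d * exp 1 / real d0)) (real r) + 180 / l)"
proof -
  let ?R = "min (real d0 * ln (real d * exp 1 / real d0)) (real r)"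
  let ?D = "\<lambda>y. \<Sum>i | i < n \<and> plug_in (bhat y (Mhat y)) (row X i) \<noteq> bayes \<beta> (row X i). (p i - 1/2)\<^sup>2"
  have c: "0 < c" using l by (metis divide_pos_pos less_le_trans mult_le_0_iff not_le zero_less_numeral order_less_imp_le)
  have rd: "r \<le> d" using rank_le_dim_col[OF X] rank by simp
  have dims: "dim_row X = n" "dim_col X = d" using X by auto
  obtain J where J: "J \<subseteq> {..<d}" "card J = r" using obtain_subset_with_card_n[of r "{..<d}"] rd by auto
  have J': "cols_lin_indpt X J" using ind J by blast
  have finJ: "finite J" using J finite_subset by blast
  define g where "g j i = (if j < d then X $$ (i, j) else \<beta> \<bullet> row X i)" for j i
  define S where "S K y = supexp (\<lambda>c. \<Sum>i<n. if y i then ln (tilt l (p i) (- (\<Sum>j\<in>K. c j * g j i)))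
      else ln (tilt l (1 - p i) (\<Sum>j\<in>K. c j * g j i)))" for K y
  have p': "0 < p i \<and> p i < 1 \<and> l \<le> 9/20 * p i * (1 - p i)" if "i < n" for i using p[OF that] by blast
  have p'': "0 < p i \<and> p i < 1 \<and> ln (p i / (1 - p i)) = \<beta> \<bullet> row X i" if "i < n" for i using p[OF that] by blast
  have ES: "E (responses n p) (S K) \<le> (25/7) ^ card K" if "finite K" for K
    unfolding S_def by (rule log_likelihood_moment[OF p' l(1) that])
  have S_upper: "exp (l * (log_lik X y b - log_lik X y \<beta>)) \<le> S K y"
    if "\<And>i. i < n \<Longrightarrow> b \<bullet> row X i - \<beta> \<bullet> row X i = (\<Sum>j\<in>K. c j * g j i)" "finite K" for b c K y
  proof -
    have "concave_bdd (\<lambda>c. \<Sum>i<n. if y i then ln (tilt l (p i) (- (\<Sum>j\<in>K. c j * g j i))) else ln (tilt l (1 - p i) (\<Sum>j\<in>K. c j * g j i)))"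
    proof (rule concave_bdd_sum)
      fix i assume "i \<in> {..<n}"
      then show "concave_bdd (\<lambda>c. if y i then ln (tilt l (p i) (- (\<Sum>j\<in>K. c j * g j i))) else ln (tilt l (1 - p i) (\<Sum>j\<in>K. c j * g j i)))"
        using p'[of i] l by (cases "y i") (auto intro!: concave_bdd_ln_tilt affine_form_uminus affine_form_sum)
    qed simp
    from supexp_upper[OF this, of c]
    show ?thesis unfolding S_def using log_lik_ratio[OF l(1), of X p \<beta> b "\<lambda>i. \<Sum>j\<in>K. c j * g j i" y] p'' that(1)
      by (simp add: dims)
  qed
  have S_pos: "0 < S K y" if "finite K" for K y
    using S_upper[where b = \<beta> and c = "\<lambda>_. 0" and K = K and y = y] that exp_gt_zero[of "0::real"] by (simp add: less_le_trans)
  define small where "small M \<longleftrightarrow> M \<subseteq> {..<d} \<and> 2 * card M \<le> d" for M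
  \<comment> \<open>All large or full models share one supremum over \<open>J\<close>, whose columns
    already span the true predictor.\<close>
  define K where "K y = (if small (Mhat y) \<and> card (Mhat y) < r then insert d (Mhat y) else J)" for y
  have Msub: "Mhat y \<subseteq> {..<d}" "card (Mhat y) \<le> r" for y
    using sel by (auto simp: penalized_ml_selection_def dims is_arg_min_linorder)
  have finK: "finite (K y)" for y using finJ finite_subset[OF Msub(1)[of y]] by (simp add: K_def)
  have spanK: "\<exists>a. \<forall>i<n. s * (b \<bullet> row X i - \<beta> \<bullet> row X i) = (\<Sum>j\<in>K y. a j * g j i)"
    if b: "b \<in> model_space d (Mhat y)" for b y s
  proof (cases "small (Mhat y) \<and> card (Mhat y) < r")
    case True
    let ?a = "\<lambda>j. s * (if j < d then b $ j else - 1)"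
    have "s * (b \<bullet> row X i - \<beta> \<bullet> row X i) = (\<Sum>j\<in>K y. ?a j * g j i)" if i: "i < n" for i
    proof -
      have "(\<Sum>j\<in>insert d (Mhat y). ?a j * g j i) = ?a d * g d i + (\<Sum>j\<in>Mhat y. ?a j * g j i)"
        using Msub(1)[of y] finite_subset[OF Msub(1)[of y]] by (subst sum.insert) auto
      also have "(\<Sum>j\<in>Mhat y. ?a j * g j i) = s * (b \<bullet> row X i)"
        unfolding model_space_scalar_prod[OF X b Msub(1) i] sum_distrib_left
        using Msub(1)[of y] by (intro sum.cong) (auto simp: g_def)
      finally show ?thesis using True by (simp add: K_def g_def algebra_simps)
    qed
    then show ?thesis by (intro exI[of _ ?a] allI impI)
  next
    case False
    then have KJ: "K y = J" by (auto simp: K_def)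
    have bc: "b \<in> carrier_vec d" using b by (simp add: model_space_def)
    obtain a1 where a1: "\<And>i. i < n \<Longrightarrow> b \<bullet> row X i = (\<Sum>j\<in>J. a1 j * X $$ (i, j))"
      using predictors_span[OF X rank J J' bc] by blast
    obtain a2 where a2: "\<And>i. i < n \<Longrightarrow> \<beta> \<bullet> row X i = (\<Sum>j\<in>J. a2 j * X $$ (i, j))"
      using predictors_span[OF X rank J J' \<beta>] by blast
    have "s * (b \<bullet> row X i - \<beta> \<bullet> row X i) = (\<Sum>j\<in>J. (s * (a1 j - a2 j)) * g j i)" if i: "i < n" for i
      unfolding a1[OF i] a2[OF i] sum_subtractf[symmetric] sum_distrib_left
      using J(1) by (intro sum.cong) (auto simp: g_def algebra_simps)
    then show ?thesis unfolding KJ by (intro exI[of _ "\<lambda>j. s * (a1 j - a2 j)"] allI impI)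
  qed
  define Z where "Z y = ln (S (K y) y) / l" for y
  have Z_upper: "log_lik X y b' - log_lik X y \<beta> \<le> Z y"
    if b: "b \<in> model_space d (Mhat y)" and b': "\<And>i. i < n \<Longrightarrow> b' \<bullet> row X i - \<beta> \<bullet> row X i = s * (b \<bullet> row X i - \<beta> \<bullet> row X i)" for b b' s y
  proof -
    obtain a where a: "\<And>i. i < n \<Longrightarrow> s * (b \<bullet> row X i - \<beta> \<bullet> row X i) = (\<Sum>j\<in>K y. a j * g j i)"
      using spanK[OF b, of s] by blast
    have "exp (l * (log_lik X y b' - log_lik X y \<beta>)) \<le> S (K y) y"
      by (rule S_upper[where c = a]) (simp_all add: b' a finK)
    then have "l * (log_lik X y b' - log_lik X y \<beta>) \<le> ln (S (K y) y)"
      using S_pos[OF finK] by (simp add: ln_ge_iff)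
    then show ?thesis using l by (simp add: Z_def pos_le_divide_eq mult.commute)
  qed
  obtain M0 where M0: "M0 \<subseteq> {..<d}" "card M0 \<le> r" "Pen c d r (card M0) \<le> c * ?R" and
    v0: "\<exists>v\<in>model_space d M0. \<forall>i<n. v \<bullet> row X i = \<beta> \<bullet> row X i"
  proof -
    let ?M = "{j. j < dim_vec \<beta> \<and> \<beta> $ j \<noteq> 0}"
    have M: "?M \<subseteq> {..<d}" "card ?M \<le> d0" using \<beta> d0 by (auto simp: l0_norm_def)
    have v: "\<beta> \<in> model_space d ?M" using \<beta> by (auto simp: model_space_def)
    have pen: "min (Pen c d r (card ?M)) (Pen c d r r) \<le> c * ?R"
      using M d0 rd c by (intro pen_comparison_le) auto
    show ?thesis
    proof (cases "Pen c d r (card ?M) \<le> Pen c d r r")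
      case True
      then show ?thesis using M v d0 pen by (intro that[of ?M]) auto
    next
      case False
      then show ?thesis using J full_model_contains[OF X rank J J' \<beta>] pen by (intro that[of J]) auto
    qed
  qed
  \<comment> \<open>\<open>ln (W y)\<close> is the bound left by \<open>selection_bound\<close>.
    Replacing it by \<open>W y\<close> itself allows a sum over models and linearity of
    expectation.\<close>
  define W where "W y = S (K y) y * exp (- (99/100 * l * Pen c d r (card (Mhat y))))" for y
  have key: "l * ?D y / 100 \<le> 99/100 * l * (c * ?R) + W y" for y
  proof -
    obtain v where v: "v \<in> model_space d M0" "\<And>i. i < n \<Longrightarrow> v \<bullet> row X i = \<beta> \<bullet> row X i" using v0 by blast
    have "99/100 * (Pen c d r (card (Mhat y)) - Pen c d r (card M0)) + 1/100 * ?D y \<le> Z y"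
    proof (rule selection_bound[OF X sel \<beta> p'' M0(1,2) v])
      fix b assume b: "b \<in> model_space d (Mhat y)"
      then have bc: "b \<in> carrier_vec d" by (simp add: model_space_def)
      show "log_lik X y b - log_lik X y \<beta> \<le> Z y" by (rule Z_upper[OF b, where s = 1]) simp
      show "log_lik X y ((1/2) \<cdot>\<^sub>v (b + \<beta>)) - log_lik X y \<beta> \<le> Z y"
      proof (rule Z_upper[OF b, where s = "1/2"])
        fix i assume "i < n"
        then have "row X i \<in> carrier_vec d" using X by auto
        then have "((1/2) \<cdot>\<^sub>v (b + \<beta>)) \<bullet> row X i = (b \<bullet> row X i + \<beta> \<bullet> row X i) / 2"
          using bc \<beta> by (simp add: smult_scalar_prod_distrib[of _ d] add_scalar_prod_distrib[of _ d])
        then show "((1/2) \<cdot>\<^sub>v (b + \<beta>)) \<bullet> row X i - \<beta> \<bullet> row X i = 1/2 * (b \<bullet> row X i - \<beta> \<bullet> row X i)"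
          by (simp add: field_simps)
      qed
    qed
    then have "l * (99/100 * (Pen c d r (card (Mhat y)) - Pen c d r (card M0)) + 1/100 * ?D y) \<le> l * Z y"
      using l by (intro mult_left_mono) auto
    moreover have "l * Z y = ln (S (K y) y)" using l by (simp add: Z_def)
    moreover have "l * Pen c d r (card M0) \<le> l * (c * ?R)" using M0(3) l by (intro mult_left_mono) auto
    moreover have "ln (S (K y) y) - 99/100 * l * Pen c d r (card (Mhat y)) = ln (W y)"
      using S_pos[OF finK[of y], of y] by (simp add: W_def ln_mult)
    moreover have "ln (W y) \<le> W y"
      using S_pos[OF finK[of y], of y] ln_le_minus_one[of "W y"] by (simp add: W_def)
    moreover have "l * (99/100 * (u - v) + 1/100 * w) = 99/100 * (l * u) - 99/100 * (l * v) + l * w / 100" for u v w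
      by (simp add: field_simps)
    ultimately show ?thesis by (simp only: mult.assoc)
  qed
  let ?T = "\<lambda>M. exp (- (99/100 * l * c * (real (card M) * ln (real d * exp 1 / real (card M)))))"
  have W_le: "W y \<le> (\<Sum>M | M \<subseteq> {..<d} \<and> 2 * card M \<le> d. S (insert d M) y * ?T M) + S J y * exp (- (13365/10000 * real r))" for y
  proof (cases "small (Mhat y) \<and> card (Mhat y) < r")
    case True
    have fin: "finite {M. M \<subseteq> {..<d} \<and> 2 * card M \<le> d}" by simp
    have nn: "0 \<le> S (insert d M) y * ?T M" if "M \<subseteq> {..<d}" for M
      using S_pos[of "insert d M" y] finite_subset[OF that] by (simp add: less_imp_le)
    have "W y = S (insert d (Mhat y)) y * ?T (Mhat y)"
      using True by (simp add: W_def K_def Pen_def mult_ac)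
    also have "\<dots> \<le> (\<Sum>M | M \<subseteq> {..<d} \<and> 2 * card M \<le> d. S (insert d M) y * ?T M)"
      using True nn by (intro member_le_sum[OF _ _ fin]) (auto simp: small_def)
    finally show ?thesis using S_pos[OF finJ, of y] by (simp add: add_increasing2 less_imp_le)
  next
    case False
    have "13365/10000 * real r \<le> 99/100 * l * Pen c d r (card (Mhat y))"
      using False Msub[of y] rd l d0 by (intro pen_large_ge) (auto simp: small_def)
    then have "W y \<le> S J y * exp (- (13365/10000 * real r))"
      using False S_pos[OF finJ, of y] unfolding W_def K_def by (simp only: if_False) (intro mult_left_mono, auto)
    moreover have "0 \<le> (\<Sum>M | M \<subseteq> {..<d} \<and> 2 * card M \<le> d. S (insert d M) y * ?T M)"
      by (intro sum_nonneg mult_nonneg_nonneg less_imp_le[OF S_pos]) (auto intro: finite_subset)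
    ultimately show ?thesis by simp
  qed
  have finR: "finite (set_pmf (responses n p))" unfolding responses_def by (rule finite_set_Pi_pmf) simp
  note int = integrable_measure_pmf_finite[OF finR]
  \<comment> \<open>\<open>1250/7\<close> from the small models plus 1 from the large ones.\<close>
  have EW: "E (responses n p) W \<le> 180"
  proof -
    have "E (responses n p) W \<le> E (responses n p) (\<lambda>y. (\<Sum>M | M \<subseteq> {..<d} \<and> 2 * card M \<le> d. S (insert d M) y * ?T M) + S J y * exp (- (13365/10000 * real r)))"
      by (intro E_mono finR W_le)
    also have "\<dots> = (\<Sum>M | M \<subseteq> {..<d} \<and> 2 * card M \<le> d. E (responses n p) (S (insert d M)) * ?T M) + E (responses n p) (S J) * exp (- (13365/10000 * real r))"
      by (simp add: int Bochner_Integration.integral_sum)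
    also have "\<dots> \<le> (\<Sum>M | M \<subseteq> {..<d} \<and> 2 * card M \<le> d. (25/7) ^ Suc (card M) * ?T M) + (25/7) ^ r * exp (- (13365/10000 * real r))"
    proof (intro add_mono sum_mono mult_right_mono)
      fix M assume "M \<in> {M. M \<subseteq> {..<d} \<and> 2 * card M \<le> d}"
      then have M: "M \<subseteq> {..<d}" "finite M" by (auto intro: finite_subset)
      then have "card (insert d M) = Suc (card M)" by (subst card_insert_disjoint) auto
      then show "E (responses n p) (S (insert d M)) \<le> (25/7) ^ Suc (card M)" using ES[of "insert d M"] M by simp
    qed (use ES[OF finJ] J in auto)
    also have "(\<Sum>M | M \<subseteq> {..<d} \<and> 2 * card M \<le> d. (25/7) ^ Suc (card M) * ?T M) \<le> 1250/7"
      using l by (intro small_models_sum) (auto simp: mult_ac)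
    also have "(25/7) ^ r * exp (- (13365/10000 * real r)) \<le> (1::real)"
    proof -
      have "exp (13365/10000 * real r) = exp (13365/10000 :: real) ^ r" by (simp add: mult.commute flip: exp_of_nat_mult)
      moreover have "(25/7) ^ r \<le> exp (13365/10000 :: real) ^ r" by (intro power_mono cubic_exp_bounds) auto
      ultimately show ?thesis by (simp add: exp_minus field_simps)
    qed
    finally show ?thesis by simp
  qed
  have "E (responses n p) (\<lambda>y. l * ?D y / 100) \<le> E (responses n p) (\<lambda>y. 99/100 * l * (c * ?R) + W y)"
    by (intro E_mono finR key)
  also have "\<dots> = 99/100 * l * (c * ?R) + E (responses n p) W" by (simp add: int)
  also have "\<dots> \<le> 99/100 * l * (c * ?R) + 180" using EW by simp
  also have "E (responses n p) (\<lambda>y. l * ?D y / 100) = l * (E (responses n p) ?D / 100)" by simp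
  finally have "l * (E (responses n p) ?D / 100) \<le> l * (99/100 * (c * ?R) + 180 / l)" using l by (simp add: distrib_left)
  then have "E (responses n p) ?D / 100 \<le> 99/100 * (c * ?R) + 180 / l" using l by (simp only: mult_le_cancel_left_pos)
  then show ?thesis by (simp add: mult.assoc)
qed

text \<open>\<open>t = sqrt (B / n)\<close> balances the two terms of
  \<open>misclass_diff_le\<close>.\<close>

lemma excess_risk_le:
  fixes D :: "(nat \<Rightarrow> bool) \<Rightarrow> real"
  assumes X: "dim_row X = n" and n: "0 < n" and p: "\<And>i. i < n \<Longrightarrow> 0 < p i \<and> p i < 1"
    and D: "D = (\<lambda>y. \<Sum>i | i < n \<and> \<eta>' y (row X i) \<noteq> \<eta> (row X i). (p i - 1/2)\<^sup>2)"
    and B: "E (responses n p) D \<le> B" "0 < B"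
  shows "excess_risk X p \<eta>' \<eta> \<le> 2 * sqrt (B / real n)"
proof -
  define t where "t = sqrt (B / real n)"
  have t: "0 < t" "t * t = B / real n" using n B(2) by (simp_all add: t_def)
  have finR: "finite (set_pmf (responses n p))" unfolding responses_def by (rule finite_set_Pi_pmf) simp
  note int = integrable_measure_pmf_finite[OF finR]
  have "excess_risk X p \<eta>' \<eta> = E (responses n p) (\<lambda>y. misclass_error X p (\<eta>' y) - misclass_error X p \<eta>)"
    unfolding excess_risk_def X by (simp add: int)
  also have "\<dots> \<le> E (responses n p) (\<lambda>y. (1 / real n) * (D y / t + real n * t))"
    unfolding D by (intro E_mono finR misclass_diff_le[OF X p t(1)])
  also have "\<dots> = (1 / real n) * (E (responses n p) D / t + real n * t)" by (simp add: int)
  also have "\<dots> \<le> (1 / real n) * (B / t + real n * t)"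
    using B t by (intro mult_left_mono add_right_mono divide_right_mono) auto
  also have "\<dots> = (B / real n) / t + t" using n by (simp add: distrib_left)
  also have "\<dots> = 2 * t" unfolding t(2)[symmetric] using t(1) by simp
  finally show ?thesis by (simp only: t_def)
qed

theorem theorem1:
  fixes c :: real
  shows "\<exists>C1>0. \<forall>(\<delta>::real) n d r (X :: real mat) bhat Mhat.
    0 < \<delta> \<and> \<delta> < 1/2 \<and> c > 4 / (\<delta> * (1 - \<delta>)) \<and>
    X \<in> carrier_mat n d \<and> vec_space.rank n X = r \<and>
    (\<forall>J. J \<subseteq> {..<d} \<and> card J = r \<longrightarrow> cols_lin_indpt X J) \<and>
    penalized_ml_selection X c r bhat Mhat
    \<longrightarrow> (\<forall>d0. 1 \<le> d0 \<and> d0 \<le> r \<longrightarrow>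
          (\<forall>\<beta> p. \<beta> \<in> carrier_vec d \<and> l0_norm \<beta> \<le> d0 \<and>
             (\<forall>i<n. \<delta> < p i \<and> p i < 1 - \<delta> \<and> ln (p i / (1 - p i)) = scalar_prod \<beta> (Matrix.row X i))
             \<longrightarrow> excess_risk X p (\<lambda>y. plug_in (bhat y (Mhat y))) (bayes \<beta>)
                 \<le> C1 * sqrt (1 / (\<delta> * (1 - \<delta>)) *
                     (min (real d0 * ln (real d * exp 1 / real d0)) (real r) / real n))))"
\<comment> \<open>\<open>10099 = 99 + 10000\<close>: the second part is
  \<open>100 * (180 / l)\<close>, turned into a multiple of \<open>c\<close> by the lower bound on
  \<open>c\<close>. The form \<open>\<bar>c\<bar> + 1\<close> keeps the constant positive for every
  real \<open>c\<close>.\<close>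
proof (intro exI[of _ "2 * sqrt (10099 * (\<bar>c\<bar> + 1))"] conjI allI impI)
  fix \<delta> :: real and n d r and X :: "real mat" and bhat Mhat d0 \<beta> p
  let ?w = "\<delta> * (1 - \<delta>)" and ?R = "min (real d0 * ln (real d * exp 1 / real d0)) (real r)"
  assume "0 < \<delta> \<and> \<delta> < 1/2 \<and> c > 4 / (\<delta> * (1 - \<delta>)) \<and>
    X \<in> carrier_mat n d \<and> vec_space.rank n X = r \<and>
    (\<forall>J. J \<subseteq> {..<d} \<and> card J = r \<longrightarrow> cols_lin_indpt X J) \<and> penalized_ml_selection X c r bhat Mhat"
  then have \<delta>: "0 < \<delta>" "\<delta> < 1/2" "c > 4 / ?w" and X: "X \<in> carrier_mat n d" and rank: "vec_space.rank n X = r"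
    and ind: "\<forall>J. J \<subseteq> {..<d} \<and> card J = r \<longrightarrow> cols_lin_indpt X J"
    and sel: "penalized_ml_selection X c r bhat Mhat" by blast+
  assume d0: "1 \<le> d0 \<and> d0 \<le> r"
  assume "\<beta> \<in> carrier_vec d \<and> l0_norm \<beta> \<le> d0 \<and>
    (\<forall>i<n. \<delta> < p i \<and> p i < 1 - \<delta> \<and> ln (p i / (1 - p i)) = \<beta> \<bullet> row X i)"
  then have \<beta>: "\<beta> \<in> carrier_vec d" "l0_norm \<beta> \<le> d0"
    and p: "\<And>i. i < n \<Longrightarrow> \<delta> < p i \<and> p i < 1 - \<delta> \<and> ln (p i / (1 - p i)) = \<beta> \<bullet> row X i" by blast+
  define l where "l = 9/20 * ?w"
  have w: "0 < ?w" "?w \<le> 1" using \<delta> mult_mono[of \<delta> 1 "1 - \<delta>" 1] by auto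
  have cw: "4 < c * ?w" using \<delta>(3) w(1) by (simp add: pos_divide_less_eq)
  have "0 < 4 / ?w" using w(1) by simp
  then have c: "0 < c" using \<delta>(3) by linarith
  have l: "0 < l" unfolding l_def by (intro mult_pos_pos w) simp
  have lc: "9/5 \<le> l * c"
  proof -
    have "l * c = 9/20 * (c * ?w)" by (simp add: l_def)
    then show ?thesis using cw by linarith
  qed
  have "180 / l \<le> 100 * c"
  proof -
    have "180 / l = 100 * (4 / ?w)" by (simp add: l_def)
    then show ?thesis using \<delta>(3) by simp
  qed
  have rd: "r \<le> d" using rank_le_dim_col[OF X] rank by simp
  have R: "1 \<le> ?R"
  proof -
    have "1 \<le> ln (real d * exp 1 / real d0)" using d0 rd by (simp add: ln_div ln_mult)
    then have "1 * 1 \<le> real d0 * ln (real d * exp 1 / real d0)" using d0 by (intro mult_mono) auto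
    then show ?thesis using d0 by simp
  qed
  have pl: "0 < p i \<and> p i < 1 \<and> ln (p i / (1 - p i)) = \<beta> \<bullet> row X i \<and> l \<le> 9/20 * p i * (1 - p i)" if i: "i < n" for i
  proof -
    have "0 \<le> (p i - \<delta>) * (1 - \<delta> - p i)" using p[OF i] by (intro mult_nonneg_nonneg) auto
    then have "?w \<le> p i * (1 - p i)" by (simp add: algebra_simps)
    then show ?thesis using p[OF i] \<delta> by (auto simp: l_def)
  qed
  show "excess_risk X p (\<lambda>y. plug_in (bhat y (Mhat y))) (bayes \<beta>)
    \<le> 2 * sqrt (10099 * (\<bar>c\<bar> + 1)) * sqrt (1 / ?w * (?R / real n))"
  proof (cases "n = 0")
    case True
    then show ?thesis using X by (simp add: excess_risk_def misclass_error_def)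
  next
    case False
    let ?B = "100 * (99/100 * c * ?R + 180 / l)"
    have B: "0 < ?B" using c R l by (intro mult_pos_pos add_nonneg_pos) auto
    have "?B \<le> 10099 * (c * ?R)"
    proof -
      have "c * 1 \<le> c * ?R" using c R by (intro mult_left_mono) auto
      then show ?thesis using \<open>180 / l \<le> 100 * c\<close> by (simp only: mult.assoc) argo
    qed
    also have "\<dots> \<le> 10099 * (\<bar>c\<bar> + 1) * (1 / ?w * ?R)"
    proof -
      have "1 \<le> 1 / ?w" using w by simp
      then have "1 * ?R \<le> 1 / ?w * ?R" using R by (intro mult_right_mono) auto
      then have "c * ?R \<le> (\<bar>c\<bar> + 1) * (1 / ?w * ?R)" using c R by (intro mult_mono) auto
      then show ?thesis by (simp only: mult.assoc)
    qed
    finally have "?B / real n \<le> 10099 * (\<bar>c\<bar> + 1) * (1 / ?w * ?R) / real n" by (rule divide_right_mono) simp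
    then have BR: "?B / real n \<le> 10099 * (\<bar>c\<bar> + 1) * (1 / ?w * (?R / real n))" by (simp only: times_divide_eq_right)
    have "excess_risk X p (\<lambda>y. plug_in (bhat y (Mhat y))) (bayes \<beta>) \<le> 2 * sqrt (?B / real n)"
      using X False pl d0 \<beta> B by (intro excess_risk_le[OF _ _ _ refl disagreement_expectation[OF X rank ind sel \<beta>(1) pl l lc]]) auto
    also have "\<dots> \<le> 2 * sqrt (10099 * (\<bar>c\<bar> + 1) * (1 / ?w * (?R / real n)))"
      using BR by simp
    finally show ?thesis by (simp only: real_sqrt_mult mult.assoc)
  qed
qed simp

end
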